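(* Let $\mathbb{A}$ be a double category with a choice of companions $f_*$ for all horizontal arrows $f$ such that $(1_A)_*=\mathrm{id}_A$, and let $\mathbb{A}^{ret}$ be its double category of retrocells. Then: (1) $\mathbb{A}^{ret}$ has a canonical choice of companions. (2) There is a canonical isomorphism of double categories with companions $\mathbb{A}\xrightarrow{\ \cong\ }\mathbb{A}^{ret\,ret}=(\mathbb{A}^{ret})^{ret}$ which is the identity on objects and on horizontal and vertical arrows.
   Context: Double categories. A double category $\mathbb{A}$ has objects, horizontal arrows (composed strictly: composite $gf$, identity $1_A$), vertical arrows $v\colon A\nrightarrow C$ (composite $w\bullet v$ meaning $v$ first, identity $\mathrm{id}_A$; vertical composition is associative up to coherent isomorphism, vertical identities are taken strict) and cells. A cell has a top $f\colon A\to B$, a bottom $g\colon C\to D$ (horizontal arrows), a left side $v\colon A\nrightarrow C$ and a right side $w\colon B\nrightarrow D$ (vertical arrows). $\alpha\mid\beta$ denotes horizontal pasting ($\alpha$ left of $\beta$) and $\frac{\alpha}{\beta}$ vertical pasting ($\alpha$ above $\beta$); $1_v$ is the horizontal identity cell on $v$ and $\mathrm{id}_f$ the vertical identity cell on $f$. A globular cell $v\Rightarrow w$ is a cell with left $v$, right $w$ and identity top and bottom; globular cells are the 2-cells of the vertical bicategory $\mathcal{V}ert\,\mathbb{A}$ of $\mathbb{A}$. Associativity isomorphisms are suppressed. Companions. A companion of $f\colon A\to B$ is a vertical arrow $f_*\colon A\nrightarrow B$ with binding cells $\psi_f$ (top $1_A$, left $\mathrm{id}_A$, right $f_*$, bottom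 $f$) and $\chi_f$ (top $f$, left $f_*$, right $\mathrm{id}_B$, bottom $1_B$) with $\psi_f\mid\chi_f=\mathrm{id}_f$ and $\frac{\psi_f}{\chi_f}=1_{f_*}$. The chosen companion of $1_A$ is $(\mathrm{id}_A,1_{\mathrm{id}_A},1_{\mathrm{id}_A})$. There are canonical globular isomorphisms $(hf)_*\cong h_*\bullet f_*$ determined by the binding cells. The double category $\mathbb{A}^{ret}$ has the same objects, horizontal and vertical arrows as $\mathbb{A}$; its cells are retrocells: a retrocell with top $f\colon A\to B$, left $v\colon A\nrightarrow C$, right $w\colon B\nrightarrow D$, bottom $g\colon C\to D$ is a globular cell $w\bullet f_*\Rightarrow g_*\bullet v$ of $\mathbb{A}$. Horizontal composite of $\alpha\colon w\bullet f_*\Rightarrow g_*\bullet v$ and $\beta\colon x\bullet h_*\Rightarrow k_*\bullet w$: $x\bullet (hf)_*\cong x\bullet h_*\bullet f_*\Rightarrow k_*\bullet w\bullet f_*\Rightarrow k_*\bullet g_*\bullet v\cong (kg)_*\bullet v$. Vertical composite of $\alpha\colon w\bullet f_*\Rightarrow g_*\bullet v$ and $\alpha'\colon w'\bullet g_*\Rightarrow h_*\bullet v'$: $w'\bullet w\bullet f_*\Rightarrow w'\bullet g_*\bullet v\Rightarrow h_*\bullet v'\bullet v$. Identities are the identity globular cells on $v$ and on $f_*$. The canonical choice of companions in $\mathbb{A}^{ret}$ (used to form $\mathbb{A}^{ret\,ret}$): the companion of $f\colon A\to B$ in $\mathbb{A}^{ret}$ is the same vertical arrow $f_*$, both binding retrocells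 being given by the identity globular cell $f_*\Rightarrow f_*$. *)

theory Defs
  imports Main
begin

text \<open>
  Double categories that are strict in the horizontal direction and weak in the vertical one:
  vertical composition is associative up to coherent isomorphism, while vertical identities are
  strict. Cells are written as
  \<^verbatim>\<open>
           f = ctop
         X --------> Y
         |           |
  v=cleft|           |w=cright
         V           V
         Z --------> W
           g = cbot
\<close>
  Both \<open>hcomp g f\<close> and \<open>vcomp w v\<close> are in applicative order (second argument first), whereas
  \<open>\<alpha> \<parallel> \<beta>\<close> pastes \<open>\<alpha>\<close> to the left of \<open>\<beta>\<close> and \<open>\<alpha> \<oslash> \<beta>\<close> pastes \<open>\<alpha>\<close> above \<open>\<beta>\<close> (the fraction
  notation). Operations are only meaningful on the carriers.
\<close>

record ('o, 'h, 'v, 'c) dblcat =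
  Obj :: "'o set"
  Hor :: "'h set"
  Ver :: "'v set"
  Cell :: "'c set"
  hdom :: "'h \<Rightarrow> 'o"
  hcod :: "'h \<Rightarrow> 'o"
  hid :: "'o \<Rightarrow> 'h"
  hcomp :: "'h \<Rightarrow> 'h \<Rightarrow> 'h" (infixl "\<cdot>\<index>" 75)
  vdom :: "'v \<Rightarrow> 'o"
  vcod :: "'v \<Rightarrow> 'o"
  vid :: "'o \<Rightarrow> 'v"
  vcomp :: "'v \<Rightarrow> 'v \<Rightarrow> 'v" (infixl "\<bullet>\<index>" 75)
  ctop :: "'c \<Rightarrow> 'h"
  cbot :: "'c \<Rightarrow> 'h"
  cleft :: "'c \<Rightarrow> 'v"
  cright :: "'c \<Rightarrow> 'v"
  hidc :: "'v \<Rightarrow> 'c"   \<comment> \<open>the horizontal identity cell on a vertical arrow\<close>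
  vidc :: "'h \<Rightarrow> 'c"   \<comment> \<open>the vertical identity cell on a horizontal arrow\<close>
  hpaste :: "'c \<Rightarrow> 'c \<Rightarrow> 'c" (infixl "\<parallel>\<index>" 65)
  vpaste :: "'c \<Rightarrow> 'c \<Rightarrow> 'c" (infixl "\<oslash>\<index>" 70)
  assoc :: "'v \<Rightarrow> 'v \<Rightarrow> 'v \<Rightarrow> 'c"   \<comment> \<open>\<open>assoc x w v : (x \<bullet> w) \<bullet> v \<Rightarrow> x \<bullet> (w \<bullet> v)\<close>\<close>

definition is_globular :: "('o, 'h, 'v, 'c) dblcat \<Rightarrow> 'c \<Rightarrow> 'v \<Rightarrow> 'v \<Rightarrow> bool" where
  "is_globular A \<alpha> v w \<longleftrightarrow>
     \<alpha> \<in> Cell A \<and> cleft A \<alpha> = v \<and> cright A \<alpha> = w \<and>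
     ctop A \<alpha> = hid A (vdom A v) \<and> cbot A \<alpha> = hid A (vcod A v)"

definition is_hinverse :: "('o, 'h, 'v, 'c) dblcat \<Rightarrow> 'c \<Rightarrow> 'c \<Rightarrow> bool" where
  "is_hinverse A \<alpha> \<beta> \<longleftrightarrow>
     \<beta> \<in> Cell A \<and> cleft A \<beta> = cright A \<alpha> \<and> cright A \<beta> = cleft A \<alpha> \<and>
     \<alpha> \<parallel>\<^bsub>A\<^esub> \<beta> = hidc A (cleft A \<alpha>) \<and> \<beta> \<parallel>\<^bsub>A\<^esub> \<alpha> = hidc A (cright A \<alpha>)"

definition hinv :: "('o, 'h, 'v, 'c) dblcat \<Rightarrow> 'c \<Rightarrow> 'c" where
  "hinv A \<alpha> = (THE \<beta>. is_hinverse A \<alpha> \<beta>)"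

text \<open>
  As the unit isomorphisms of the vertical bicategory are identities, the triangle law says that
  \<open>assoc w id v\<close> is an identity cell.
\<close>

locale double_category =
  fixes A :: "('o, 'h, 'v, 'c) dblcat" (structure)
  \<comment> \<open>the category of objects and horizontal arrows\<close>
  assumes hdom_in: "f \<in> Hor A \<Longrightarrow> hdom A f \<in> Obj A"
    and hcod_in: "f \<in> Hor A \<Longrightarrow> hcod A f \<in> Obj A"
    and hid_in: "X \<in> Obj A \<Longrightarrow> hid A X \<in> Hor A"
    and hid_dom: "X \<in> Obj A \<Longrightarrow> hdom A (hid A X) = X"
    and hid_cod: "X \<in> Obj A \<Longrightarrow> hcod A (hid A X) = X"
    and hcomp_in: "\<lbrakk>f \<in> Hor A; h \<in> Hor A; hcod A f = hdom A h\<rbrakk> \<Longrightarrow> h \<cdot> f \<in> Hor A"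
    and hcomp_dom: "\<lbrakk>f \<in> Hor A; h \<in> Hor A; hcod A f = hdom A h\<rbrakk> \<Longrightarrow> hdom A (h \<cdot> f) = hdom A f"
    and hcomp_cod: "\<lbrakk>f \<in> Hor A; h \<in> Hor A; hcod A f = hdom A h\<rbrakk> \<Longrightarrow> hcod A (h \<cdot> f) = hcod A h"
    and hcomp_hid_right: "f \<in> Hor A \<Longrightarrow> f \<cdot> hid A (hdom A f) = f"
    and hcomp_hid_left: "f \<in> Hor A \<Longrightarrow> hid A (hcod A f) \<cdot> f = f"
    and hcomp_assoc: "\<lbrakk>f \<in> Hor A; h \<in> Hor A; k \<in> Hor A; hcod A f = hdom A h; hcod A h = hdom A k\<rbrakk>
      \<Longrightarrow> k \<cdot> h \<cdot> f = k \<cdot> (h \<cdot> f)"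
  \<comment> \<open>vertical arrows\<close>
    and vdom_in: "v \<in> Ver A \<Longrightarrow> vdom A v \<in> Obj A"
    and vcod_in: "v \<in> Ver A \<Longrightarrow> vcod A v \<in> Obj A"
    and vid_in: "X \<in> Obj A \<Longrightarrow> vid A X \<in> Ver A"
    and vid_dom: "X \<in> Obj A \<Longrightarrow> vdom A (vid A X) = X"
    and vid_cod: "X \<in> Obj A \<Longrightarrow> vcod A (vid A X) = X"
    and vcomp_in: "\<lbrakk>v \<in> Ver A; w \<in> Ver A; vcod A v = vdom A w\<rbrakk> \<Longrightarrow> w \<bullet> v \<in> Ver A"
    and vcomp_dom: "\<lbrakk>v \<in> Ver A; w \<in> Ver A; vcod A v = vdom A w\<rbrakk> \<Longrightarrow> vdom A (w \<bullet> v) = vdom A v"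
    and vcomp_cod: "\<lbrakk>v \<in> Ver A; w \<in> Ver A; vcod A v = vdom A w\<rbrakk> \<Longrightarrow> vcod A (w \<bullet> v) = vcod A w"
    and vcomp_vid_right: "v \<in> Ver A \<Longrightarrow> v \<bullet> vid A (vdom A v) = v"
    and vcomp_vid_left: "v \<in> Ver A \<Longrightarrow> vid A (vcod A v) \<bullet> v = v"
  \<comment> \<open>boundaries of cells\<close>
    and ctop_in: "\<alpha> \<in> Cell A \<Longrightarrow> ctop A \<alpha> \<in> Hor A"
    and cbot_in: "\<alpha> \<in> Cell A \<Longrightarrow> cbot A \<alpha> \<in> Hor A"
    and cleft_in: "\<alpha> \<in> Cell A \<Longrightarrow> cleft A \<alpha> \<in> Ver A"
    and cright_in: "\<alpha> \<in> Cell A \<Longrightarrow> cright A \<alpha> \<in> Ver A"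
    and corner_tl: "\<alpha> \<in> Cell A \<Longrightarrow> hdom A (ctop A \<alpha>) = vdom A (cleft A \<alpha>)"
    and corner_tr: "\<alpha> \<in> Cell A \<Longrightarrow> hcod A (ctop A \<alpha>) = vdom A (cright A \<alpha>)"
    and corner_bl: "\<alpha> \<in> Cell A \<Longrightarrow> hdom A (cbot A \<alpha>) = vcod A (cleft A \<alpha>)"
    and corner_br: "\<alpha> \<in> Cell A \<Longrightarrow> hcod A (cbot A \<alpha>) = vcod A (cright A \<alpha>)"
  \<comment> \<open>the category of vertical arrows and cells\<close>
    and hidc_globular: "v \<in> Ver A \<Longrightarrow> is_globular A (hidc A v) v v"
    and hpaste_in: "\<lbrakk>\<alpha> \<in> Cell A; \<beta> \<in> Cell A; cright A \<alpha> = cleft A \<beta>\<rbrakk> \<Longrightarrow> \<alpha> \<parallel> \<beta> \<in> Cell A"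
    and hpaste_top: "\<lbrakk>\<alpha> \<in> Cell A; \<beta> \<in> Cell A; cright A \<alpha> = cleft A \<beta>\<rbrakk>
      \<Longrightarrow> ctop A (\<alpha> \<parallel> \<beta>) = ctop A \<beta> \<cdot> ctop A \<alpha>"
    and hpaste_bot: "\<lbrakk>\<alpha> \<in> Cell A; \<beta> \<in> Cell A; cright A \<alpha> = cleft A \<beta>\<rbrakk>
      \<Longrightarrow> cbot A (\<alpha> \<parallel> \<beta>) = cbot A \<beta> \<cdot> cbot A \<alpha>"
    and hpaste_left: "\<lbrakk>\<alpha> \<in> Cell A; \<beta> \<in> Cell A; cright A \<alpha> = cleft A \<beta>\<rbrakk>
      \<Longrightarrow> cleft A (\<alpha> \<parallel> \<beta>) = cleft A \<alpha>"
    and hpaste_right: "\<lbrakk>\<alpha> \<in> Cell A; \<beta> \<in> Cell A; cright A \<alpha> = cleft A \<beta>\<rbrakk>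
      \<Longrightarrow> cright A (\<alpha> \<parallel> \<beta>) = cright A \<beta>"
    and hpaste_hidc_left: "\<alpha> \<in> Cell A \<Longrightarrow> hidc A (cleft A \<alpha>) \<parallel> \<alpha> = \<alpha>"
    and hpaste_hidc_right: "\<alpha> \<in> Cell A \<Longrightarrow> \<alpha> \<parallel> hidc A (cright A \<alpha>) = \<alpha>"
    and hpaste_assoc: "\<lbrakk>\<alpha> \<in> Cell A; \<beta> \<in> Cell A; \<gamma> \<in> Cell A;
        cright A \<alpha> = cleft A \<beta>; cright A \<beta> = cleft A \<gamma>\<rbrakk> \<Longrightarrow> \<alpha> \<parallel> \<beta> \<parallel> \<gamma> = \<alpha> \<parallel> (\<beta> \<parallel> \<gamma>)"
  \<comment> \<open>vertical pasting, functorial with respect to horizontal pasting\<close>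
    and vidc_in: "f \<in> Hor A \<Longrightarrow> vidc A f \<in> Cell A"
    and vidc_top: "f \<in> Hor A \<Longrightarrow> ctop A (vidc A f) = f"
    and vidc_bot: "f \<in> Hor A \<Longrightarrow> cbot A (vidc A f) = f"
    and vidc_left: "f \<in> Hor A \<Longrightarrow> cleft A (vidc A f) = vid A (hdom A f)"
    and vidc_right: "f \<in> Hor A \<Longrightarrow> cright A (vidc A f) = vid A (hcod A f)"
    and vpaste_in: "\<lbrakk>\<alpha> \<in> Cell A; \<beta> \<in> Cell A; cbot A \<alpha> = ctop A \<beta>\<rbrakk> \<Longrightarrow> \<alpha> \<oslash> \<beta> \<in> Cell A"
    and vpaste_top: "\<lbrakk>\<alpha> \<in> Cell A; \<beta> \<in> Cell A; cbot A \<alpha> = ctop A \<beta>\<rbrakk>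
      \<Longrightarrow> ctop A (\<alpha> \<oslash> \<beta>) = ctop A \<alpha>"
    and vpaste_bot: "\<lbrakk>\<alpha> \<in> Cell A; \<beta> \<in> Cell A; cbot A \<alpha> = ctop A \<beta>\<rbrakk>
      \<Longrightarrow> cbot A (\<alpha> \<oslash> \<beta>) = cbot A \<beta>"
    and vpaste_left: "\<lbrakk>\<alpha> \<in> Cell A; \<beta> \<in> Cell A; cbot A \<alpha> = ctop A \<beta>\<rbrakk>
      \<Longrightarrow> cleft A (\<alpha> \<oslash> \<beta>) = cleft A \<beta> \<bullet> cleft A \<alpha>"
    and vpaste_right: "\<lbrakk>\<alpha> \<in> Cell A; \<beta> \<in> Cell A; cbot A \<alpha> = ctop A \<beta>\<rbrakk>
      \<Longrightarrow> cright A (\<alpha> \<oslash> \<beta>) = cright A \<beta> \<bullet> cright A \<alpha>"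
    and interchange: "\<lbrakk>\<alpha> \<in> Cell A; \<beta> \<in> Cell A; \<gamma> \<in> Cell A; \<delta> \<in> Cell A;
        cright A \<alpha> = cleft A \<beta>; cright A \<gamma> = cleft A \<delta>;
        cbot A \<alpha> = ctop A \<gamma>; cbot A \<beta> = ctop A \<delta>\<rbrakk>
      \<Longrightarrow> (\<alpha> \<parallel> \<beta>) \<oslash> (\<gamma> \<parallel> \<delta>) = (\<alpha> \<oslash> \<gamma>) \<parallel> (\<beta> \<oslash> \<delta>)"
    and vpaste_hidc: "\<lbrakk>v \<in> Ver A; w \<in> Ver A; vcod A v = vdom A w\<rbrakk>
      \<Longrightarrow> hidc A v \<oslash> hidc A w = hidc A (w \<bullet> v)"
    and hpaste_vidc: "\<lbrakk>f \<in> Hor A; h \<in> Hor A; hcod A f = hdom A h\<rbrakk>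
      \<Longrightarrow> vidc A f \<parallel> vidc A h = vidc A (h \<cdot> f)"
    and hidc_vid: "X \<in> Obj A \<Longrightarrow> hidc A (vid A X) = vidc A (hid A X)"
    and vpaste_vidc_top: "\<alpha> \<in> Cell A \<Longrightarrow> vidc A (ctop A \<alpha>) \<oslash> \<alpha> = \<alpha>"
    and vpaste_vidc_bot: "\<alpha> \<in> Cell A \<Longrightarrow> \<alpha> \<oslash> vidc A (cbot A \<alpha>) = \<alpha>"
  \<comment> \<open>associativity isomorphisms: invertibility, naturality, pentagon, triangle\<close>
    and assoc_globular: "\<lbrakk>v \<in> Ver A; w \<in> Ver A; x \<in> Ver A; vcod A v = vdom A w; vcod A w = vdom A x\<rbrakk>
      \<Longrightarrow> is_globular A (assoc A x w v) (x \<bullet> w \<bullet> v) (x \<bullet> (w \<bullet> v))"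
    and assoc_iso: "\<lbrakk>v \<in> Ver A; w \<in> Ver A; x \<in> Ver A; vcod A v = vdom A w; vcod A w = vdom A x\<rbrakk>
      \<Longrightarrow> \<exists>\<beta>. is_hinverse A (assoc A x w v) \<beta>"
    and assoc_natural: "\<lbrakk>\<alpha> \<in> Cell A; \<beta> \<in> Cell A; \<gamma> \<in> Cell A;
        cbot A \<alpha> = ctop A \<beta>; cbot A \<beta> = ctop A \<gamma>\<rbrakk>
      \<Longrightarrow> \<alpha> \<oslash> (\<beta> \<oslash> \<gamma>) \<parallel> assoc A (cright A \<gamma>) (cright A \<beta>) (cright A \<alpha>) =
          assoc A (cleft A \<gamma>) (cleft A \<beta>) (cleft A \<alpha>) \<parallel> \<alpha> \<oslash> \<beta> \<oslash> \<gamma>"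
    and pentagon: "\<lbrakk>v \<in> Ver A; w \<in> Ver A; x \<in> Ver A; y \<in> Ver A;
        vcod A v = vdom A w; vcod A w = vdom A x; vcod A x = vdom A y\<rbrakk>
      \<Longrightarrow> assoc A (y \<bullet> x) w v \<parallel> assoc A y x (w \<bullet> v) =
          hidc A v \<oslash> assoc A y x w \<parallel> assoc A y (x \<bullet> w) v \<parallel> assoc A x w v \<oslash> hidc A y"
    and triangle: "\<lbrakk>v \<in> Ver A; w \<in> Ver A; vcod A v = vdom A w\<rbrakk>
      \<Longrightarrow> assoc A w (vid A (vcod A v)) v = hidc A (w \<bullet> v)"


record ('h, 'v, 'c) companions =
  cmp :: "'h \<Rightarrow> 'v"
  psi :: "'h \<Rightarrow> 'c"
  chi :: "'h \<Rightarrow> 'c"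

definition is_companion ::
  "('o, 'h, 'v, 'c) dblcat \<Rightarrow> 'h \<Rightarrow> 'v \<Rightarrow> 'c \<Rightarrow> 'c \<Rightarrow> bool" where
  "is_companion A f v \<psi> \<chi> \<longleftrightarrow>
     v \<in> Ver A \<and> vdom A v = hdom A f \<and> vcod A v = hcod A f \<and>
     \<psi> \<in> Cell A \<and> ctop A \<psi> = hid A (hdom A f) \<and> cleft A \<psi> = vid A (hdom A f) \<and>
       cright A \<psi> = v \<and> cbot A \<psi> = f \<and>
     \<chi> \<in> Cell A \<and> ctop A \<chi> = f \<and> cleft A \<chi> = v \<and>
       cright A \<chi> = vid A (hcod A f) \<and> cbot A \<chi> = hid A (hcod A f) \<and>
     \<psi> \<parallel>\<^bsub>A\<^esub> \<chi> = vidc A f \<and> \<psi> \<oslash>\<^bsub>A\<^esub> \<chi> = hidc A v"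

definition companion_choice ::
  "('o, 'h, 'v, 'c) dblcat \<Rightarrow> ('h, 'v, 'c) companions \<Rightarrow> bool" where
  "companion_choice A K \<longleftrightarrow>
     (\<forall>f \<in> Hor A. is_companion A f (cmp K f) (psi K f) (chi K f)) \<and>
     (\<forall>X \<in> Obj A. cmp K (hid A X) = vid A X \<and>
        psi K (hid A X) = hidc A (vid A X) \<and> chi K (hid A X) = hidc A (vid A X))"

text \<open>
  The canonical isomorphism \<open>(h \<cdot> f)\<^sub>* \<Rightarrow> h\<^sub>* \<bullet> f\<^sub>*\<close> and its inverse. For example, the left side of
  \<open>cmp_split\<close> is \<open>(h \<cdot> f)\<^sub>* \<bullet> (id \<bullet> id)\<close> and its right side is \<open>id \<bullet> (h\<^sub>* \<bullet> f\<^sub>*)\<close>; strictness of vertical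
  identities makes it a globular cell.
\<close>

definition cmp_split ::
  "('o, 'h, 'v, 'c) dblcat \<Rightarrow> ('h, 'v, 'c) companions \<Rightarrow> 'h \<Rightarrow> 'h \<Rightarrow> 'c" where
  "cmp_split A K h f =
     psi K f \<oslash>\<^bsub>A\<^esub> (vidc A f \<parallel>\<^bsub>A\<^esub> psi K h) \<oslash>\<^bsub>A\<^esub> chi K (h \<cdot>\<^bsub>A\<^esub> f)"

definition cmp_join ::
  "('o, 'h, 'v, 'c) dblcat \<Rightarrow> ('h, 'v, 'c) companions \<Rightarrow> 'h \<Rightarrow> 'h \<Rightarrow> 'c" where
  "cmp_join A K h f =
     psi K (h \<cdot>\<^bsub>A\<^esub> f) \<oslash>\<^bsub>A\<^esub> ((chi K f \<parallel>\<^bsub>A\<^esub> vidc A h) \<oslash>\<^bsub>A\<^esub> chi K h)"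


text \<open>
  A retrocell records its boundary, since the underlying globular cell does not determine it.
\<close>

datatype ('h, 'v, 'c) retrocell =
  Retrocell (rtop: 'h) (rleft: 'v) (rright: 'v) (rbot: 'h) (rcell: 'c)

definition retrocells ::
  "('o, 'h, 'v, 'c) dblcat \<Rightarrow> ('h, 'v, 'c) companions \<Rightarrow> ('h, 'v, 'c) retrocell set" where
  "retrocells A K =
     {Retrocell f v w g \<alpha> | f v w g \<alpha>.
        f \<in> Hor A \<and> g \<in> Hor A \<and> v \<in> Ver A \<and> w \<in> Ver A \<and>
        hdom A f = vdom A v \<and> hcod A f = vdom A w \<and>
        hdom A g = vcod A v \<and> hcod A g = vcod A w \<and>
        is_globular A \<alpha> (w \<bullet>\<^bsub>A\<^esub> cmp K f) (cmp K g \<bullet>\<^bsub>A\<^esub> v)}"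

text \<open>
  The following two composites insert the suppressed associativity isomorphisms. Horizontal pasting
  of globular cells is composition of 2-cells in the vertical bicategory, in diagrammatic order;
  whiskering of \<open>\<sigma>\<close> by \<open>x\<close> applied after \<open>\<sigma>\<close> is \<open>\<sigma> \<oslash> hidc x\<close>.

  \<open>ret_hpaste\<close>: for \<open>\<alpha> : w \<bullet> f\<^sub>* \<Rightarrow> g\<^sub>* \<bullet> v\<close> and \<open>\<beta> : x \<bullet> h\<^sub>* \<Rightarrow> k\<^sub>* \<bullet> w\<close>, the composite
  \<open>x \<bullet> (h \<cdot> f)\<^sub>* \<Rightarrow> x \<bullet> (h\<^sub>* \<bullet> f\<^sub>*) \<Rightarrow> (x \<bullet> h\<^sub>*) \<bullet> f\<^sub>* \<Rightarrow> (k\<^sub>* \<bullet> w) \<bullet> f\<^sub>* \<Rightarrow> k\<^sub>* \<bullet> (w \<bullet> f\<^sub>*) \<Rightarrow> k\<^sub>* \<bullet> (g\<^sub>* \<bullet> v)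
    \<Rightarrow> (k\<^sub>* \<bullet> g\<^sub>*) \<bullet> v \<Rightarrow> (k \<cdot> g)\<^sub>* \<bullet> v\<close>.

  \<open>ret_vpaste\<close>: for \<open>\<alpha> : w \<bullet> f\<^sub>* \<Rightarrow> g\<^sub>* \<bullet> v\<close> and \<open>\<alpha>' : w' \<bullet> g\<^sub>* \<Rightarrow> h\<^sub>* \<bullet> v'\<close>, the composite
  \<open>(w' \<bullet> w) \<bullet> f\<^sub>* \<Rightarrow> w' \<bullet> (w \<bullet> f\<^sub>*) \<Rightarrow> w' \<bullet> (g\<^sub>* \<bullet> v) \<Rightarrow> (w' \<bullet> g\<^sub>*) \<bullet> v \<Rightarrow> (h\<^sub>* \<bullet> v') \<bullet> v \<Rightarrow> h\<^sub>* \<bullet> (v' \<bullet> v)\<close>.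
\<close>

fun ret_hpaste ::
  "('o, 'h, 'v, 'c) dblcat \<Rightarrow> ('h, 'v, 'c) companions \<Rightarrow>
   ('h, 'v, 'c) retrocell \<Rightarrow> ('h, 'v, 'c) retrocell \<Rightarrow> ('h, 'v, 'c) retrocell" where
  "ret_hpaste A K (Retrocell f v w g \<alpha>) (Retrocell h w' x k \<beta>) =
     Retrocell (h \<cdot>\<^bsub>A\<^esub> f) v x (k \<cdot>\<^bsub>A\<^esub> g)
       (cmp_split A K h f \<oslash>\<^bsub>A\<^esub> hidc A x
        \<parallel>\<^bsub>A\<^esub> hinv A (assoc A x (cmp K h) (cmp K f))
        \<parallel>\<^bsub>A\<^esub> hidc A (cmp K f) \<oslash>\<^bsub>A\<^esub> \<beta>
        \<parallel>\<^bsub>A\<^esub> assoc A (cmp K k) w (cmp K f)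
        \<parallel>\<^bsub>A\<^esub> \<alpha> \<oslash>\<^bsub>A\<^esub> hidc A (cmp K k)
        \<parallel>\<^bsub>A\<^esub> hinv A (assoc A (cmp K k) (cmp K g) v)
        \<parallel>\<^bsub>A\<^esub> hidc A v \<oslash>\<^bsub>A\<^esub> cmp_join A K k g)"

fun ret_vpaste ::
  "('o, 'h, 'v, 'c) dblcat \<Rightarrow> ('h, 'v, 'c) companions \<Rightarrow>
   ('h, 'v, 'c) retrocell \<Rightarrow> ('h, 'v, 'c) retrocell \<Rightarrow> ('h, 'v, 'c) retrocell" where
  "ret_vpaste A K (Retrocell f v w g \<alpha>) (Retrocell g' v' w' h \<alpha>') =
     Retrocell f (v' \<bullet>\<^bsub>A\<^esub> v) (w' \<bullet>\<^bsub>A\<^esub> w) h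
       (assoc A w' w (cmp K f)
        \<parallel>\<^bsub>A\<^esub> \<alpha> \<oslash>\<^bsub>A\<^esub> hidc A w'
        \<parallel>\<^bsub>A\<^esub> hinv A (assoc A w' (cmp K g) v)
        \<parallel>\<^bsub>A\<^esub> hidc A v \<oslash>\<^bsub>A\<^esub> \<alpha>'
        \<parallel>\<^bsub>A\<^esub> assoc A (cmp K h) v' v)"

text \<open>
  A globular retrocell \<open>v \<Rightarrow> w\<close> is a globular cell \<open>w \<Rightarrow> v\<close>; this is why the associativity
  isomorphisms of \<open>ret A K\<close> are given by the inverses of those of \<open>A\<close>.
\<close>

definition ret ::
  "('o, 'h, 'v, 'c) dblcat \<Rightarrow> ('h, 'v, 'c) companions \<Rightarrow>
   ('o, 'h, 'v, ('h, 'v, 'c) retrocell) dblcat" where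
  "ret A K =
     \<lparr>Obj = Obj A, Hor = Hor A, Ver = Ver A, Cell = retrocells A K,
      hdom = hdom A, hcod = hcod A, hid = hid A, hcomp = hcomp A,
      vdom = vdom A, vcod = vcod A, vid = vid A, vcomp = vcomp A,
      ctop = rtop, cbot = rbot, cleft = rleft, cright = rright,
      hidc = (\<lambda>v. Retrocell (hid A (vdom A v)) v v (hid A (vcod A v)) (hidc A v)),
      vidc = (\<lambda>f. Retrocell f (vid A (hdom A f)) (vid A (hcod A f)) f (hidc A (cmp K f))),
      hpaste = ret_hpaste A K, vpaste = ret_vpaste A K,
      assoc = (\<lambda>x w v. Retrocell (hid A (vdom A v)) (x \<bullet>\<^bsub>A\<^esub> w \<bullet>\<^bsub>A\<^esub> v) (x \<bullet>\<^bsub>A\<^esub> (w \<bullet>\<^bsub>A\<^esub> v))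
        (hid A (vcod A x)) (hinv A (assoc A x w v)))\<rparr>"

definition ret_companions ::
  "('o, 'h, 'v, 'c) dblcat \<Rightarrow> ('h, 'v, 'c) companions \<Rightarrow>
   ('h, 'v, ('h, 'v, 'c) retrocell) companions" where
  "ret_companions A K =
     \<lparr>cmp = cmp K,
      psi = (\<lambda>f. Retrocell (hid A (hdom A f)) (vid A (hdom A f)) (cmp K f) f (hidc A (cmp K f))),
      chi = (\<lambda>f. Retrocell f (cmp K f) (vid A (hcod A f)) (hid A (hcod A f)) (hidc A (cmp K f)))\<rparr>"


record ('o, 'h, 'v, 'c, 'p, 'i, 'w, 'd) dblmap =
  on_obj :: "'o \<Rightarrow> 'p"
  on_hor :: "'h \<Rightarrow> 'i"
  on_ver :: "'v \<Rightarrow> 'w"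
  on_cell :: "'c \<Rightarrow> 'd"

text \<open>Strict double functors.\<close>

locale double_functor =
  dom: double_category A + cod: double_category B
  for A :: "('o, 'h, 'v, 'c) dblcat" and B :: "('p, 'i, 'w, 'd) dblcat" +
  fixes F :: "('o, 'h, 'v, 'c, 'p, 'i, 'w, 'd) dblmap"
  assumes on_obj_in: "X \<in> Obj A \<Longrightarrow> on_obj F X \<in> Obj B"
    and on_hor_in: "f \<in> Hor A \<Longrightarrow> on_hor F f \<in> Hor B"
    and on_ver_in: "v \<in> Ver A \<Longrightarrow> on_ver F v \<in> Ver B"
    and on_cell_in: "\<alpha> \<in> Cell A \<Longrightarrow> on_cell F \<alpha> \<in> Cell B"
    and on_hdom: "f \<in> Hor A \<Longrightarrow> hdom B (on_hor F f) = on_obj F (hdom A f)"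
    and on_hcod: "f \<in> Hor A \<Longrightarrow> hcod B (on_hor F f) = on_obj F (hcod A f)"
    and on_hid: "X \<in> Obj A \<Longrightarrow> on_hor F (hid A X) = hid B (on_obj F X)"
    and on_hcomp: "\<lbrakk>f \<in> Hor A; h \<in> Hor A; hcod A f = hdom A h\<rbrakk>
      \<Longrightarrow> on_hor F (h \<cdot>\<^bsub>A\<^esub> f) = on_hor F h \<cdot>\<^bsub>B\<^esub> on_hor F f"
    and on_vdom: "v \<in> Ver A \<Longrightarrow> vdom B (on_ver F v) = on_obj F (vdom A v)"
    and on_vcod: "v \<in> Ver A \<Longrightarrow> vcod B (on_ver F v) = on_obj F (vcod A v)"
    and on_vid: "X \<in> Obj A \<Longrightarrow> on_ver F (vid A X) = vid B (on_obj F X)"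
    and on_vcomp: "\<lbrakk>v \<in> Ver A; w \<in> Ver A; vcod A v = vdom A w\<rbrakk>
      \<Longrightarrow> on_ver F (w \<bullet>\<^bsub>A\<^esub> v) = on_ver F w \<bullet>\<^bsub>B\<^esub> on_ver F v"
    and on_ctop: "\<alpha> \<in> Cell A \<Longrightarrow> ctop B (on_cell F \<alpha>) = on_hor F (ctop A \<alpha>)"
    and on_cbot: "\<alpha> \<in> Cell A \<Longrightarrow> cbot B (on_cell F \<alpha>) = on_hor F (cbot A \<alpha>)"
    and on_cleft: "\<alpha> \<in> Cell A \<Longrightarrow> cleft B (on_cell F \<alpha>) = on_ver F (cleft A \<alpha>)"
    and on_cright: "\<alpha> \<in> Cell A \<Longrightarrow> cright B (on_cell F \<alpha>) = on_ver F (cright A \<alpha>)"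
    and on_hidc: "v \<in> Ver A \<Longrightarrow> on_cell F (hidc A v) = hidc B (on_ver F v)"
    and on_vidc: "f \<in> Hor A \<Longrightarrow> on_cell F (vidc A f) = vidc B (on_hor F f)"
    and on_hpaste: "\<lbrakk>\<alpha> \<in> Cell A; \<beta> \<in> Cell A; cright A \<alpha> = cleft A \<beta>\<rbrakk>
      \<Longrightarrow> on_cell F (\<alpha> \<parallel>\<^bsub>A\<^esub> \<beta>) = on_cell F \<alpha> \<parallel>\<^bsub>B\<^esub> on_cell F \<beta>"
    and on_vpaste: "\<lbrakk>\<alpha> \<in> Cell A; \<beta> \<in> Cell A; cbot A \<alpha> = ctop A \<beta>\<rbrakk>
      \<Longrightarrow> on_cell F (\<alpha> \<oslash>\<^bsub>A\<^esub> \<beta>) = on_cell F \<alpha> \<oslash>\<^bsub>B\<^esub> on_cell F \<beta>"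
    and on_assoc: "\<lbrakk>v \<in> Ver A; w \<in> Ver A; x \<in> Ver A; vcod A v = vdom A w; vcod A w = vdom A x\<rbrakk>
      \<Longrightarrow> on_cell F (assoc A x w v) = assoc B (on_ver F x) (on_ver F w) (on_ver F v)"

definition preserves_companions ::
  "('o, 'h, 'v, 'c) dblcat \<Rightarrow> ('h, 'v, 'c) companions \<Rightarrow> ('i, 'w, 'd) companions \<Rightarrow>
   ('o, 'h, 'v, 'c, 'p, 'i, 'w, 'd) dblmap \<Rightarrow> bool" where
  "preserves_companions A K L F \<longleftrightarrow>
     (\<forall>f \<in> Hor A. on_ver F (cmp K f) = cmp L (on_hor F f) \<and>
        on_cell F (psi K f) = psi L (on_hor F f) \<and> on_cell F (chi K f) = chi L (on_hor F f))"

definition inverse_on ::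
  "('o, 'h, 'v, 'c) dblcat \<Rightarrow> ('o, 'h, 'v, 'c, 'p, 'i, 'w, 'd) dblmap \<Rightarrow>
   ('p, 'i, 'w, 'd, 'o, 'h, 'v, 'c) dblmap \<Rightarrow> bool" where
  "inverse_on A F G \<longleftrightarrow>
     (\<forall>X \<in> Obj A. on_obj G (on_obj F X) = X) \<and> (\<forall>f \<in> Hor A. on_hor G (on_hor F f) = f) \<and>
     (\<forall>v \<in> Ver A. on_ver G (on_ver F v) = v) \<and> (\<forall>\<alpha> \<in> Cell A. on_cell G (on_cell F \<alpha>) = \<alpha>)"

definition iso_with_companions ::
  "('o, 'h, 'v, 'c) dblcat \<Rightarrow> ('h, 'v, 'c) companions \<Rightarrow>
   ('p, 'i, 'w, 'd) dblcat \<Rightarrow> ('i, 'w, 'd) companions \<Rightarrow>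
   ('o, 'h, 'v, 'c, 'p, 'i, 'w, 'd) dblmap \<Rightarrow> bool" where
  "iso_with_companions A K B L F \<longleftrightarrow>
     companion_choice A K \<and> companion_choice B L \<and>
     double_functor A B F \<and> preserves_companions A K L F \<and>
     (\<exists>G. double_functor B A G \<and> preserves_companions B L K G \<and>
        inverse_on A F G \<and> inverse_on B G F)"

text \<open>
  The canonical comparison. A cell of \<open>A\<^sup>r\<^sup>e\<^sup>t\<^sup>r\<^sup>e\<^sup>t\<close> with top \<open>f\<close>, left \<open>v\<close>, right \<open>w\<close> and bottom \<open>g\<close> is a
  globular retrocell \<open>w \<bullet> f\<^sub>* \<Rightarrow> g\<^sub>* \<bullet> v\<close>, hence a globular cell \<open>g\<^sub>* \<bullet> v \<Rightarrow> w \<bullet> f\<^sub>*\<close> of \<open>A\<close>; the one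
  corresponding to \<open>\<alpha>\<close> is \<open>\<psi>\<^sub>f\<close> above \<open>\<alpha>\<close> above \<open>\<chi>\<^sub>g\<close>.
\<close>

definition companion_transpose ::
  "('o, 'h, 'v, 'c) dblcat \<Rightarrow> ('h, 'v, 'c) companions \<Rightarrow> 'c \<Rightarrow> 'c" where
  "companion_transpose A K \<alpha> = psi K (ctop A \<alpha>) \<oslash>\<^bsub>A\<^esub> \<alpha> \<oslash>\<^bsub>A\<^esub> chi K (cbot A \<alpha>)"

definition to_ret_ret ::
  "('o, 'h, 'v, 'c) dblcat \<Rightarrow> ('h, 'v, 'c) companions \<Rightarrow>
   ('o, 'h, 'v, 'c,
    'o, 'h, 'v, ('h, 'v, ('h, 'v, 'c) retrocell) retrocell) dblmap" where
  "to_ret_ret A K =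
     \<lparr>on_obj = (\<lambda>X. X), on_hor = (\<lambda>f. f), on_ver = (\<lambda>v. v),
      on_cell = (\<lambda>\<alpha>. let f = ctop A \<alpha>; v = cleft A \<alpha>; w = cright A \<alpha>; g = cbot A \<alpha> in
        Retrocell f v w g
          (Retrocell (hid A (hdom A f)) (w \<bullet>\<^bsub>A\<^esub> cmp K f) (cmp K g \<bullet>\<^bsub>A\<^esub> v) (hid A (hcod A g))
            (companion_transpose A K \<alpha>)))\<rparr>"

end

theory Submission
  imports Defs
begin

text \<open>
  A retrocell with top \<open>f\<close>, left \<open>v\<close>, right \<open>w\<close> and bottom \<open>g\<close> is a 2-cell \<open>\<alpha> : w \<bullet> f\<^sub>* \<Rightarrow> g\<^sub>* \<bullet> v\<close> of
  the vertical bicategory, that is, a quintet (a square of vertical arrows filled by a 2-cell) two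
  of whose sides are companions. So \<open>\<A>\<^sup>r\<^sup>e\<^sup>t\<close> is a double category because quintets can be
  pasted in two directions and because \<open>f \<mapsto> f\<^sub>*\<close> is a pseudofunctor.

  The work lies in the associativity isomorphisms of the pastings. They are tamed by prolongation:
  for \<open>u\<close> ending where \<open>f\<close> begins, \<open>\<alpha>\<close> induces \<open>\<alpha>\<^sub>u : w \<bullet> (f \<bullet> u) \<Rightarrow> g \<bullet> (v \<bullet> u)\<close>, and every
  composite is then bracketed to the right. Written with prolongations the two pastings are
  \<open>\<alpha> \<bar> \<beta> = split \<oslash> x ; \<beta>\<^sub>f ; \<alpha> \<oslash> k ; join\<^sub>v\<close> and \<open>\<alpha> / \<alpha>' = assoc ; \<alpha> \<oslash> w' ; \<alpha>'\<^sub>v\<close>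
  (here \<open>;\<close> is composition of 2-cells and \<open>\<alpha> \<oslash> k\<close> is whiskering). The prolongations of these
  pastings have the same shape (\<open>prolong_hcomp\<close>, \<open>prolong_vcomp\<close>), which is where the
  pentagon enters. After that, associativity, interchange and naturality of the associator each follow
  from the naturality of \<open>\<beta>\<^sub>u\<close> in \<open>u\<close> (\<open>prolong_natural\<close>) together with the coherence of
  \<open>(h \<cdot> f)\<^sub>* \<cong> h\<^sub>* \<bullet> f\<^sub>*\<close>; see \<open>quintet_hcomp_assoc\<close>, \<open>quintet_interchange\<close> and
  \<open>quintet_vcomp_assoc\<close>. Coherence of the companions holds because a globular cell out of
  \<open>f\<^sub>*\<close> is determined by its composite with the binding cell \<open>\<psi>\<^sub>f\<close>.

  A globular retrocell \<open>v \<Rightarrow> w\<close> is a globular cell \<open>w \<Rightarrow> v\<close>, and reversing direction is compatible with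
  both pastings. Hence a cell of \<open>\<A>\<^sup>r\<^sup>e\<^sup>t\<^sup>r\<^sup>e\<^sup>t\<close> is nothing but a globular cell \<open>g\<^sub>* \<bullet> v \<Rightarrow> w \<bullet> f\<^sub>*\<close> of \<open>\<A>\<close>,
  and the binding cells identify these with the cells of \<open>\<A>\<close> having boundary \<open>f, v, w, g\<close>
  (\<open>fold_transpose\<close>, \<open>fold_boundary\<close>). This bijection respects pasting: to see that the
  transpose of a pasting is the pasting of the transposes, it suffices to compare the two after
  folding with the binding cells (\<open>transpose_hpaste\<close>, \<open>transpose_vpaste\<close>).
\<close>

section \<open>Calculus of globular cells\<close>

context double_category
begin

declare hdom_in [simp] hcod_in [simp] hid_in [simp] hid_dom [simp] hid_cod [simp]
  hcomp_in [simp] hcomp_dom [simp] hcomp_cod [simp]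
  vdom_in [simp] vcod_in [simp] vid_in [simp] vid_dom [simp] vid_cod [simp]
  vcomp_in [simp] vcomp_dom [simp] vcomp_cod [simp]
  ctop_in [simp] cbot_in [simp] cleft_in [simp] cright_in [simp]
  hpaste_in [simp] hpaste_top [simp] hpaste_bot [simp] hpaste_left [simp] hpaste_right [simp]
  vidc_in [simp] vidc_top [simp] vidc_bot [simp] vidc_left [simp] vidc_right [simp]
  vpaste_in [simp] vpaste_top [simp] vpaste_bot [simp] vpaste_left [simp] vpaste_right [simp]
  vpaste_hidc [simp] hpaste_vidc [simp]

abbreviation globular ("\<guillemotleft>_ : _ \<Rightarrow> _\<guillemotright>") where
  "\<guillemotleft>\<sigma> : a \<Rightarrow> b\<guillemotright> \<equiv> is_globular A \<sigma> a b"

abbreviation assoc_inv where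
  "assoc_inv x w v \<equiv> hinv A (assoc A x w v)"

lemma vcomp_vid [simp]:
  "\<lbrakk>v \<in> Ver A; vdom A v = X\<rbrakk> \<Longrightarrow> v \<bullet> vid A X = v"
  "\<lbrakk>v \<in> Ver A; vcod A v = X\<rbrakk> \<Longrightarrow> vid A X \<bullet> v = v"
  using vcomp_vid_right vcomp_vid_left by auto

lemma hcomp_hid [simp]:
  "\<lbrakk>f \<in> Hor A; hdom A f = X\<rbrakk> \<Longrightarrow> f \<cdot> hid A X = f"
  "\<lbrakk>f \<in> Hor A; hcod A f = X\<rbrakk> \<Longrightarrow> hid A X \<cdot> f = f"
  using hcomp_hid_right hcomp_hid_left by auto

lemma hidc_boundary [simp]:
  assumes "v \<in> Ver A"
  shows "hidc A v \<in> Cell A" "cleft A (hidc A v) = v" "cright A (hidc A v) = v"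
    "ctop A (hidc A v) = hid A (vdom A v)" "cbot A (hidc A v) = hid A (vcod A v)"
    "\<guillemotleft>hidc A v : v \<Rightarrow> v\<guillemotright>"
  using hidc_globular[OF assms] by (auto simp: is_globular_def)

lemma vidc_hid [simp]: "X \<in> Obj A \<Longrightarrow> vidc A (hid A X) = hidc A (vid A X)"
  by (simp add: hidc_vid)

lemma hpaste_hidc [simp]:
  "\<lbrakk>\<alpha> \<in> Cell A; cleft A \<alpha> = v\<rbrakk> \<Longrightarrow> hidc A v \<parallel> \<alpha> = \<alpha>"
  "\<lbrakk>\<alpha> \<in> Cell A; cright A \<alpha> = v\<rbrakk> \<Longrightarrow> \<alpha> \<parallel> hidc A v = \<alpha>"
  using hpaste_hidc_left hpaste_hidc_right by auto

lemma vpaste_vidc [simp]: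
  "\<lbrakk>\<alpha> \<in> Cell A; ctop A \<alpha> = f\<rbrakk> \<Longrightarrow> vidc A f \<oslash> \<alpha> = \<alpha>"
  "\<lbrakk>\<alpha> \<in> Cell A; cbot A \<alpha> = f\<rbrakk> \<Longrightarrow> \<alpha> \<oslash> vidc A f = \<alpha>"
  using vpaste_vidc_top vpaste_vidc_bot by auto

lemma vpaste_hidc_vid [simp]:
  "\<lbrakk>\<alpha> \<in> Cell A; ctop A \<alpha> = hid A X; X \<in> Obj A\<rbrakk> \<Longrightarrow> hidc A (vid A X) \<oslash> \<alpha> = \<alpha>"
  "\<lbrakk>\<alpha> \<in> Cell A; cbot A \<alpha> = hid A X; X \<in> Obj A\<rbrakk> \<Longrightarrow> \<alpha> \<oslash> hidc A (vid A X) = \<alpha>"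
  by (simp_all flip: vidc_hid)

lemma globularD:
  assumes "\<guillemotleft>\<sigma> : a \<Rightarrow> b\<guillemotright>"
  shows "\<sigma> \<in> Cell A" "cleft A \<sigma> = a" "cright A \<sigma> = b" "a \<in> Ver A" "b \<in> Ver A"
    "vdom A b = vdom A a" "vcod A b = vcod A a"
    "ctop A \<sigma> = hid A (vdom A a)" "cbot A \<sigma> = hid A (vcod A a)"
proof -
  from assms show *: "\<sigma> \<in> Cell A" "cleft A \<sigma> = a" "cright A \<sigma> = b"
    "ctop A \<sigma> = hid A (vdom A a)" "cbot A \<sigma> = hid A (vcod A a)"
    by (auto simp: is_globular_def)
  with cleft_in cright_in show "a \<in> Ver A" "b \<in> Ver A" by auto
  with * corner_tr[of \<sigma>] corner_br[of \<sigma>]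
  show "vdom A b = vdom A a" "vcod A b = vcod A a" by auto
qed

lemma globular_hpaste [intro]:
  assumes "\<guillemotleft>\<sigma> : a \<Rightarrow> b\<guillemotright>" "\<guillemotleft>\<tau> : b \<Rightarrow> c\<guillemotright>"
  shows "\<guillemotleft>\<sigma> \<parallel> \<tau> : a \<Rightarrow> c\<guillemotright>"
  unfolding is_globular_def by (simp add: globularD[OF assms(1)] globularD[OF assms(2)])

lemma globular_vpaste [intro]:
  assumes "\<guillemotleft>\<sigma> : a \<Rightarrow> b\<guillemotright>" "\<guillemotleft>\<tau> : c \<Rightarrow> d\<guillemotright>" "vcod A a = vdom A c"
  shows "\<guillemotleft>\<sigma> \<oslash> \<tau> : c \<bullet> a \<Rightarrow> d \<bullet> b\<guillemotright>"
  unfolding is_globular_def by (simp add: globularD[OF assms(1)] globularD[OF assms(2)] assms(3))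

lemma hinverse_unique:
  assumes "\<alpha> \<in> Cell A" "is_hinverse A \<alpha> \<beta>" "is_hinverse A \<alpha> \<gamma>"
  shows "\<beta> = \<gamma>"
proof -
  from assms have c: "\<beta> \<in> Cell A" "\<gamma> \<in> Cell A" "cleft A \<beta> = cright A \<alpha>"
    "cright A \<beta> = cleft A \<alpha>" "cleft A \<gamma> = cright A \<alpha>"
    and e: "\<beta> \<parallel> \<alpha> = hidc A (cright A \<alpha>)" "\<alpha> \<parallel> \<gamma> = hidc A (cleft A \<alpha>)"
    by (simp_all only: is_hinverse_def)
  have "\<beta> = \<beta> \<parallel> (\<alpha> \<parallel> \<gamma>)"
    using c by (simp add: e(2))
  also have "\<dots> = \<beta> \<parallel> \<alpha> \<parallel> \<gamma>"
    using assms(1) c by (simp add: hpaste_assoc)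
  also have "\<dots> = \<gamma>"
    using c by (simp add: e(1))
  finally show ?thesis .
qed

lemma hinv_eq: "\<lbrakk>\<alpha> \<in> Cell A; is_hinverse A \<alpha> \<beta>\<rbrakk> \<Longrightarrow> hinv A \<alpha> = \<beta>"
  unfolding hinv_def by (rule the_equality) (auto intro: hinverse_unique)

lemma hinv_hidc [simp]: "v \<in> Ver A \<Longrightarrow> hinv A (hidc A v) = hidc A v"
  by (rule hinv_eq) (simp_all add: is_hinverse_def)

lemma assoc_boundary [simp]:
  assumes "v \<in> Ver A" "w \<in> Ver A" "x \<in> Ver A" "vcod A v = vdom A w" "vcod A w = vdom A x"
  shows "\<guillemotleft>assoc A x w v : x \<bullet> w \<bullet> v \<Rightarrow> x \<bullet> (w \<bullet> v)\<guillemotright>"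
    "assoc A x w v \<in> Cell A" "cleft A (assoc A x w v) = x \<bullet> w \<bullet> v"
    "cright A (assoc A x w v) = x \<bullet> (w \<bullet> v)"
    "ctop A (assoc A x w v) = hid A (vdom A v)" "cbot A (assoc A x w v) = hid A (vcod A x)"
  using assoc_globular[OF assms] assms by (auto simp: is_globular_def)

lemma assoc_inverse:
  assumes "v \<in> Ver A" "w \<in> Ver A" "x \<in> Ver A" "vcod A v = vdom A w" "vcod A w = vdom A x"
  shows "is_hinverse A (assoc A x w v) (assoc_inv x w v)"
proof -
  obtain \<beta> where "is_hinverse A (assoc A x w v) \<beta>"
    using assoc_iso[OF assms] by blast
  with hinv_eq assoc_boundary(2)[OF assms] show ?thesis by simp
qed

lemma assoc_inv_boundary [simp]:
  assumes "v \<in> Ver A" "w \<in> Ver A" "x \<in> Ver A" "vcod A v = vdom A w" "vcod A w = vdom A x"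
  shows "\<guillemotleft>assoc_inv x w v : x \<bullet> (w \<bullet> v) \<Rightarrow> x \<bullet> w \<bullet> v\<guillemotright>"
    "assoc_inv x w v \<in> Cell A" "cright A (assoc_inv x w v) = x \<bullet> w \<bullet> v"
    "cleft A (assoc_inv x w v) = x \<bullet> (w \<bullet> v)"
    "ctop A (assoc_inv x w v) = hid A (vdom A v)" "cbot A (assoc_inv x w v) = hid A (vcod A x)"
    "assoc_inv x w v \<parallel> assoc A x w v = hidc A (x \<bullet> (w \<bullet> v))"
    "assoc A x w v \<parallel> assoc_inv x w v = hidc A (x \<bullet> w \<bullet> v)"
proof -
  let ?a = "assoc A x w v" and ?b = "assoc_inv x w v"
  note i = assoc_inverse[OF assms]
  from i[unfolded is_hinverse_def] show 1: "?b \<in> Cell A" "cright A ?b = x \<bullet> w \<bullet> v" "cleft A ?b = x \<bullet> (w \<bullet> v)"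
    and 2: "?b \<parallel> ?a = hidc A (x \<bullet> (w \<bullet> v))" "?a \<parallel> ?b = hidc A (x \<bullet> w \<bullet> v)"
    by (simp_all add: assms)
  have c: "hcod A (ctop A ?b) = vdom A v" "hcod A (cbot A ?b) = vcod A x"
    using corner_tr[OF 1(1)] corner_br[OF 1(1)] by (simp_all add: 1 assms)
  have "ctop A (?b \<parallel> ?a) = ctop A ?b" "cbot A (?b \<parallel> ?a) = cbot A ?b"
    by (simp_all add: 1 c assms)
  then show 3: "ctop A ?b = hid A (vdom A v)" "cbot A ?b = hid A (vcod A x)"
    by (simp_all add: 2 assms)
  show "\<guillemotleft>?b : x \<bullet> (w \<bullet> v) \<Rightarrow> x \<bullet> w \<bullet> v\<guillemotright>"
    unfolding is_globular_def by (simp add: 1 3 assms)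
qed

lemma assoc_cancel [simp]:
  assumes "v \<in> Ver A" "w \<in> Ver A" "x \<in> Ver A" "vcod A v = vdom A w" "vcod A w = vdom A x"
  shows "\<lbrakk>\<rho> \<in> Cell A; cleft A \<rho> = x \<bullet> (w \<bullet> v)\<rbrakk> \<Longrightarrow> assoc_inv x w v \<parallel> (assoc A x w v \<parallel> \<rho>) = \<rho>"
    and "\<lbrakk>\<rho> \<in> Cell A; cleft A \<rho> = x \<bullet> w \<bullet> v\<rbrakk> \<Longrightarrow> assoc A x w v \<parallel> (assoc_inv x w v \<parallel> \<rho>) = \<rho>"
  using assms by (simp_all flip: hpaste_assoc)

lemma cancel_left:
  assumes "\<guillemotleft>\<sigma> : a \<Rightarrow> b\<guillemotright>" "\<guillemotleft>\<sigma>' : b \<Rightarrow> a\<guillemotright>" "\<sigma>' \<parallel> \<sigma> = hidc A b"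
    and "\<tau> \<in> Cell A" "\<tau>' \<in> Cell A" "cleft A \<tau> = b" "cleft A \<tau>' = b" "\<sigma> \<parallel> \<tau> = \<sigma> \<parallel> \<tau>'"
  shows "\<tau> = \<tau>'"
proof -
  note g = globularD[OF assms(1)] globularD[OF assms(2)]
  have "\<sigma>' \<parallel> (\<sigma> \<parallel> \<tau>) = \<tau>" "\<sigma>' \<parallel> (\<sigma> \<parallel> \<tau>') = \<tau>'"
    using assms(3-7) g(1-5,10-12) by (simp_all flip: hpaste_assoc)
  then show ?thesis unfolding assms(8) by (rule trans[OF sym])
qed

text \<open>
  Kelly's argument: the pentagon at \<open>id, id, w, v\<close> makes \<open>assoc id w v\<close> idempotent, and an invertible
  idempotent is an identity. The third unit position is treated in the same way.
\<close>

lemma assoc_vid_left [simp]: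
  assumes "v \<in> Ver A" "w \<in> Ver A" "vcod A v = vdom A w" "vcod A w = X"
  shows "assoc A (vid A X) w v = hidc A (w \<bullet> v)"
proof -
  have X: "X \<in> Obj A" using assms by auto
  have t: "assoc A (vid A X) (vid A X) w = hidc A w"
    "assoc A (vid A X) (vid A X) (w \<bullet> v) = hidc A (w \<bullet> v)"
    using triangle[of w "vid A X"] triangle[of "w \<bullet> v" "vid A X"] assms X by simp_all
  have "assoc A (vid A X) w v = assoc A (vid A X) w v \<parallel> assoc A (vid A X) w v"
    using pentagon[of v w "vid A X" "vid A X"] assms X by (simp add: t)
  then have e: "assoc A (vid A X) w v \<parallel> hidc A (w \<bullet> v) = assoc A (vid A X) w v \<parallel> assoc A (vid A X) w v"
    using assms X by simp
  show ?thesis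
    by (rule cancel_left[OF _ _ _ _ _ _ _ e[symmetric], of "w \<bullet> v" "w \<bullet> v" "assoc_inv (vid A X) w v"])
      (use assms X assoc_boundary[of v w "vid A X"] assoc_inv_boundary[of v w "vid A X"] in simp_all)
qed

lemma assoc_vid_mid [simp]:
  assumes "v \<in> Ver A" "w \<in> Ver A" "vcod A v = X" "vdom A w = X"
  shows "assoc A w (vid A X) v = hidc A (w \<bullet> v)"
  using triangle[of v w] assms by simp

lemma assoc_vid_right [simp]:
  assumes "v \<in> Ver A" "w \<in> Ver A" "vcod A v = vdom A w" "vdom A v = X"
  shows "assoc A w v (vid A X) = hidc A (w \<bullet> v)"
proof -
  have X: "X \<in> Obj A" using assms by auto
  have "assoc A w v (vid A X) = assoc A w v (vid A X) \<parallel> assoc A w v (vid A X)"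
    using pentagon[of "vid A X" "vid A X" v w] assms X by simp
  then have e: "assoc A w v (vid A X) \<parallel> hidc A (w \<bullet> v) = assoc A w v (vid A X) \<parallel> assoc A w v (vid A X)"
    using assms X by simp
  show ?thesis
    by (rule cancel_left[OF _ _ _ _ _ _ _ e[symmetric], of "w \<bullet> v" "w \<bullet> v" "assoc_inv w v (vid A X)"])
      (use assms X assoc_boundary[of "vid A X" v w] assoc_inv_boundary[of "vid A X" v w] in simp_all)
qed

text \<open>
  Mutually inverse globular cells with named source and target; unlike \<open>is_hinverse\<close> this is
  symmetric and fixes both boundaries, so that its consequences can rewrite composites.
\<close>

definition inverse_cells where
  "inverse_cells \<sigma> \<sigma>' a b \<longleftrightarrow> \<guillemotleft>\<sigma> : a \<Rightarrow> b\<guillemotright> \<and> \<guillemotleft>\<sigma>' : b \<Rightarrow> a\<guillemotright> \<and> \<sigma> \<parallel> \<sigma>' = hidc A a \<and> \<sigma>' \<parallel> \<sigma> = hidc A b"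

lemma inverse_cellsD:
  assumes "inverse_cells \<sigma> \<sigma>' a b"
  shows "\<sigma> \<in> Cell A" "cleft A \<sigma> = a" "cright A \<sigma> = b" "\<sigma>' \<in> Cell A" "cleft A \<sigma>' = b" "cright A \<sigma>' = a"
    "\<sigma> \<parallel> \<sigma>' = hidc A a" "\<sigma>' \<parallel> \<sigma> = hidc A b" "a \<in> Ver A" "b \<in> Ver A"
    "\<lbrakk>\<rho> \<in> Cell A; cleft A \<rho> = a\<rbrakk> \<Longrightarrow> \<sigma> \<parallel> (\<sigma>' \<parallel> \<rho>) = \<rho>"
    "\<lbrakk>\<rho> \<in> Cell A; cleft A \<rho> = b\<rbrakk> \<Longrightarrow> \<sigma>' \<parallel> (\<sigma> \<parallel> \<rho>) = \<rho>"
proof -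
  from assms have g: "\<guillemotleft>\<sigma> : a \<Rightarrow> b\<guillemotright>" "\<guillemotleft>\<sigma>' : b \<Rightarrow> a\<guillemotright>"
    and e: "\<sigma> \<parallel> \<sigma>' = hidc A a" "\<sigma>' \<parallel> \<sigma> = hidc A b"
    by (simp_all add: inverse_cells_def)
  note [simp] = globularD[OF g(1)] globularD(1-3,8,9)[OF g(2)]
  show "\<sigma> \<in> Cell A" "cleft A \<sigma> = a" "cright A \<sigma> = b" "\<sigma>' \<in> Cell A" "cleft A \<sigma>' = b" "cright A \<sigma>' = a"
    "\<sigma> \<parallel> \<sigma>' = hidc A a" "\<sigma>' \<parallel> \<sigma> = hidc A b" "a \<in> Ver A" "b \<in> Ver A"
    by (simp_all add: e)
  show "\<lbrakk>\<rho> \<in> Cell A; cleft A \<rho> = a\<rbrakk> \<Longrightarrow> \<sigma> \<parallel> (\<sigma>' \<parallel> \<rho>) = \<rho>"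
    "\<lbrakk>\<rho> \<in> Cell A; cleft A \<rho> = b\<rbrakk> \<Longrightarrow> \<sigma>' \<parallel> (\<sigma> \<parallel> \<rho>) = \<rho>"
    by (simp_all add: e flip: hpaste_assoc)
qed

lemma inverse_cells_assoc:
  assumes "v \<in> Ver A" "w \<in> Ver A" "x \<in> Ver A" "vcod A v = vdom A w" "vcod A w = vdom A x"
  shows "inverse_cells (assoc A x w v) (assoc_inv x w v) (x \<bullet> w \<bullet> v) (x \<bullet> (w \<bullet> v))"
  unfolding inverse_cells_def using assms by simp

lemma whisker_hpaste:
  assumes "\<sigma> \<in> Cell A" "\<tau> \<in> Cell A" "cright A \<sigma> = cleft A \<tau>"
  shows "\<lbrakk>x \<in> Ver A; cbot A \<sigma> = hid A (vdom A x); cbot A \<tau> = hid A (vdom A x)\<rbrakk>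
      \<Longrightarrow> (\<sigma> \<parallel> \<tau>) \<oslash> hidc A x = \<sigma> \<oslash> hidc A x \<parallel> \<tau> \<oslash> hidc A x"
    and "\<lbrakk>u \<in> Ver A; ctop A \<sigma> = hid A (vcod A u); ctop A \<tau> = hid A (vcod A u)\<rbrakk>
      \<Longrightarrow> hidc A u \<oslash> (\<sigma> \<parallel> \<tau>) = hidc A u \<oslash> \<sigma> \<parallel> hidc A u \<oslash> \<tau>"
  using interchange[of \<sigma> \<tau> "hidc A x" "hidc A x"] interchange[of "hidc A u" "hidc A u" \<sigma> \<tau>] assms
  by simp_all

lemma inverse_cells_whisker:
  assumes "inverse_cells \<sigma> \<sigma>' a b"
  shows "\<lbrakk>x \<in> Ver A; vcod A a = vdom A x\<rbrakk>
      \<Longrightarrow> inverse_cells (\<sigma> \<oslash> hidc A x) (\<sigma>' \<oslash> hidc A x) (x \<bullet> a) (x \<bullet> b)"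
    and "\<lbrakk>u \<in> Ver A; vcod A u = vdom A a\<rbrakk>
      \<Longrightarrow> inverse_cells (hidc A u \<oslash> \<sigma>) (hidc A u \<oslash> \<sigma>') (a \<bullet> u) (b \<bullet> u)"
proof -
  from assms have g: "\<guillemotleft>\<sigma> : a \<Rightarrow> b\<guillemotright>" "\<guillemotleft>\<sigma>' : b \<Rightarrow> a\<guillemotright>"
    by (simp_all add: inverse_cells_def)
  note [simp] = globularD[OF g(1)] globularD(1-3,8,9)[OF g(2)]
  show "inverse_cells (\<sigma> \<oslash> hidc A x) (\<sigma>' \<oslash> hidc A x) (x \<bullet> a) (x \<bullet> b)"
    if "x \<in> Ver A" "vcod A a = vdom A x"
    unfolding inverse_cells_def using that
    by (simp add: globular_vpaste g whisker_hpaste(1)[symmetric, of \<sigma> \<sigma>'] whisker_hpaste(1)[symmetric, of \<sigma>' \<sigma>] inverse_cellsD(7,8)[OF assms])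
  show "inverse_cells (hidc A u \<oslash> \<sigma>) (hidc A u \<oslash> \<sigma>') (a \<bullet> u) (b \<bullet> u)"
    if "u \<in> Ver A" "vcod A u = vdom A a"
    unfolding inverse_cells_def using that
    by (simp add: globular_vpaste g whisker_hpaste(2)[symmetric, of \<sigma> \<sigma>'] whisker_hpaste(2)[symmetric, of \<sigma>' \<sigma>] inverse_cellsD(7,8)[OF assms])
qed

lemma assoc_inv_natural:
  assumes [simp]: "\<alpha> \<in> Cell A" "\<beta> \<in> Cell A" "\<gamma> \<in> Cell A"
    and b: "cbot A \<alpha> = ctop A \<beta>" "cbot A \<beta> = ctop A \<gamma>"
  shows "assoc_inv (cleft A \<gamma>) (cleft A \<beta>) (cleft A \<alpha>) \<parallel> \<alpha> \<oslash> (\<beta> \<oslash> \<gamma>) =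
    \<alpha> \<oslash> \<beta> \<oslash> \<gamma> \<parallel> assoc_inv (cright A \<gamma>) (cright A \<beta>) (cright A \<alpha>)"
proof -
  have c: "vcod A (cleft A \<alpha>) = vdom A (cleft A \<beta>)" "vcod A (cleft A \<beta>) = vdom A (cleft A \<gamma>)"
    "vcod A (cright A \<alpha>) = vdom A (cright A \<beta>)" "vcod A (cright A \<beta>) = vdom A (cright A \<gamma>)"
    by (simp_all flip: corner_tl corner_bl corner_tr corner_br add: b)
  let ?l = "assoc A (cleft A \<gamma>) (cleft A \<beta>) (cleft A \<alpha>)"
  let ?l' = "assoc_inv (cleft A \<gamma>) (cleft A \<beta>) (cleft A \<alpha>)"
  let ?r = "assoc A (cright A \<gamma>) (cright A \<beta>) (cright A \<alpha>)"
  let ?r' = "assoc_inv (cright A \<gamma>) (cright A \<beta>) (cright A \<alpha>)"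
  have "?l' \<parallel> \<alpha> \<oslash> (\<beta> \<oslash> \<gamma>) = ?l' \<parallel> (\<alpha> \<oslash> (\<beta> \<oslash> \<gamma>) \<parallel> (?r \<parallel> ?r'))"
    by (simp add: c b)
  also have "\<dots> = ?l' \<parallel> ((\<alpha> \<oslash> (\<beta> \<oslash> \<gamma>) \<parallel> ?r) \<parallel> ?r')"
    by (subst hpaste_assoc) (simp_all add: c b)
  also have "\<dots> = \<alpha> \<oslash> \<beta> \<oslash> \<gamma> \<parallel> ?r'"
    by (subst assoc_natural) (simp_all add: c b hpaste_assoc)
  finally show ?thesis .
qed

text \<open>
  A commuting pentagon of isomorphisms may be read starting from any corner. The three readings
  below are those in which the inverse associators have to be moved past a whiskering.
\<close>

lemma pentagon_rotations:
  assumes i: "inverse_cells a1 a1' p q" "inverse_cells a2 a2' q r"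
      "inverse_cells b1 b1' p s" "inverse_cells b2 b2' s t" "inverse_cells b3 b3' t r"
    and e: "a1 \<parallel> a2 = b1 \<parallel> b2 \<parallel> b3"
  shows "b2' \<parallel> b1' = b3 \<parallel> (a2' \<parallel> a1')"
    and "a1' \<parallel> b1 = a2 \<parallel> (b3' \<parallel> b2')"
    and "b3' \<parallel> (b2' \<parallel> b1') = a2' \<parallel> a1'"
proof -
  note [simp] = i[THEN inverse_cellsD(1)] i[THEN inverse_cellsD(2)] i[THEN inverse_cellsD(3)]
    i[THEN inverse_cellsD(4)] i[THEN inverse_cellsD(5)] i[THEN inverse_cellsD(6)]
    i[THEN inverse_cellsD(7)] i[THEN inverse_cellsD(8)] i[THEN inverse_cellsD(9)]
    i[THEN inverse_cellsD(10)] i[THEN inverse_cellsD(11)] i[THEN inverse_cellsD(12)]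
  have e': "a1 \<parallel> (a2 \<parallel> \<rho>) = b1 \<parallel> (b2 \<parallel> (b3 \<parallel> \<rho>))" if "\<rho> \<in> Cell A" "cleft A \<rho> = r" for \<rho>
    using arg_cong[OF e, of "\<lambda>c. c \<parallel> \<rho>"] that by (simp add: hpaste_assoc)
  have "b2' \<parallel> b1' = b2' \<parallel> (b1' \<parallel> (a1 \<parallel> (a2 \<parallel> (a2' \<parallel> a1'))))"
    by simp
  also have "\<dots> = b3 \<parallel> (a2' \<parallel> a1')"
    by (simp add: e' del: inverse_cellsD(11)[OF i(2)])
  finally show 1: "b2' \<parallel> b1' = b3 \<parallel> (a2' \<parallel> a1')" .
  show "b3' \<parallel> (b2' \<parallel> b1') = a2' \<parallel> a1'"
    by (simp add: 1)
  have "a1' \<parallel> b1 = a1' \<parallel> (b1 \<parallel> (b2 \<parallel> (b3 \<parallel> (b3' \<parallel> b2'))))"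
    by simp
  also have "\<dots> = a1' \<parallel> (a1 \<parallel> (a2 \<parallel> (b3' \<parallel> b2')))"
    by (simp add: e' del: inverse_cellsD(11)[OF i(5)])
  also have "\<dots> = a2 \<parallel> (b3' \<parallel> b2')"
    by simp
  finally show "a1' \<parallel> b1 = a2 \<parallel> (b3' \<parallel> b2')" .
qed

lemma pentagon_inv:
  assumes [simp]: "v \<in> Ver A" "w \<in> Ver A" "x \<in> Ver A" "y \<in> Ver A"
    "vcod A v = vdom A w" "vcod A w = vdom A x" "vcod A x = vdom A y"
  shows "assoc_inv y (x \<bullet> w) v \<parallel> hidc A v \<oslash> assoc_inv y x w =
      assoc A x w v \<oslash> hidc A y \<parallel> (assoc_inv y x (w \<bullet> v) \<parallel> assoc_inv (y \<bullet> x) w v)" (is ?A)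
    and "assoc_inv (y \<bullet> x) w v \<parallel> hidc A v \<oslash> assoc A y x w =
      assoc A y x (w \<bullet> v) \<parallel> (assoc_inv x w v \<oslash> hidc A y \<parallel> assoc_inv y (x \<bullet> w) v)" (is ?B)
    and "assoc_inv x w v \<oslash> hidc A y \<parallel> (assoc_inv y (x \<bullet> w) v \<parallel> hidc A v \<oslash> assoc_inv y x w) =
      assoc_inv y x (w \<bullet> v) \<parallel> assoc_inv (y \<bullet> x) w v" (is ?C)
proof -
  have i: "inverse_cells (assoc A (y \<bullet> x) w v) (assoc_inv (y \<bullet> x) w v) (y \<bullet> x \<bullet> w \<bullet> v) (y \<bullet> x \<bullet> (w \<bullet> v))"
    "inverse_cells (assoc A y x (w \<bullet> v)) (assoc_inv y x (w \<bullet> v)) (y \<bullet> x \<bullet> (w \<bullet> v)) (y \<bullet> (x \<bullet> (w \<bullet> v)))"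
    "inverse_cells (hidc A v \<oslash> assoc A y x w) (hidc A v \<oslash> assoc_inv y x w) (y \<bullet> x \<bullet> w \<bullet> v) (y \<bullet> (x \<bullet> w) \<bullet> v)"
    "inverse_cells (assoc A y (x \<bullet> w) v) (assoc_inv y (x \<bullet> w) v) (y \<bullet> (x \<bullet> w) \<bullet> v) (y \<bullet> (x \<bullet> w \<bullet> v))"
    "inverse_cells (assoc A x w v \<oslash> hidc A y) (assoc_inv x w v \<oslash> hidc A y) (y \<bullet> (x \<bullet> w \<bullet> v)) (y \<bullet> (x \<bullet> (w \<bullet> v)))"
    by (simp_all add: inverse_cells_assoc inverse_cells_whisker)
  note r = pentagon_rotations[OF i pentagon[OF assms]]
  from r show ?A ?B ?C by blast+
qed

section \<open>Prolonging squares of the vertical bicategory\<close>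

text \<open>
  Quintets in the sense of Ehresmann, with \<open>f\<close>, \<open>g\<close> drawn horizontally and \<open>v\<close>, \<open>w\<close>
  vertically although all four are vertical arrows.
\<close>

definition quintet where
  "quintet w f g v \<alpha> \<longleftrightarrow> w \<in> Ver A \<and> f \<in> Ver A \<and> g \<in> Ver A \<and> v \<in> Ver A \<and>
     vcod A f = vdom A w \<and> vcod A v = vdom A g \<and> \<guillemotleft>\<alpha> : w \<bullet> f \<Rightarrow> g \<bullet> v\<guillemotright>"

lemma quintetD:
  assumes "quintet w f g v \<alpha>"
  shows "w \<in> Ver A" "f \<in> Ver A" "g \<in> Ver A" "v \<in> Ver A"
    "vcod A f = vdom A w" "vcod A v = vdom A g" "vdom A v = vdom A f" "vcod A g = vcod A w"
    "\<alpha> \<in> Cell A" "cleft A \<alpha> = w \<bullet> f" "cright A \<alpha> = g \<bullet> v"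
    "ctop A \<alpha> = hid A (vdom A f)" "cbot A \<alpha> = hid A (vcod A w)"
    "\<guillemotleft>\<alpha> : w \<bullet> f \<Rightarrow> g \<bullet> v\<guillemotright>"
proof -
  from assms have v: "w \<in> Ver A" "f \<in> Ver A" "g \<in> Ver A" "v \<in> Ver A"
    "vcod A f = vdom A w" "vcod A v = vdom A g" and g: "\<guillemotleft>\<alpha> : w \<bullet> f \<Rightarrow> g \<bullet> v\<guillemotright>"
    by (simp_all add: quintet_def)
  then show "w \<in> Ver A" "f \<in> Ver A" "g \<in> Ver A" "v \<in> Ver A"
    "vcod A f = vdom A w" "vcod A v = vdom A g" "\<guillemotleft>\<alpha> : w \<bullet> f \<Rightarrow> g \<bullet> v\<guillemotright>" by blast+
  show "vdom A v = vdom A f" "vcod A g = vcod A w"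
    "\<alpha> \<in> Cell A" "cleft A \<alpha> = w \<bullet> f" "cright A \<alpha> = g \<bullet> v"
    "ctop A \<alpha> = hid A (vdom A f)" "cbot A \<alpha> = hid A (vcod A w)"
    using globularD[OF g] v by simp_all
qed

text \<open>
  The 2-cell \<open>w \<bullet> (f \<bullet> u) \<Rightarrow> g \<bullet> (v \<bullet> u)\<close> induced by \<open>\<alpha>\<close>. It hides the associators that
  pasting \<open>\<alpha>\<close> with other cells requires.
\<close>

definition prolong where
  "prolong w f g v \<alpha> u = assoc_inv w f u \<parallel> (hidc A u \<oslash> \<alpha> \<parallel> assoc A g v u)"

lemma prolong_boundary:
  assumes q: "quintet w f g v \<alpha>" and u: "u \<in> Ver A" "vcod A u = vdom A f"
  shows "prolong w f g v \<alpha> u \<in> Cell A" "cleft A (prolong w f g v \<alpha> u) = w \<bullet> (f \<bullet> u)"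
    "cright A (prolong w f g v \<alpha> u) = g \<bullet> (v \<bullet> u)"
    "ctop A (prolong w f g v \<alpha> u) = hid A (vdom A u)" "cbot A (prolong w f g v \<alpha> u) = hid A (vcod A w)"
  unfolding prolong_def by (simp_all add: u quintetD[OF q])

lemma prolong_natural:
  assumes q: "quintet w f g v \<alpha>" and \<theta>: "\<guillemotleft>\<theta> : u \<Rightarrow> u'\<guillemotright>" and u: "vcod A u = vdom A f"
  shows "\<theta> \<oslash> hidc A f \<oslash> hidc A w \<parallel> prolong w f g v \<alpha> u' =
    prolong w f g v \<alpha> u \<parallel> \<theta> \<oslash> hidc A v \<oslash> hidc A g"
proof -
  note [simp] = quintetD[OF q] globularD[OF \<theta>] u
  have 1: "\<theta> \<oslash> hidc A f \<oslash> hidc A w \<parallel> assoc_inv w f u' = assoc_inv w f u \<parallel> \<theta> \<oslash> hidc A (w \<bullet> f)"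
    using assoc_inv_natural[of \<theta> "hidc A f" "hidc A w"] by simp
  have 2: "assoc A g v u \<parallel> \<theta> \<oslash> hidc A v \<oslash> hidc A g = \<theta> \<oslash> hidc A (g \<bullet> v) \<parallel> assoc A g v u'"
    using assoc_natural[of \<theta> "hidc A v" "hidc A g"] by simp
  have 3: "\<theta> \<oslash> hidc A (w \<bullet> f) \<parallel> hidc A u' \<oslash> \<alpha> = hidc A u \<oslash> \<alpha> \<parallel> \<theta> \<oslash> hidc A (g \<bullet> v)"
    using interchange[of \<theta> "hidc A u'" "hidc A (w \<bullet> f)" \<alpha>]
      interchange[of "hidc A u" \<theta> \<alpha> "hidc A (g \<bullet> v)"] by simp
  have "\<theta> \<oslash> hidc A f \<oslash> hidc A w \<parallel> prolong w f g v \<alpha> u' =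
      \<theta> \<oslash> hidc A f \<oslash> hidc A w \<parallel> assoc_inv w f u' \<parallel> (hidc A u' \<oslash> \<alpha> \<parallel> assoc A g v u')"
    by (simp add: prolong_def hpaste_assoc)
  also have "\<dots> = assoc_inv w f u \<parallel> (\<theta> \<oslash> hidc A (w \<bullet> f) \<parallel> hidc A u' \<oslash> \<alpha> \<parallel> assoc A g v u')"
    by (simp add: 1 hpaste_assoc)
  also have "\<dots> = assoc_inv w f u \<parallel> (hidc A u \<oslash> \<alpha> \<parallel> (\<theta> \<oslash> hidc A (g \<bullet> v) \<parallel> assoc A g v u'))"
    by (subst 3) (simp add: hpaste_assoc)
  also have "\<dots> = prolong w f g v \<alpha> u \<parallel> \<theta> \<oslash> hidc A v \<oslash> hidc A g"
    by (simp add: prolong_def hpaste_assoc flip: 2)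
  finally show ?thesis .
qed

text \<open>
  Prolonging in two steps, along \<open>f\<close> and then along \<open>u\<close>, agrees with prolonging along
  \<open>f \<bullet> u\<close> up to rebracketing. Two pentagons are used, one on each side of \<open>\<beta>\<close>.
\<close>

lemma prolong_whisker:
  assumes q: "quintet x h k w \<beta>" and f: "f \<in> Ver A" "vcod A f = vdom A h"
    and u: "u \<in> Ver A" "vcod A u = vdom A f"
  shows "assoc_inv x (h \<bullet> f) u \<parallel> hidc A u \<oslash> prolong x h k w \<beta> f =
    assoc A h f u \<oslash> hidc A x \<parallel> (prolong x h k w \<beta> (f \<bullet> u) \<parallel>
      (assoc_inv w f u \<oslash> hidc A k \<parallel> assoc_inv k (w \<bullet> f) u))"
proof -
  note [simp] = quintetD[OF q] f u
  have 1: "assoc_inv x (h \<bullet> f) u \<parallel> hidc A u \<oslash> assoc_inv x h f =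
      assoc A h f u \<oslash> hidc A x \<parallel> (assoc_inv x h (f \<bullet> u) \<parallel> assoc_inv (x \<bullet> h) f u)"
    by (rule pentagon_inv(1)) simp_all
  have 2: "assoc_inv (x \<bullet> h) f u \<parallel> hidc A u \<oslash> (hidc A f \<oslash> \<beta>) =
      hidc A (f \<bullet> u) \<oslash> \<beta> \<parallel> assoc_inv (k \<bullet> w) f u"
    using assoc_inv_natural[of "hidc A u" "hidc A f" \<beta>] by simp
  have 3: "assoc_inv (k \<bullet> w) f u \<parallel> hidc A u \<oslash> assoc A k w f =
      assoc A k w (f \<bullet> u) \<parallel> (assoc_inv w f u \<oslash> hidc A k \<parallel> assoc_inv k (w \<bullet> f) u)"
    by (rule pentagon_inv(2)) simp_all
  have "assoc_inv x (h \<bullet> f) u \<parallel> hidc A u \<oslash> prolong x h k w \<beta> f =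
      assoc_inv x (h \<bullet> f) u \<parallel> hidc A u \<oslash> assoc_inv x h f \<parallel>
      (hidc A u \<oslash> (hidc A f \<oslash> \<beta>) \<parallel> hidc A u \<oslash> assoc A k w f)"
    by (simp add: prolong_def hpaste_assoc whisker_hpaste)
  also have "\<dots> = assoc A h f u \<oslash> hidc A x \<parallel> (assoc_inv x h (f \<bullet> u) \<parallel>
      (assoc_inv (x \<bullet> h) f u \<parallel> hidc A u \<oslash> (hidc A f \<oslash> \<beta>) \<parallel> hidc A u \<oslash> assoc A k w f))"
    by (simp add: 1 hpaste_assoc)
  also have "\<dots> = assoc A h f u \<oslash> hidc A x \<parallel> (assoc_inv x h (f \<bullet> u) \<parallel>
      (hidc A (f \<bullet> u) \<oslash> \<beta> \<parallel> (assoc_inv (k \<bullet> w) f u \<parallel> hidc A u \<oslash> assoc A k w f)))"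
    by (simp add: 2 hpaste_assoc)
  also have "\<dots> = assoc A h f u \<oslash> hidc A x \<parallel> (prolong x h k w \<beta> (f \<bullet> u) \<parallel>
      (assoc_inv w f u \<oslash> hidc A k \<parallel> assoc_inv k (w \<bullet> f) u))"
    by (simp add: 3 prolong_def hpaste_assoc)
  finally show ?thesis .
qed

text \<open>Lets an equation between composites rewrite the head of a right-nested chain.\<close>

lemma hpaste_eq_assoc:
  assumes "\<sigma> \<parallel> \<tau> = \<rho>" "\<sigma> \<in> Cell A" "\<tau> \<in> Cell A" "cright A \<sigma> = cleft A \<tau>"
    "\<pi> \<in> Cell A" "cright A \<tau> = cleft A \<pi>"
  shows "\<sigma> \<parallel> (\<tau> \<parallel> \<pi>) = \<rho> \<parallel> \<pi>"
  using hpaste_assoc[of \<sigma> \<tau> \<pi>] assms by simp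

lemma quintetI:
  assumes "w \<in> Ver A" "f \<in> Ver A" "g \<in> Ver A" "v \<in> Ver A" "vcod A f = vdom A w" "vcod A v = vdom A g"
    "\<alpha> \<in> Cell A" "cleft A \<alpha> = w \<bullet> f" "cright A \<alpha> = g \<bullet> v"
    "ctop A \<alpha> = hid A (vdom A f)" "cbot A \<alpha> = hid A (vcod A w)"
  shows "quintet w f g v \<alpha>"
  unfolding quintet_def is_globular_def using assms by simp

section \<open>Pasting of quintets\<close>

text \<open>
  Quintets are pasted horizontally relative to chosen comparison cells \<open>s : F \<Rightarrow> h \<bullet> f\<close> and
  \<open>j : k \<bullet> g \<Rightarrow> G\<close>, abstracting the canonical isomorphisms between \<open>(h \<cdot> f)\<^sub>*\<close> and \<open>h\<^sub>* \<bullet> f\<^sub>*\<close>. Both are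
  themselves quintets with one identity side, so they can be prolonged too.
\<close>

definition splits where
  "splits F h f s \<longleftrightarrow> f \<in> Ver A \<and> h \<in> Ver A \<and> vcod A f = vdom A h \<and> \<guillemotleft>s : F \<Rightarrow> h \<bullet> f\<guillemotright>"

definition joins where
  "joins h f F j \<longleftrightarrow> f \<in> Ver A \<and> h \<in> Ver A \<and> vcod A f = vdom A h \<and> \<guillemotleft>j : h \<bullet> f \<Rightarrow> F\<guillemotright>"

definition prolong_split where
  "prolong_split F h f s u = prolong (vid A (vcod A h)) F h f s u"

definition prolong_join where
  "prolong_join h f F j u = prolong h f F (vid A (vdom A f)) j u"

lemma splitsD:
  assumes "splits F h f s"
  shows "F \<in> Ver A" "f \<in> Ver A" "h \<in> Ver A" "vcod A f = vdom A h" "vdom A F = vdom A f"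
    "vcod A F = vcod A h" "s \<in> Cell A" "cleft A s = F" "cright A s = h \<bullet> f"
    "ctop A s = hid A (vdom A f)" "cbot A s = hid A (vcod A h)" "\<guillemotleft>s : F \<Rightarrow> h \<bullet> f\<guillemotright>"
proof -
  from assms have v: "f \<in> Ver A" "h \<in> Ver A" "vcod A f = vdom A h" and g: "\<guillemotleft>s : F \<Rightarrow> h \<bullet> f\<guillemotright>"
    by (simp_all add: splits_def)
  then show "f \<in> Ver A" "h \<in> Ver A" "vcod A f = vdom A h" "\<guillemotleft>s : F \<Rightarrow> h \<bullet> f\<guillemotright>" by blast+
  from globularD(6,7)[OF g] v show d: "vdom A F = vdom A f" "vcod A F = vcod A h" by simp_all
  show "F \<in> Ver A" "s \<in> Cell A" "cleft A s = F" "cright A s = h \<bullet> f"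
    "ctop A s = hid A (vdom A f)" "cbot A s = hid A (vcod A h)"
    using globularD(1-5,8,9)[OF g] by (simp_all add: d)
qed

lemma joinsD:
  assumes "joins h f F j"
  shows "F \<in> Ver A" "f \<in> Ver A" "h \<in> Ver A" "vcod A f = vdom A h" "vdom A F = vdom A f"
    "vcod A F = vcod A h" "j \<in> Cell A" "cleft A j = h \<bullet> f" "cright A j = F"
    "ctop A j = hid A (vdom A f)" "cbot A j = hid A (vcod A h)" "\<guillemotleft>j : h \<bullet> f \<Rightarrow> F\<guillemotright>"
    "quintet h f F (vid A (vdom A f)) j"
proof -
  from assms have v: "f \<in> Ver A" "h \<in> Ver A" "vcod A f = vdom A h" and g: "\<guillemotleft>j : h \<bullet> f \<Rightarrow> F\<guillemotright>"
    by (simp_all add: joins_def)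
  then show "f \<in> Ver A" "h \<in> Ver A" "vcod A f = vdom A h" "\<guillemotleft>j : h \<bullet> f \<Rightarrow> F\<guillemotright>" by blast+
  from globularD[OF g] v show d: "vdom A F = vdom A f" "vcod A F = vcod A h" by simp_all
  show c: "F \<in> Ver A" "j \<in> Cell A" "cleft A j = h \<bullet> f" "cright A j = F"
    "ctop A j = hid A (vdom A f)" "cbot A j = hid A (vcod A h)"
    using globularD(1-5,8,9)[OF g] v by simp_all
  show "quintet h f F (vid A (vdom A f)) j"
    unfolding quintet_def using v g c d by simp
qed

lemma prolong_split:
  assumes s: "splits F h f s" and u: "u \<in> Ver A" "vcod A u = vdom A f"
  shows "prolong_split F h f s u = hidc A u \<oslash> s \<parallel> assoc A h f u"
    "\<guillemotleft>prolong_split F h f s u : F \<bullet> u \<Rightarrow> h \<bullet> (f \<bullet> u)\<guillemotright>"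
    "prolong_split F h f s u \<in> Cell A" "cleft A (prolong_split F h f s u) = F \<bullet> u"
    "cright A (prolong_split F h f s u) = h \<bullet> (f \<bullet> u)"
    "ctop A (prolong_split F h f s u) = hid A (vdom A u)" "cbot A (prolong_split F h f s u) = hid A (vcod A h)"
proof -
  note [simp] = splitsD[OF s] u
  show e: "prolong_split F h f s u = hidc A u \<oslash> s \<parallel> assoc A h f u"
    by (simp add: prolong_split_def prolong_def)
  show "prolong_split F h f s u \<in> Cell A" "cleft A (prolong_split F h f s u) = F \<bullet> u"
    "cright A (prolong_split F h f s u) = h \<bullet> (f \<bullet> u)"
    "ctop A (prolong_split F h f s u) = hid A (vdom A u)" "cbot A (prolong_split F h f s u) = hid A (vcod A h)"
    "\<guillemotleft>prolong_split F h f s u : F \<bullet> u \<Rightarrow> h \<bullet> (f \<bullet> u)\<guillemotright>"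
    by (simp_all add: e is_globular_def)
qed

lemma prolong_join:
  assumes j: "joins h f F j" and u: "u \<in> Ver A" "vcod A u = vdom A f"
  shows "prolong_join h f F j u = assoc_inv h f u \<parallel> hidc A u \<oslash> j"
    "\<guillemotleft>prolong_join h f F j u : h \<bullet> (f \<bullet> u) \<Rightarrow> F \<bullet> u\<guillemotright>"
    "prolong_join h f F j u \<in> Cell A" "cright A (prolong_join h f F j u) = F \<bullet> u"
    "cleft A (prolong_join h f F j u) = h \<bullet> (f \<bullet> u)"
    "ctop A (prolong_join h f F j u) = hid A (vdom A u)" "cbot A (prolong_join h f F j u) = hid A (vcod A h)"
proof -
  note [simp] = joinsD[OF j] u
  show e: "prolong_join h f F j u = assoc_inv h f u \<parallel> hidc A u \<oslash> j"
    by (simp add: prolong_join_def prolong_def)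
  show "prolong_join h f F j u \<in> Cell A" "cright A (prolong_join h f F j u) = F \<bullet> u"
    "cleft A (prolong_join h f F j u) = h \<bullet> (f \<bullet> u)"
    "ctop A (prolong_join h f F j u) = hid A (vdom A u)" "cbot A (prolong_join h f F j u) = hid A (vcod A h)"
    "\<guillemotleft>prolong_join h f F j u : h \<bullet> (f \<bullet> u) \<Rightarrow> F \<bullet> u\<guillemotright>"
    by (simp_all add: e is_globular_def)
qed

definition quintet_hcomp where
  "quintet_hcomp x h k w f g v G s \<beta> \<alpha> j =
     s \<oslash> hidc A x \<parallel> (prolong x h k w \<beta> f \<parallel> (\<alpha> \<oslash> hidc A k \<parallel> prolong_join k g G j v))"

definition quintet_vcomp where
  "quintet_vcomp w' w f g v h v' \<alpha> \<alpha>' =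
     assoc A w' w f \<parallel> (\<alpha> \<oslash> hidc A w' \<parallel> prolong w' g h v' \<alpha>' v)"

lemma quintet_hcomp:
  assumes \<alpha>: "quintet w f g v \<alpha>" and \<beta>: "quintet x h k w \<beta>"
    and s: "splits F h f s" and j: "joins k g G j"
  shows "quintet x F G v (quintet_hcomp x h k w f g v G s \<beta> \<alpha> j)"
proof -
  note [simp] = quintetD[OF \<alpha>] quintetD[OF \<beta>] splitsD[OF s] joinsD[OF j]
    prolong_boundary[OF \<beta>] prolong_join(2-)[OF j]
  show ?thesis
    unfolding quintet_hcomp_def by (rule quintetI) simp_all
qed

lemma quintet_vcomp:
  assumes \<alpha>: "quintet w f g v \<alpha>" and \<beta>: "quintet w' g h v' \<alpha>'"
  shows "quintet (w' \<bullet> w) f h (v' \<bullet> v) (quintet_vcomp w' w f g v h v' \<alpha> \<alpha>')"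
proof -
  have [simp]: "vcod A w = vdom A w'"
    using quintetD(8)[OF \<alpha>] quintetD(5)[OF \<beta>] by simp
  note [simp] = quintetD[OF \<alpha>] quintetD[OF \<beta>] prolong_boundary[OF \<beta>]
  show ?thesis
    unfolding quintet_vcomp_def by (rule quintetI) simp_all
qed

text \<open>
  The four factors of a horizontal pasting prolong independently of each other: the rebracketing cells
  that \<open>prolong_whisker\<close> leaves between neighbouring factors cancel.
\<close>

lemma prolong_hcomp:
  assumes \<alpha>: "quintet w f g v \<alpha>" and \<beta>: "quintet x h k w \<beta>"
    and s: "splits F h f s" and j: "joins k g G j"
    and u: "u \<in> Ver A" "vcod A u = vdom A f"
  shows "prolong x F G v (quintet_hcomp x h k w f g v G s \<beta> \<alpha> j) u =
    prolong_split F h f s u \<oslash> hidc A x \<parallel> (prolong x h k w \<beta> (f \<bullet> u) \<parallel>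
      (prolong w f g v \<alpha> u \<oslash> hidc A k \<parallel> prolong_join k g G j (v \<bullet> u)))"
proof -
  note [simp] = quintetD[OF \<alpha>] quintetD[OF \<beta>] splitsD[OF s] joinsD[OF j]
    prolong_boundary[OF \<beta>] prolong_join(2-)[OF j] u
  have 1: "assoc_inv x F u \<parallel> hidc A u \<oslash> (s \<oslash> hidc A x) = hidc A u \<oslash> s \<oslash> hidc A x \<parallel> assoc_inv x (h \<bullet> f) u"
    using assoc_inv_natural[of "hidc A u" s "hidc A x"] by simp
  have 2: "assoc_inv x (h \<bullet> f) u \<parallel> hidc A u \<oslash> prolong x h k w \<beta> f =
    assoc A h f u \<oslash> hidc A x \<parallel> (prolong x h k w \<beta> (f \<bullet> u) \<parallel>
      (assoc_inv w f u \<oslash> hidc A k \<parallel> assoc_inv k (w \<bullet> f) u))"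
    by (rule prolong_whisker[OF \<beta>]) simp_all
  have 3: "assoc_inv k (w \<bullet> f) u \<parallel> hidc A u \<oslash> (\<alpha> \<oslash> hidc A k) =
     hidc A u \<oslash> \<alpha> \<oslash> hidc A k \<parallel> assoc_inv k (g \<bullet> v) u"
    using assoc_inv_natural[of "hidc A u" \<alpha> "hidc A k"] by simp
  have 4: "assoc_inv k (g \<bullet> v) u \<parallel> hidc A u \<oslash> prolong_join k g G j v =
    assoc A g v u \<oslash> hidc A k \<parallel> (prolong_join k g G j (v \<bullet> u) \<parallel> assoc_inv G v u)"
    using prolong_whisker[OF joinsD(13)[OF j], of v u] by (simp add: prolong_join_def)
  have "prolong x F G v (quintet_hcomp x h k w f g v G s \<beta> \<alpha> j) u =
    assoc_inv x F u \<parallel> (hidc A u \<oslash> (s \<oslash> hidc A x) \<parallel> (hidc A u \<oslash> prolong x h k w \<beta> f \<parallel>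
      (hidc A u \<oslash> (\<alpha> \<oslash> hidc A k) \<parallel> (hidc A u \<oslash> prolong_join k g G j v \<parallel> assoc A G v u))))"
    unfolding prolong_def[of x F G v] quintet_hcomp_def by (simp add: whisker_hpaste hpaste_assoc)
  also have "\<dots> = hidc A u \<oslash> s \<oslash> hidc A x \<parallel> (assoc A h f u \<oslash> hidc A x \<parallel> (prolong x h k w \<beta> (f \<bullet> u) \<parallel>
      (assoc_inv w f u \<oslash> hidc A k \<parallel> (hidc A u \<oslash> \<alpha> \<oslash> hidc A k \<parallel> (assoc A g v u \<oslash> hidc A k \<parallel>
       prolong_join k g G j (v \<bullet> u))))))"
    by (simp add: hpaste_eq_assoc[OF 1] hpaste_eq_assoc[OF 2] hpaste_eq_assoc[OF 3]
        hpaste_eq_assoc[OF 4] hpaste_assoc)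
  also have "\<dots> = prolong_split F h f s u \<oslash> hidc A x \<parallel> (prolong x h k w \<beta> (f \<bullet> u) \<parallel>
      (prolong w f g v \<alpha> u \<oslash> hidc A k \<parallel> prolong_join k g G j (v \<bullet> u)))"
    unfolding prolong_split(1)[OF s u] prolong_def[of w f g v \<alpha>]
    by (simp add: whisker_hpaste hpaste_assoc)
  finally show ?thesis .
qed

lemma prolong_vcomp:
  assumes \<alpha>: "quintet w f g v \<alpha>" and \<beta>: "quintet w' g h v' \<alpha>'"
    and u: "u \<in> Ver A" "vcod A u = vdom A f"
  shows "prolong (w' \<bullet> w) f h (v' \<bullet> v) (quintet_vcomp w' w f g v h v' \<alpha> \<alpha>') u =
    assoc A w' w (f \<bullet> u) \<parallel> (prolong w f g v \<alpha> u \<oslash> hidc A w' \<parallel> (prolong w' g h v' \<alpha>' (v \<bullet> u) \<parallel>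
      assoc_inv v' v u \<oslash> hidc A h))"
proof -
  have [simp]: "vcod A w = vdom A w'"
    using quintetD(8)[OF \<alpha>] quintetD(5)[OF \<beta>] by simp
  note [simp] = quintetD[OF \<alpha>] quintetD[OF \<beta>] prolong_boundary[OF \<beta>] u
  have 1: "assoc_inv (w' \<bullet> w) f u \<parallel> hidc A u \<oslash> assoc A w' w f =
    assoc A w' w (f \<bullet> u) \<parallel> (assoc_inv w f u \<oslash> hidc A w' \<parallel> assoc_inv w' (w \<bullet> f) u)"
    by (rule pentagon_inv(2)) simp_all
  have 2: "assoc_inv w' (w \<bullet> f) u \<parallel> hidc A u \<oslash> (\<alpha> \<oslash> hidc A w') =
     hidc A u \<oslash> \<alpha> \<oslash> hidc A w' \<parallel> assoc_inv w' (g \<bullet> v) u"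
    using assoc_inv_natural[of "hidc A u" \<alpha> "hidc A w'"] by simp
  have 3: "assoc_inv w' (g \<bullet> v) u \<parallel> hidc A u \<oslash> prolong w' g h v' \<alpha>' v =
    assoc A g v u \<oslash> hidc A w' \<parallel> (prolong w' g h v' \<alpha>' (v \<bullet> u) \<parallel>
      (assoc_inv v' v u \<oslash> hidc A h \<parallel> assoc_inv h (v' \<bullet> v) u))"
    by (rule prolong_whisker[OF \<beta>]) simp_all
  have "prolong (w' \<bullet> w) f h (v' \<bullet> v) (quintet_vcomp w' w f g v h v' \<alpha> \<alpha>') u =
    assoc_inv (w' \<bullet> w) f u \<parallel> (hidc A u \<oslash> assoc A w' w f \<parallel> (hidc A u \<oslash> (\<alpha> \<oslash> hidc A w') \<parallel>
      (hidc A u \<oslash> prolong w' g h v' \<alpha>' v \<parallel> assoc A h (v' \<bullet> v) u)))"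
    unfolding prolong_def[of "w' \<bullet> w"] quintet_vcomp_def by (simp add: whisker_hpaste hpaste_assoc)
  also have "\<dots> = assoc A w' w (f \<bullet> u) \<parallel> (prolong w f g v \<alpha> u \<oslash> hidc A w' \<parallel>
      (prolong w' g h v' \<alpha>' (v \<bullet> u) \<parallel> assoc_inv v' v u \<oslash> hidc A h))"
    unfolding prolong_def[of w f g v \<alpha>]
    by (simp add: hpaste_eq_assoc[OF 1] hpaste_eq_assoc[OF 2] hpaste_eq_assoc[OF 3]
        whisker_hpaste hpaste_assoc)
  finally show ?thesis .
qed

text \<open>
  Coherence of the comparison cells persists under prolongation; this is what associativity
  needs on the bottom side, where the cells are applied after \<open>v\<close>.
\<close>

lemma prolong_join_coherence:
  assumes j1: "joins k g G1 j1" and j2: "joins m k G2 j2"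
    and j3: "joins m G1 G3 j3" and j4: "joins G2 g G3 j4"
    and coh: "j1 \<oslash> hidc A m \<parallel> j3 = assoc_inv m k g \<parallel> (hidc A g \<oslash> j2 \<parallel> j4)"
    and v: "v \<in> Ver A" "vcod A v = vdom A g"
  shows "prolong_join k g G1 j1 v \<oslash> hidc A m \<parallel> prolong_join m G1 G3 j3 v =
    prolong_join m k G2 j2 (g \<bullet> v) \<parallel> prolong_join G2 g G3 j4 v"
proof -
  have [simp]: "vcod A k = vdom A m" "vdom A G1 = vdom A g" "vdom A k = vcod A g"
    using joinsD(4)[OF j1] joinsD(4)[OF j2] joinsD(4-6)[OF j3] joinsD(5,6)[OF j1] by simp_all
  note [simp] = joinsD(1-3,7-)[OF j1] joinsD(1-3,5-)[OF j2] joinsD(1-3,6-)[OF j3] joinsD(1-3,7-)[OF j4] v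
  have [simp]: "vcod A G1 = vdom A m" "vdom A G3 = vdom A g" "vcod A G3 = vcod A m"
    using joinsD(4-6)[OF j3] by simp_all
  have 1: "hidc A v \<oslash> j1 \<oslash> hidc A m \<parallel> assoc_inv m G1 v =
      assoc_inv m (k \<bullet> g) v \<parallel> hidc A v \<oslash> (j1 \<oslash> hidc A m)"
    using assoc_inv_natural[of "hidc A v" j1 "hidc A m"] by simp
  have 2: "hidc A v \<oslash> (j1 \<oslash> hidc A m) \<parallel> hidc A v \<oslash> j3 =
      hidc A v \<oslash> assoc_inv m k g \<parallel> (hidc A v \<oslash> (hidc A g \<oslash> j2) \<parallel> hidc A v \<oslash> j4)"
    using arg_cong[OF coh, of "\<lambda>c. hidc A v \<oslash> c"] by (simp add: whisker_hpaste)
  have 3: "assoc_inv k g v \<oslash> hidc A m \<parallel> (assoc_inv m (k \<bullet> g) v \<parallel> hidc A v \<oslash> assoc_inv m k g) =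
      assoc_inv m k (g \<bullet> v) \<parallel> assoc_inv (m \<bullet> k) g v"
    by (rule pentagon_inv(3)) simp_all
  have 4: "assoc_inv (m \<bullet> k) g v \<parallel> hidc A v \<oslash> (hidc A g \<oslash> j2) =
      hidc A (g \<bullet> v) \<oslash> j2 \<parallel> assoc_inv G2 g v"
    using assoc_inv_natural[of "hidc A v" "hidc A g" j2] by simp
  have "prolong_join k g G1 j1 v \<oslash> hidc A m \<parallel> prolong_join m G1 G3 j3 v =
      assoc_inv k g v \<oslash> hidc A m \<parallel> (hidc A v \<oslash> j1 \<oslash> hidc A m \<parallel> (assoc_inv m G1 v \<parallel> hidc A v \<oslash> j3))"
    using prolong_join(1)[OF j1, of v] prolong_join(1)[OF j3, of v] by (simp add: whisker_hpaste hpaste_assoc)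
  also have "\<dots> = assoc_inv k g v \<oslash> hidc A m \<parallel> (assoc_inv m (k \<bullet> g) v \<parallel> hidc A v \<oslash> assoc_inv m k g) \<parallel>
      (hidc A v \<oslash> (hidc A g \<oslash> j2) \<parallel> hidc A v \<oslash> j4)"
    by (simp add: hpaste_eq_assoc[OF 1] 2 hpaste_assoc)
  also have "\<dots> = assoc_inv m k (g \<bullet> v) \<parallel> (assoc_inv (m \<bullet> k) g v \<parallel> hidc A v \<oslash> (hidc A g \<oslash> j2) \<parallel> hidc A v \<oslash> j4)"
    by (subst 3) (simp add: hpaste_assoc)
  also have "\<dots> = prolong_join m k G2 j2 (g \<bullet> v) \<parallel> prolong_join G2 g G3 j4 v"
    using prolong_join(1)[OF j2, of "g \<bullet> v"] prolong_join(1)[OF j4, of v]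
    by (simp add: 4 whisker_hpaste hpaste_assoc)
  finally show ?thesis .
qed

text \<open>
  Both bracketings unfold to a chain of prolonged factors in which \<open>\<gamma>\<close>, \<open>\<beta>\<close>, \<open>\<alpha>\<close> occur in this
  order. They differ only by sliding \<open>s1\<close> past \<open>\<gamma>\<close> and \<open>j2\<close> past \<open>\<alpha>\<close>, and by the coherence of
  the comparison cells.
\<close>

lemma quintet_hcomp_assoc:
  assumes \<alpha>: "quintet w f g v \<alpha>" and \<beta>: "quintet x h k w \<beta>" and \<gamma>: "quintet y l m x \<gamma>"
    and s: "splits F1 h f s1" "splits F2 l h s2" "splits F3 l F1 s3" "splits F3 F2 f s4"
    and j: "joins k g G1 j1" "joins m k G2 j2" "joins m G1 G3 j3" "joins G2 g G3 j4"
    and cohs: "s3 \<parallel> s1 \<oslash> hidc A l = s4 \<parallel> (hidc A f \<oslash> s2 \<parallel> assoc A l h f)"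
    and cohj: "j1 \<oslash> hidc A m \<parallel> j3 = assoc_inv m k g \<parallel> (hidc A g \<oslash> j2 \<parallel> j4)"
  shows "quintet_hcomp y l m x F1 G1 v G3 s3 \<gamma> (quintet_hcomp x h k w f g v G1 s1 \<beta> \<alpha> j1) j3 =
    quintet_hcomp y F2 G2 w f g v G3 s4 (quintet_hcomp y l m x h k w G2 s2 \<gamma> \<beta> j2) \<alpha> j4"
proof -
  note [simp] = quintetD[OF \<alpha>] quintetD[OF \<beta>] quintetD[OF \<gamma>]
  have [simp]: "F1 \<in> Ver A" "F2 \<in> Ver A" "F3 \<in> Ver A" "G1 \<in> Ver A" "G2 \<in> Ver A" "G3 \<in> Ver A"
    "vdom A F1 = vdom A f" "vcod A F1 = vdom A x" "vdom A F2 = vdom A h" "vcod A F2 = vdom A y"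
    "vdom A F3 = vdom A f" "vcod A F3 = vdom A y"
    "vdom A G1 = vdom A g" "vcod A G1 = vcod A x" "vdom A G2 = vdom A k" "vcod A G2 = vcod A y"
    "vdom A G3 = vdom A g" "vcod A G3 = vcod A y"
    using s[THEN splitsD(1)] s[THEN splitsD(5)] s[THEN splitsD(6)]
      j[THEN joinsD(1)] j[THEN joinsD(5)] j[THEN joinsD(6)] by simp_all
  note [simp] = s[THEN splitsD(7)] s[THEN splitsD(8)] s[THEN splitsD(9)]
    j[THEN joinsD(7)] j[THEN joinsD(8)] j[THEN joinsD(9)]
  have [simp]: "ctop A s1 = hid A (vdom A f)" "cbot A s1 = hid A (vdom A x)"
    "ctop A s2 = hid A (vdom A h)" "cbot A s2 = hid A (vdom A y)"
    "ctop A s3 = hid A (vdom A f)" "cbot A s3 = hid A (vdom A y)"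
    "ctop A s4 = hid A (vdom A f)" "cbot A s4 = hid A (vdom A y)"
    using s[THEN splitsD(10)] s[THEN splitsD(11)] by simp_all
  note [simp] = prolong_boundary[OF \<beta>] prolong_boundary[OF \<gamma>] prolong_join(3-)[OF j(1)]
    prolong_join(3-)[OF j(2)] prolong_join(3-)[OF j(3)] prolong_join(3-)[OF j(4)]
  have 1: "prolong y l m x \<gamma> F1 \<parallel> s1 \<oslash> hidc A x \<oslash> hidc A m =
      s1 \<oslash> hidc A l \<oslash> hidc A y \<parallel> prolong y l m x \<gamma> (h \<bullet> f)"
    using prolong_natural[OF \<gamma> splitsD(12)[OF s(1)]] by simp
  have 2: "prolong_join m k G2 j2 (w \<bullet> f) \<parallel> \<alpha> \<oslash> hidc A G2 =
      \<alpha> \<oslash> hidc A k \<oslash> hidc A m \<parallel> prolong_join m k G2 j2 (g \<bullet> v)"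
    using prolong_natural[OF joinsD(13)[OF j(2)] quintetD(14)[OF \<alpha>]] by (simp add: prolong_join_def)
  have 3: "prolong_join k g G1 j1 v \<oslash> hidc A m \<parallel> prolong_join m G1 G3 j3 v =
      prolong_join m k G2 j2 (g \<bullet> v) \<parallel> prolong_join G2 g G3 j4 v"
    by (rule prolong_join_coherence[OF j cohj]) simp_all
  have 4: "s3 \<oslash> hidc A y \<parallel> s1 \<oslash> hidc A l \<oslash> hidc A y =
      s4 \<oslash> hidc A y \<parallel> prolong_split F2 l h s2 f \<oslash> hidc A y"
    using arg_cong[OF cohs, of "\<lambda>c. c \<oslash> hidc A y"] prolong_split(1)[OF s(2), of f]
    by (simp add: whisker_hpaste)
  note es [simp] = prolong_split(3-)[OF s(2)]
  have "quintet_hcomp y l m x F1 G1 v G3 s3 \<gamma> (quintet_hcomp x h k w f g v G1 s1 \<beta> \<alpha> j1) j3 =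
    s3 \<oslash> hidc A y \<parallel> (prolong y l m x \<gamma> F1 \<parallel> (s1 \<oslash> hidc A x \<oslash> hidc A m \<parallel> (prolong x h k w \<beta> f \<oslash> hidc A m \<parallel>
      (\<alpha> \<oslash> hidc A k \<oslash> hidc A m \<parallel> (prolong_join k g G1 j1 v \<oslash> hidc A m \<parallel> prolong_join m G1 G3 j3 v)))))"
    unfolding quintet_hcomp_def by (simp add: whisker_hpaste hpaste_assoc)
  also have "\<dots> = s4 \<oslash> hidc A y \<parallel> (prolong_split F2 l h s2 f \<oslash> hidc A y \<parallel> (prolong y l m x \<gamma> (h \<bullet> f) \<parallel>
      (prolong x h k w \<beta> f \<oslash> hidc A m \<parallel> (\<alpha> \<oslash> hidc A k \<oslash> hidc A m \<parallel> (prolong_join m k G2 j2 (g \<bullet> v) \<parallel> prolong_join G2 g G3 j4 v)))))"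
    by (simp add: hpaste_eq_assoc[OF 1] hpaste_eq_assoc[OF 4] 3 hpaste_assoc)
  also have "\<dots> = s4 \<oslash> hidc A y \<parallel> (prolong_split F2 l h s2 f \<oslash> hidc A y \<parallel> (prolong y l m x \<gamma> (h \<bullet> f) \<parallel>
      (prolong x h k w \<beta> f \<oslash> hidc A m \<parallel> (prolong_join m k G2 j2 (w \<bullet> f) \<parallel> (\<alpha> \<oslash> hidc A G2 \<parallel> prolong_join G2 g G3 j4 v)))))"
    by (simp add: hpaste_eq_assoc[OF 2] hpaste_assoc)
  also have "\<dots> = quintet_hcomp y F2 G2 w f g v G3 s4 (quintet_hcomp y l m x h k w G2 s2 \<gamma> \<beta> j2) \<alpha> j4"
    unfolding quintet_hcomp_def[of y F2]
    by (subst prolong_hcomp[OF \<beta> \<gamma> s(2) j(2)]) (simp_all add: hpaste_assoc)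
  finally show ?thesis .
qed

text \<open>
  Pasting rows first produces the comparison \<open>j1\<close> of the upper row directly followed by the
  comparison \<open>s2\<close> of the lower row; these cancel, and then \<open>\<alpha>\<close> and \<open>\<beta>'\<close> are adjacent and
  change places by naturality of the prolongation of \<open>\<beta>'\<close>.
\<close>

lemma quintet_interchange:
  assumes \<alpha>: "quintet w f g v \<alpha>" and \<beta>: "quintet x h k w \<beta>"
    and \<alpha>': "quintet w' g l v' \<alpha>'" and \<beta>': "quintet x' k m w' \<beta>'"
    and s: "splits F h f s1" "splits G k g s2" and j: "joins k g G j1" "joins m l H j2"
    and inv: "j1 \<parallel> s2 = hidc A (k \<bullet> g)"
  shows "quintet_vcomp x' x F G v H v' (quintet_hcomp x h k w f g v G s1 \<beta> \<alpha> j1)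
      (quintet_hcomp x' k m w' g l v' H s2 \<beta>' \<alpha>' j2) =
    quintet_hcomp (x' \<bullet> x) h m (w' \<bullet> w) f l (v' \<bullet> v) H s1
      (quintet_vcomp x' x h k w m w' \<beta> \<beta>') (quintet_vcomp w' w f g v l v' \<alpha> \<alpha>') j2"
proof -
  have [simp]: "w \<in> Ver A" "f \<in> Ver A" "g \<in> Ver A" "v \<in> Ver A" "x \<in> Ver A" "h \<in> Ver A" "k \<in> Ver A"
    "w' \<in> Ver A" "l \<in> Ver A" "v' \<in> Ver A" "x' \<in> Ver A" "m \<in> Ver A" "F \<in> Ver A" "G \<in> Ver A" "H \<in> Ver A"
    using quintetD[OF \<alpha>] quintetD[OF \<beta>] quintetD[OF \<alpha>'] quintetD[OF \<beta>']
      s[THEN splitsD(1)] j[THEN joinsD(1)] by simp_all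
  have [simp]: "vdom A v = vdom A f" "vdom A h = vdom A w" "vcod A f = vdom A w"
     "vcod A h = vdom A x" "vdom A g = vcod A v" "vdom A v' = vcod A v" "vcod A g = vdom A w'" "vdom A k = vdom A w'"
     "vcod A w = vdom A w'" "vcod A x = vdom A x'" "vcod A k = vdom A x'" "vdom A l = vcod A v'"
     "vcod A l = vcod A w'" "vdom A m = vcod A w'" "vcod A m = vcod A x'"
     "vdom A F = vdom A f" "vcod A F = vdom A x" "vdom A G = vcod A v" "vcod A G = vdom A x'"
     "vdom A H = vcod A v'" "vcod A H = vcod A x'"
    using quintetD(5-8)[OF \<alpha>] quintetD(5-8)[OF \<beta>] quintetD(5-8)[OF \<alpha>'] quintetD(5-8)[OF \<beta>']
      s[THEN splitsD(4)] s[THEN splitsD(5)] s[THEN splitsD(6)]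
      j[THEN joinsD(4)] j[THEN joinsD(5)] j[THEN joinsD(6)] by metis+
  note [simp] = quintetD(9-)[OF \<alpha>] quintetD(9-)[OF \<beta>] quintetD(9-)[OF \<alpha>'] quintetD(9-)[OF \<beta>']
    prolong_boundary[OF \<alpha>] prolong_boundary[OF \<beta>] prolong_boundary[OF \<alpha>'] prolong_boundary[OF \<beta>']
    splitsD(7-11)[OF s(1)] splitsD(7-11)[OF s(2)] joinsD(7-11)[OF j(1)] joinsD(7-11)[OF j(2)]
    prolong_split(3-)[OF s(1)] prolong_split(3-)[OF s(2)] prolong_join(3-)[OF j(1)] prolong_join(3-)[OF j(2)]
  \<comment> \<open>The comparison cells between the two rows cancel also after prolongation.\<close>
  have inv_v: "prolong_join k g G j1 v \<parallel> prolong_split G k g s2 v = hidc A (k \<bullet> (g \<bullet> v))"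
  proof -
    have "hidc A v \<oslash> j1 \<parallel> hidc A v \<oslash> s2 = hidc A (k \<bullet> g \<bullet> v)"
      by (subst whisker_hpaste(2)[symmetric]) (simp_all add: inv)
    from hpaste_eq_assoc[OF this, of "assoc A k g v"]
    have "hidc A v \<oslash> j1 \<parallel> (hidc A v \<oslash> s2 \<parallel> assoc A k g v) = assoc A k g v" by simp
    then show ?thesis
      using prolong_join(1)[OF j(1), of v] prolong_split(1)[OF s(2), of v] by (simp add: hpaste_assoc)
  qed
  have 1: "prolong_join k g G j1 v \<oslash> hidc A x' \<parallel> prolong_split G k g s2 v \<oslash> hidc A x' =
      hidc A (x' \<bullet> (k \<bullet> (g \<bullet> v)))"
    by (subst whisker_hpaste(1)[symmetric]) (simp_all add: inv_v)
  have 2: "s1 \<oslash> hidc A (x' \<bullet> x) \<parallel> assoc A x' x (h \<bullet> f) = assoc A x' x F \<parallel> s1 \<oslash> hidc A x \<oslash> hidc A x'"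
    using assoc_natural[of s1 "hidc A x" "hidc A x'"] by simp
  have 3: "prolong x' k m w' \<beta>' (w \<bullet> f) \<parallel> \<alpha> \<oslash> hidc A w' \<oslash> hidc A m =
      \<alpha> \<oslash> hidc A k \<oslash> hidc A x' \<parallel> prolong x' k m w' \<beta>' (g \<bullet> v)"
    using prolong_natural[OF \<beta>' quintetD(14)[OF \<alpha>]] by simp
  have 4: "assoc_inv w' w f \<oslash> hidc A m \<parallel> assoc A w' w f \<oslash> hidc A m = hidc A (m \<bullet> (w' \<bullet> (w \<bullet> f)))"
    by (subst whisker_hpaste(1)[symmetric]) simp_all
  have "quintet_vcomp x' x F G v H v' (quintet_hcomp x h k w f g v G s1 \<beta> \<alpha> j1)
      (quintet_hcomp x' k m w' g l v' H s2 \<beta>' \<alpha>' j2) =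
    assoc A x' x F \<parallel> (s1 \<oslash> hidc A x \<oslash> hidc A x' \<parallel> (prolong x h k w \<beta> f \<oslash> hidc A x' \<parallel>
      (\<alpha> \<oslash> hidc A k \<oslash> hidc A x' \<parallel> (prolong_join k g G j1 v \<oslash> hidc A x' \<parallel> (prolong_split G k g s2 v \<oslash> hidc A x' \<parallel>
      (prolong x' k m w' \<beta>' (g \<bullet> v) \<parallel> (prolong w' g l v' \<alpha>' v \<oslash> hidc A m \<parallel> prolong_join m l H j2 (v' \<bullet> v))))))))"
    unfolding quintet_vcomp_def quintet_hcomp_def[of x]
    by (subst prolong_hcomp[OF \<alpha>' \<beta>' s(2) j(2)]) (simp_all add: whisker_hpaste hpaste_assoc)
  also have "\<dots> = assoc A x' x F \<parallel> (s1 \<oslash> hidc A x \<oslash> hidc A x' \<parallel> (prolong x h k w \<beta> f \<oslash> hidc A x' \<parallel>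
      (prolong x' k m w' \<beta>' (w \<bullet> f) \<parallel> (\<alpha> \<oslash> hidc A w' \<oslash> hidc A m \<parallel>
      (prolong w' g l v' \<alpha>' v \<oslash> hidc A m \<parallel> prolong_join m l H j2 (v' \<bullet> v))))))"
    by (simp add: hpaste_eq_assoc[OF 1] hpaste_eq_assoc[OF 3] hpaste_assoc)
  also have "\<dots> = s1 \<oslash> hidc A (x' \<bullet> x) \<parallel> (assoc A x' x (h \<bullet> f) \<parallel> (prolong x h k w \<beta> f \<oslash> hidc A x' \<parallel>
      (prolong x' k m w' \<beta>' (w \<bullet> f) \<parallel> (assoc_inv w' w f \<oslash> hidc A m \<parallel> (assoc A w' w f \<oslash> hidc A m \<parallel>
      (\<alpha> \<oslash> hidc A w' \<oslash> hidc A m \<parallel>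
      (prolong w' g l v' \<alpha>' v \<oslash> hidc A m \<parallel> prolong_join m l H j2 (v' \<bullet> v))))))))"
    by (simp add: hpaste_eq_assoc[OF 2] hpaste_eq_assoc[OF 4] hpaste_assoc)
  also have "\<dots> = quintet_hcomp (x' \<bullet> x) h m (w' \<bullet> w) f l (v' \<bullet> v) H s1
      (quintet_vcomp x' x h k w m w' \<beta> \<beta>') (quintet_vcomp w' w f g v l v' \<alpha> \<alpha>') j2"
    unfolding quintet_hcomp_def quintet_vcomp_def[of w']
    by (subst prolong_vcomp[OF \<beta> \<beta>']) (simp_all add: whisker_hpaste hpaste_assoc)
  finally show ?thesis .
qed

lemma quintet_vcomp_assoc:
  assumes \<alpha>: "quintet w1 f g v1 \<alpha>" and \<beta>: "quintet w2 g h v2 \<beta>" and \<gamma>: "quintet w3 h k v3 \<gamma>"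
  shows "hidc A f \<oslash> assoc A w3 w2 w1 \<parallel>
      quintet_vcomp w3 (w2 \<bullet> w1) f h (v2 \<bullet> v1) k v3 (quintet_vcomp w2 w1 f g v1 h v2 \<alpha> \<beta>) \<gamma> =
    quintet_vcomp (w3 \<bullet> w2) w1 f g v1 k (v3 \<bullet> v2) \<alpha> (quintet_vcomp w3 w2 g h v2 k v3 \<beta> \<gamma>) \<parallel>
      assoc A v3 v2 v1 \<oslash> hidc A k"
proof -
  have [simp]: "w1 \<in> Ver A" "f \<in> Ver A" "g \<in> Ver A" "v1 \<in> Ver A" "w2 \<in> Ver A" "h \<in> Ver A" "v2 \<in> Ver A"
    "w3 \<in> Ver A" "k \<in> Ver A" "v3 \<in> Ver A"
    using quintetD[OF \<alpha>] quintetD[OF \<beta>] quintetD[OF \<gamma>] by simp_all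
  have [simp]: "vdom A v1 = vdom A f" "vcod A f = vdom A w1" "vdom A g = vcod A v1" "vdom A v2 = vcod A v1"
    "vcod A g = vdom A w2" "vcod A w1 = vdom A w2" "vdom A h = vcod A v2" "vdom A v3 = vcod A v2"
    "vcod A h = vdom A w3" "vcod A w2 = vdom A w3" "vdom A k = vcod A v3" "vcod A k = vcod A w3"
    using quintetD(5-8)[OF \<alpha>] quintetD(5-8)[OF \<beta>] quintetD(5-8)[OF \<gamma>] by metis+
  note [simp] = quintetD(9-)[OF \<alpha>] quintetD(9-)[OF \<beta>] quintetD(9-)[OF \<gamma>]
    prolong_boundary[OF \<alpha>] prolong_boundary[OF \<beta>] prolong_boundary[OF \<gamma>]
  have 1: "hidc A f \<oslash> assoc A w3 w2 w1 \<parallel> (assoc A w3 (w2 \<bullet> w1) f \<parallel> assoc A w2 w1 f \<oslash> hidc A w3) =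
      assoc A (w3 \<bullet> w2) w1 f \<parallel> assoc A w3 w2 (w1 \<bullet> f)"
    using pentagon[of f w1 w2 w3] by (simp add: hpaste_assoc)
  have 2: "assoc A w3 w2 (w1 \<bullet> f) \<parallel> \<alpha> \<oslash> hidc A w2 \<oslash> hidc A w3 =
      \<alpha> \<oslash> hidc A (w3 \<bullet> w2) \<parallel> assoc A w3 w2 (g \<bullet> v1)"
    using assoc_natural[of \<alpha> "hidc A w2" "hidc A w3"] by simp
  have 3: "assoc_inv v3 v2 v1 \<oslash> hidc A k \<parallel> assoc A v3 v2 v1 \<oslash> hidc A k = hidc A (k \<bullet> (v3 \<bullet> (v2 \<bullet> v1)))"
    by (subst whisker_hpaste(1)[symmetric]) simp_all
  have "hidc A f \<oslash> assoc A w3 w2 w1 \<parallel>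
      quintet_vcomp w3 (w2 \<bullet> w1) f h (v2 \<bullet> v1) k v3 (quintet_vcomp w2 w1 f g v1 h v2 \<alpha> \<beta>) \<gamma> =
    hidc A f \<oslash> assoc A w3 w2 w1 \<parallel> (assoc A w3 (w2 \<bullet> w1) f \<parallel> assoc A w2 w1 f \<oslash> hidc A w3) \<parallel>
      (\<alpha> \<oslash> hidc A w2 \<oslash> hidc A w3 \<parallel> (prolong w2 g h v2 \<beta> v1 \<oslash> hidc A w3 \<parallel> prolong w3 h k v3 \<gamma> (v2 \<bullet> v1)))"
    unfolding quintet_vcomp_def by (simp add: whisker_hpaste hpaste_assoc)
  also have "\<dots> = assoc A (w3 \<bullet> w2) w1 f \<parallel> (\<alpha> \<oslash> hidc A (w3 \<bullet> w2) \<parallel> (assoc A w3 w2 (g \<bullet> v1) \<parallel>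
      (prolong w2 g h v2 \<beta> v1 \<oslash> hidc A w3 \<parallel> (prolong w3 h k v3 \<gamma> (v2 \<bullet> v1) \<parallel>
        (assoc_inv v3 v2 v1 \<oslash> hidc A k \<parallel> assoc A v3 v2 v1 \<oslash> hidc A k)))))"
    unfolding 1 by (simp add: hpaste_eq_assoc[OF 2] 3 hpaste_assoc)
  also have "\<dots> = quintet_vcomp (w3 \<bullet> w2) w1 f g v1 k (v3 \<bullet> v2) \<alpha> (quintet_vcomp w3 w2 g h v2 k v3 \<beta> \<gamma>) \<parallel>
      assoc A v3 v2 v1 \<oslash> hidc A k"
    unfolding quintet_vcomp_def[of "w3 \<bullet> w2"]
    by (subst prolong_vcomp[OF \<beta> \<gamma>]) (simp_all add: hpaste_assoc)
  finally show ?thesis .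
qed

text \<open>
  When the associators on both sides are identities, as happens whenever enough of the sides are
  vertical identities, vertical pasting is strictly associative.
\<close>

lemma vpaste_assoc_unit:
  assumes c: "\<alpha> \<in> Cell A" "\<beta> \<in> Cell A" "\<gamma> \<in> Cell A" "cbot A \<alpha> = ctop A \<beta>" "cbot A \<beta> = ctop A \<gamma>"
    and l: "assoc A (cleft A \<gamma>) (cleft A \<beta>) (cleft A \<alpha>) = hidc A V" "V \<in> Ver A"
    and r: "assoc A (cright A \<gamma>) (cright A \<beta>) (cright A \<alpha>) = hidc A W" "W \<in> Ver A"
  shows "\<alpha> \<oslash> (\<beta> \<oslash> \<gamma>) = \<alpha> \<oslash> \<beta> \<oslash> \<gamma>"
proof -
  have b: "vcod A (cleft A \<alpha>) = vdom A (cleft A \<beta>)" "vcod A (cleft A \<beta>) = vdom A (cleft A \<gamma>)"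
    "vcod A (cright A \<alpha>) = vdom A (cright A \<beta>)" "vcod A (cright A \<beta>) = vdom A (cright A \<gamma>)"
    using c by (simp_all flip: corner_tl corner_bl corner_tr corner_br)
  have "cright A (hidc A V) = cleft A \<gamma> \<bullet> (cleft A \<beta> \<bullet> cleft A \<alpha>)"
    unfolding l(1)[symmetric] using b c by simp
  moreover have "cleft A (hidc A W) = cright A \<gamma> \<bullet> cright A \<beta> \<bullet> cright A \<alpha>"
    unfolding r(1)[symmetric] using b c by simp
  ultimately show ?thesis
    using assoc_natural[OF c] c l r by simp
qed

end

section \<open>Inverse double functors\<close>

text \<open>
  Each law for the inverse holds after applying the given functor to both sides, and
  the latter is injective.
\<close>

lemma double_functor_inverse:
  assumes F: "double_functor A B F" and GF: "inverse_on A F G" and FG: "inverse_on B G F"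
    and obj: "\<And>X. X \<in> Obj B \<Longrightarrow> on_obj G X \<in> Obj A" and hor: "\<And>f. f \<in> Hor B \<Longrightarrow> on_hor G f \<in> Hor A"
    and ver: "\<And>v. v \<in> Ver B \<Longrightarrow> on_ver G v \<in> Ver A" and cell: "\<And>\<alpha>. \<alpha> \<in> Cell B \<Longrightarrow> on_cell G \<alpha> \<in> Cell A"
  shows "double_functor B A G"
proof -
  interpret F: double_functor A B F by (rule F)
  have GF': "\<And>X. X \<in> Obj A \<Longrightarrow> on_obj G (on_obj F X) = X" "\<And>f. f \<in> Hor A \<Longrightarrow> on_hor G (on_hor F f) = f"
    "\<And>v. v \<in> Ver A \<Longrightarrow> on_ver G (on_ver F v) = v" "\<And>\<alpha>. \<alpha> \<in> Cell A \<Longrightarrow> on_cell G (on_cell F \<alpha>) = \<alpha>"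
    using GF by (simp_all add: inverse_on_def)
  have FG': "\<And>X. X \<in> Obj B \<Longrightarrow> on_obj F (on_obj G X) = X" "\<And>f. f \<in> Hor B \<Longrightarrow> on_hor F (on_hor G f) = f"
    "\<And>v. v \<in> Ver B \<Longrightarrow> on_ver F (on_ver G v) = v" "\<And>\<alpha>. \<alpha> \<in> Cell B \<Longrightarrow> on_cell F (on_cell G \<alpha>) = \<alpha>"
    using FG by (simp_all add: inverse_on_def)
  have hdom: "hdom A (on_hor G f) = on_obj G (hdom B f)" "hcod A (on_hor G f) = on_obj G (hcod B f)"
    if "f \<in> Hor B" for f
    using F.on_hdom[OF hor[OF that]] F.on_hcod[OF hor[OF that]] GF'(1)[of "hdom A (on_hor G f)"]
      GF'(1)[of "hcod A (on_hor G f)"] FG'(2)[OF that] hor[OF that] F.dom.hdom_in F.dom.hcod_in by auto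
  have vdom: "vdom A (on_ver G v) = on_obj G (vdom B v)" "vcod A (on_ver G v) = on_obj G (vcod B v)"
    if "v \<in> Ver B" for v
    using F.on_vdom[OF ver[OF that]] F.on_vcod[OF ver[OF that]] GF'(1)[of "vdom A (on_ver G v)"]
      GF'(1)[of "vcod A (on_ver G v)"] FG'(3)[OF that] ver[OF that] F.dom.vdom_in F.dom.vcod_in by auto
  have bd: "ctop A (on_cell G \<alpha>) = on_hor G (ctop B \<alpha>)" "cbot A (on_cell G \<alpha>) = on_hor G (cbot B \<alpha>)"
    "cleft A (on_cell G \<alpha>) = on_ver G (cleft B \<alpha>)" "cright A (on_cell G \<alpha>) = on_ver G (cright B \<alpha>)"
    if "\<alpha> \<in> Cell B" for \<alpha>
    using F.on_ctop[OF cell[OF that]] F.on_cbot[OF cell[OF that]] F.on_cleft[OF cell[OF that]]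
      F.on_cright[OF cell[OF that]] FG'(4)[OF that]
      GF'(2)[OF F.dom.ctop_in[OF cell[OF that]]] GF'(2)[OF F.dom.cbot_in[OF cell[OF that]]]
      GF'(3)[OF F.dom.cleft_in[OF cell[OF that]]] GF'(3)[OF F.dom.cright_in[OF cell[OF that]]] by simp_all
  show ?thesis
  proof unfold_locales
    show "on_hor G (hid B X) = hid A (on_obj G X)" if "X \<in> Obj B" for X
      using GF'(2)[of "hid A (on_obj G X)"] that by (simp add: obj F.on_hid FG')
    show "on_hor G (h \<cdot>\<^bsub>B\<^esub> f) = on_hor G h \<cdot>\<^bsub>A\<^esub> on_hor G f"
      if "f \<in> Hor B" "h \<in> Hor B" "hcod B f = hdom B h" for f h
      using GF'(2)[of "on_hor G h \<cdot>\<^bsub>A\<^esub> on_hor G f"] that by (simp add: hor hdom F.on_hcomp FG')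
    show "on_ver G (vid B X) = vid A (on_obj G X)" if "X \<in> Obj B" for X
      using GF'(3)[of "vid A (on_obj G X)"] that by (simp add: obj F.on_vid FG')
    show "on_ver G (w \<bullet>\<^bsub>B\<^esub> v) = on_ver G w \<bullet>\<^bsub>A\<^esub> on_ver G v"
      if "v \<in> Ver B" "w \<in> Ver B" "vcod B v = vdom B w" for v w
      using GF'(3)[of "on_ver G w \<bullet>\<^bsub>A\<^esub> on_ver G v"] that by (simp add: ver vdom F.on_vcomp FG')
    show "on_cell G (hidc B v) = hidc A (on_ver G v)" if "v \<in> Ver B" for v
      using GF'(4)[of "hidc A (on_ver G v)"] that by (simp add: ver F.on_hidc FG')
    show "on_cell G (vidc B f) = vidc A (on_hor G f)" if "f \<in> Hor B" for f
      using GF'(4)[of "vidc A (on_hor G f)"] that by (simp add: hor F.on_vidc FG')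
    show "on_cell G (\<alpha> \<parallel>\<^bsub>B\<^esub> \<beta>) = on_cell G \<alpha> \<parallel>\<^bsub>A\<^esub> on_cell G \<beta>"
      if "\<alpha> \<in> Cell B" "\<beta> \<in> Cell B" "cright B \<alpha> = cleft B \<beta>" for \<alpha> \<beta>
      using GF'(4)[of "on_cell G \<alpha> \<parallel>\<^bsub>A\<^esub> on_cell G \<beta>"] that by (simp add: cell bd F.on_hpaste FG')
    show "on_cell G (\<alpha> \<oslash>\<^bsub>B\<^esub> \<beta>) = on_cell G \<alpha> \<oslash>\<^bsub>A\<^esub> on_cell G \<beta>"
      if "\<alpha> \<in> Cell B" "\<beta> \<in> Cell B" "cbot B \<alpha> = ctop B \<beta>" for \<alpha> \<beta>
      using GF'(4)[of "on_cell G \<alpha> \<oslash>\<^bsub>A\<^esub> on_cell G \<beta>"] that by (simp add: cell bd F.on_vpaste FG')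
    show "on_cell G (assoc B x w v) = assoc A (on_ver G x) (on_ver G w) (on_ver G v)"
      if "v \<in> Ver B" "w \<in> Ver B" "x \<in> Ver B" "vcod B v = vdom B w" "vcod B w = vdom B x" for v w x
      using GF'(4)[of "assoc A (on_ver G x) (on_ver G w) (on_ver G v)"] that
      by (simp add: ver vdom F.on_assoc FG')
  qed (use obj hor ver cell hdom vdom bd in auto)
qed

section \<open>Companions and transposition\<close>

locale double_category_with_companions = double_category A
  for A :: "('o, 'h, 'v, 'c) dblcat" (structure) +
  fixes K :: "('h, 'v, 'c) companions"
  assumes companions: "companion_choice A K"
begin

abbreviation companion ("_\<^sub>*" [1000] 1000) where "f\<^sub>* \<equiv> cmp K f"

abbreviation \<psi> where "\<psi> \<equiv> psi K"

abbreviation \<chi> where "\<chi> \<equiv> chi K"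

lemma companion [simp]:
  assumes "f \<in> Hor A"
  shows "f\<^sub>* \<in> Ver A" "vdom A f\<^sub>* = hdom A f" "vcod A f\<^sub>* = hcod A f"
    "\<psi> f \<in> Cell A" "ctop A (\<psi> f) = hid A (hdom A f)" "cleft A (\<psi> f) = vid A (hdom A f)"
    "cright A (\<psi> f) = f\<^sub>*" "cbot A (\<psi> f) = f"
    "\<chi> f \<in> Cell A" "ctop A (\<chi> f) = f" "cleft A (\<chi> f) = f\<^sub>*"
    "cright A (\<chi> f) = vid A (hcod A f)" "cbot A (\<chi> f) = hid A (hcod A f)"
    "\<psi> f \<parallel> \<chi> f = vidc A f" "\<psi> f \<oslash> \<chi> f = hidc A f\<^sub>*"
  using companions assms unfolding companion_choice_def is_companion_def by blast+

lemma companion_hid [simp]: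
  assumes "X \<in> Obj A"
  shows "(hid A X)\<^sub>* = vid A X" "\<psi> (hid A X) = hidc A (vid A X)" "\<chi> (hid A X) = hidc A (vid A X)"
  using companions assms unfolding companion_choice_def by blast+

text \<open>
  The inverse of \<open>companion_transpose\<close>: a globular cell \<open>g\<^sub>* \<bullet> v \<Rightarrow> w \<bullet> f\<^sub>*\<close> becomes a cell with top \<open>f\<close>,
  left \<open>v\<close>, right \<open>w\<close> and bottom \<open>g\<close>, by using \<open>\<psi> g\<close> to bend \<open>g\<^sub>*\<close> into the bottom and \<open>\<chi> f\<close> to
  bend \<open>f\<^sub>*\<close> into the top.
\<close>

definition fold_companions where
  "fold_companions g v \<sigma> w f = hidc A v \<oslash> \<psi> g \<parallel> (\<sigma> \<parallel> \<chi> f \<oslash> hidc A w)"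

lemma transpose_boundary:
  assumes [simp]: "\<alpha> \<in> Cell A"
  shows "\<guillemotleft>companion_transpose A K \<alpha> : (cbot A \<alpha>)\<^sub>* \<bullet> cleft A \<alpha> \<Rightarrow> cright A \<alpha> \<bullet> (ctop A \<alpha>)\<^sub>*\<guillemotright>"
proof -
  note [simp] = corner_tl corner_tr corner_bl corner_br
  show ?thesis
    unfolding companion_transpose_def is_globular_def by simp
qed

text \<open>Folding on one side only; the other binding cell of the transpose survives.\<close>

lemma psi_transpose:
  assumes [simp]: "\<alpha> \<in> Cell A"
  shows "hidc A (cleft A \<alpha>) \<oslash> \<psi> (cbot A \<alpha>) \<parallel> companion_transpose A K \<alpha> = \<psi> (ctop A \<alpha>) \<oslash> \<alpha>"
    "companion_transpose A K \<alpha> \<parallel> \<chi> (ctop A \<alpha>) \<oslash> hidc A (cright A \<alpha>) = \<alpha> \<oslash> \<chi> (cbot A \<alpha>)"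
proof -
  note [simp] = corner_tl corner_tr corner_bl corner_br
  have 1: "\<psi> (ctop A \<alpha>) \<oslash> (\<alpha> \<oslash> \<chi> (cbot A \<alpha>)) = \<psi> (ctop A \<alpha>) \<oslash> \<alpha> \<oslash> \<chi> (cbot A \<alpha>)"
    by (rule vpaste_assoc_unit[where V = "(cbot A \<alpha>)\<^sub>* \<bullet> cleft A \<alpha>" and W = "cright A \<alpha> \<bullet> (ctop A \<alpha>)\<^sub>*"])
      simp_all
  show "hidc A (cleft A \<alpha>) \<oslash> \<psi> (cbot A \<alpha>) \<parallel> companion_transpose A K \<alpha> = \<psi> (ctop A \<alpha>) \<oslash> \<alpha>"
    unfolding companion_transpose_def
    using interchange[of "hidc A (cleft A \<alpha>)" "\<psi> (ctop A \<alpha>) \<oslash> \<alpha>" "\<psi> (cbot A \<alpha>)" "\<chi> (cbot A \<alpha>)"] by simp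
  show "companion_transpose A K \<alpha> \<parallel> \<chi> (ctop A \<alpha>) \<oslash> hidc A (cright A \<alpha>) = \<alpha> \<oslash> \<chi> (cbot A \<alpha>)"
    unfolding companion_transpose_def 1[symmetric]
    using interchange[of "\<psi> (ctop A \<alpha>)" "\<chi> (ctop A \<alpha>)" "\<alpha> \<oslash> \<chi> (cbot A \<alpha>)" "hidc A (cright A \<alpha>)"] by simp
qed

lemma fold_transpose:
  assumes [simp]: "\<alpha> \<in> Cell A"
  shows "fold_companions (cbot A \<alpha>) (cleft A \<alpha>) (companion_transpose A K \<alpha>) (cright A \<alpha>) (ctop A \<alpha>) = \<alpha>"
  unfolding fold_companions_def psi_transpose(2)[OF assms]
  using interchange[of "hidc A (cleft A \<alpha>)" \<alpha> "\<psi> (cbot A \<alpha>)" "\<chi> (cbot A \<alpha>)"]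
  by (simp add: corner_tl corner_tr corner_bl corner_br)

text \<open>
  For the transpose of a fold, read \<open>\<psi> f\<close>, the fold and \<open>\<chi> g\<close> as three rows and paste by
  columns: the outer columns are \<open>\<psi> g\<close> above \<open>\<chi> g\<close> and \<open>\<psi> f\<close> above \<open>\<chi> f\<close>, which are identities.
\<close>

lemma fold_boundary:
  assumes [simp]: "f \<in> Hor A" "g \<in> Hor A" "v \<in> Ver A" "w \<in> Ver A"
    "hdom A f = vdom A v" "hcod A f = vdom A w" "hdom A g = vcod A v" "hcod A g = vcod A w"
    and s: "\<guillemotleft>\<sigma> : g\<^sub>* \<bullet> v \<Rightarrow> w \<bullet> f\<^sub>*\<guillemotright>"
  defines "F \<equiv> fold_companions g v \<sigma> w f"
  shows "F \<in> Cell A" "cleft A F = v" "cright A F = w" "ctop A F = f" "cbot A F = g"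
    "companion_transpose A K F = \<sigma>"
proof -
  have [simp]: "\<sigma> \<in> Cell A" "cleft A \<sigma> = g\<^sub>* \<bullet> v" "cright A \<sigma> = w \<bullet> f\<^sub>*"
    "ctop A \<sigma> = hid A (vdom A v)" "cbot A \<sigma> = hid A (vcod A w)"
    using globularD[OF s] by simp_all
  show [simp]: "F \<in> Cell A" "cleft A F = v" "cright A F = w" and t[simp]: "ctop A F = f" "cbot A F = g"
    unfolding F_def fold_companions_def by simp_all
  have 1: "hidc A v \<oslash> (\<psi> g \<oslash> \<chi> g) = hidc A v \<oslash> \<psi> g \<oslash> \<chi> g"
    by (rule vpaste_assoc_unit[where V = "g\<^sub>* \<bullet> v" and W = "g\<^sub>* \<bullet> v"]) simp_all
  have 2: "\<psi> f \<oslash> (\<chi> f \<oslash> hidc A w) = \<psi> f \<oslash> \<chi> f \<oslash> hidc A w"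
    by (rule vpaste_assoc_unit[where V = "w \<bullet> f\<^sub>*" and W = "w \<bullet> f\<^sub>*"]) simp_all
  have "\<psi> f \<oslash> F = hidc A v \<oslash> \<psi> g \<parallel> (\<sigma> \<parallel> \<psi> f \<oslash> (\<chi> f \<oslash> hidc A w))"
    unfolding F_def fold_companions_def
    using interchange[of "hidc A (vid A (vdom A v))" "\<psi> f" "hidc A v \<oslash> \<psi> g" "\<sigma> \<parallel> \<chi> f \<oslash> hidc A w"]
      interchange[of "hidc A (vid A (vdom A v))" "\<psi> f" "\<sigma>" "\<chi> f \<oslash> hidc A w"] by simp
  also have "\<dots> = hidc A v \<oslash> \<psi> g \<parallel> \<sigma>"
    unfolding 2 by simp
  finally have e: "\<psi> f \<oslash> F = hidc A v \<oslash> \<psi> g \<parallel> \<sigma>" .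
  show "companion_transpose A K F = \<sigma>"
    unfolding companion_transpose_def t e
    using interchange[of "hidc A v \<oslash> \<psi> g" \<sigma> "\<chi> g" "hidc A (vid A (vcod A w))"] by (simp flip: 1)
qed

text \<open>Injectivity of folding, used below to compare globular cells by comparing ordinary cells.\<close>

lemma companion_cell_eqI:
  assumes "f \<in> Hor A" "g \<in> Hor A" "v \<in> Ver A" "w \<in> Ver A"
    "hdom A f = vdom A v" "hcod A f = vdom A w" "hdom A g = vcod A v" "hcod A g = vcod A w"
    "\<guillemotleft>\<sigma> : g\<^sub>* \<bullet> v \<Rightarrow> w \<bullet> f\<^sub>*\<guillemotright>" "\<guillemotleft>\<tau> : g\<^sub>* \<bullet> v \<Rightarrow> w \<bullet> f\<^sub>*\<guillemotright>"
    "fold_companions g v \<sigma> w f = fold_companions g v \<tau> w f"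
  shows "\<sigma> = \<tau>"
  using fold_boundary(6)[OF assms(1-8,9)] fold_boundary(6)[OF assms(1-8,10)]
  unfolding assms(11) by (rule trans[OF sym])

lemma psi_cancel:
  assumes [simp]: "f \<in> Hor A" and s: "\<guillemotleft>\<sigma> : f\<^sub>* \<Rightarrow> b\<guillemotright>"
  shows "(\<psi> f \<parallel> \<sigma>) \<oslash> \<chi> f = \<sigma>"
  using interchange[of "\<psi> f" \<sigma> "\<chi> f" "hidc A (vid A (hcod A f))"] by (simp add: globularD[OF s])

lemma psi_eqI:
  assumes "f \<in> Hor A" "\<guillemotleft>\<sigma> : f\<^sub>* \<Rightarrow> b\<guillemotright>" "\<guillemotleft>\<tau> : f\<^sub>* \<Rightarrow> b\<guillemotright>" "\<psi> f \<parallel> \<sigma> = \<psi> f \<parallel> \<tau>"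
  shows "\<sigma> = \<tau>"
  using psi_cancel[OF assms(1,2)] psi_cancel[OF assms(1,3)] unfolding assms(4) by (rule trans[OF sym])

text \<open>
  \<open>cmp_split\<close> and \<open>cmp_join\<close> compare two companions of \<open>h \<cdot> f\<close>: the chosen one, and \<open>h\<^sub>* \<bullet> f\<^sub>*\<close> with
  the binding cells displayed in the third and fourth claims. They are mutually
  inverse, as any two companions of the same arrow are uniquely isomorphic over it.
\<close>

lemma cmp_split_join:
  assumes [simp]: "f \<in> Hor A" "h \<in> Hor A" "hcod A f = hdom A h"
  shows "\<guillemotleft>cmp_split A K h f : (h \<cdot> f)\<^sub>* \<Rightarrow> h\<^sub>* \<bullet> f\<^sub>*\<guillemotright>"
    and "\<guillemotleft>cmp_join A K h f : h\<^sub>* \<bullet> f\<^sub>* \<Rightarrow> (h \<cdot> f)\<^sub>*\<guillemotright>"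
    and "\<psi> (h \<cdot> f) \<parallel> cmp_split A K h f = \<psi> f \<oslash> (vidc A f \<parallel> \<psi> h)"
    and "cmp_join A K h f \<parallel> \<chi> (h \<cdot> f) = (\<chi> f \<parallel> vidc A h) \<oslash> \<chi> h"
    and "cmp_split A K h f \<parallel> cmp_join A K h f = hidc A (h \<cdot> f)\<^sub>*"
    and "cmp_join A K h f \<parallel> cmp_split A K h f = hidc A (h\<^sub>* \<bullet> f\<^sub>*)"
proof -
  let ?\<rho> = "\<psi> f \<oslash> (vidc A f \<parallel> \<psi> h)" and ?\<kappa> = "(\<chi> f \<parallel> vidc A h) \<oslash> \<chi> h"
  let ?s = "cmp_split A K h f" and ?j = "cmp_join A K h f"
  show s: "\<guillemotleft>?s : (h \<cdot> f)\<^sub>* \<Rightarrow> h\<^sub>* \<bullet> f\<^sub>*\<guillemotright>" and j: "\<guillemotleft>?j : h\<^sub>* \<bullet> f\<^sub>* \<Rightarrow> (h \<cdot> f)\<^sub>*\<guillemotright>"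
    unfolding cmp_split_def cmp_join_def is_globular_def by simp_all
  have [simp]: "?s \<in> Cell A" "cleft A ?s = (h \<cdot> f)\<^sub>*" "cright A ?s = h\<^sub>* \<bullet> f\<^sub>*"
      "ctop A ?s = hid A (hdom A f)" "cbot A ?s = hid A (hcod A h)"
      "?j \<in> Cell A" "cright A ?j = (h \<cdot> f)\<^sub>*" "cleft A ?j = h\<^sub>* \<bullet> f\<^sub>*"
      "ctop A ?j = hid A (hdom A f)" "cbot A ?j = hid A (hcod A h)"
    using globularD[OF s] globularD[OF j] by simp_all
  show ps: "\<psi> (h \<cdot> f) \<parallel> ?s = ?\<rho>"
    unfolding cmp_split_def
    using interchange[of "hidc A (vid A (hdom A f))" ?\<rho> "\<psi> (h \<cdot> f)" "\<chi> (h \<cdot> f)"] by simp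
  show jc: "?j \<parallel> \<chi> (h \<cdot> f) = ?\<kappa>"
    unfolding cmp_join_def
    using interchange[of "\<psi> (h \<cdot> f)" "\<chi> (h \<cdot> f)" ?\<kappa> "hidc A (vid A (hcod A h))"] by simp
  have "?\<rho> \<parallel> ?\<kappa> = (\<psi> f \<parallel> (\<chi> f \<parallel> vidc A h)) \<oslash> (vidc A f \<parallel> \<psi> h \<parallel> \<chi> h)"
    by (simp add: interchange)
  also have "\<dots> = vidc A (h \<cdot> f)"
    by (simp add: hpaste_assoc hpaste_eq_assoc[OF companion(14)])
  finally have rk: "?\<rho> \<parallel> ?\<kappa> = vidc A (h \<cdot> f)" .
  show "?s \<parallel> ?j = hidc A (h \<cdot> f)\<^sub>*"
  proof (rule companion_cell_eqI[of "h \<cdot> f" "h \<cdot> f" "vid A (hdom A f)" "vid A (hcod A h)"])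
    have "\<psi> (h \<cdot> f) \<parallel> (?s \<parallel> ?j \<parallel> \<chi> (h \<cdot> f)) = ?\<rho> \<parallel> ?\<kappa>"
      by (simp add: hpaste_assoc jc hpaste_eq_assoc[OF ps])
    then show "fold_companions (h \<cdot> f) (vid A (hdom A f)) (?s \<parallel> ?j) (vid A (hcod A h)) (h \<cdot> f) =
        fold_companions (h \<cdot> f) (vid A (hdom A f)) (hidc A (h \<cdot> f)\<^sub>*) (vid A (hcod A h)) (h \<cdot> f)"
      unfolding fold_companions_def by (simp add: rk)
  qed (use globular_hpaste[OF s j] in simp_all)
  \<comment> \<open>In the other order the two staircases are stacked; their middle steps merge into \<open>\<chi> f\<close> above \<open>\<psi> h\<close>.\<close>
  have m: "(vidc A f \<parallel> \<psi> h) \<oslash> (\<chi> f \<parallel> vidc A h) = \<chi> f \<oslash> \<psi> h"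
  proof -
    have "(vidc A f \<parallel> \<psi> h) \<oslash> (\<chi> f \<parallel> vidc A h) = \<chi> f \<parallel> \<psi> h"
      using interchange[of "vidc A f" "\<psi> h" "\<chi> f" "vidc A h"] by simp
    also have "\<dots> = \<chi> f \<oslash> \<psi> h"
      using interchange[of "\<chi> f" "hidc A (vid A (hdom A h))" "hidc A (vid A (hdom A h))" "\<psi> h"] by simp
    finally show ?thesis .
  qed
  have "?j \<parallel> ?s = (\<psi> (h \<cdot> f) \<parallel> ?s) \<oslash> ?\<kappa>"
    using interchange[of "\<psi> (h \<cdot> f)" ?s ?\<kappa> "hidc A (vid A (hcod A h))"] unfolding cmp_join_def by simp
  also have "\<dots> = ?\<rho> \<oslash> ((\<chi> f \<parallel> vidc A h) \<oslash> \<chi> h)"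
    unfolding ps ..
  also have "\<dots> = \<psi> f \<oslash> (vidc A f \<parallel> \<psi> h) \<oslash> (\<chi> f \<parallel> vidc A h) \<oslash> \<chi> h"
    by (rule vpaste_assoc_unit[where V = "h\<^sub>* \<bullet> f\<^sub>*" and W = "h\<^sub>* \<bullet> f\<^sub>*"]) simp_all
  also have "\<psi> f \<oslash> (vidc A f \<parallel> \<psi> h) \<oslash> (\<chi> f \<parallel> vidc A h) = \<psi> f \<oslash> ((vidc A f \<parallel> \<psi> h) \<oslash> (\<chi> f \<parallel> vidc A h))"
    by (rule vpaste_assoc_unit[where V = "f\<^sub>*" and W = "h\<^sub>* \<bullet> f\<^sub>*", symmetric]) simp_all
  also have "\<dots> = \<psi> f \<oslash> \<chi> f \<oslash> \<psi> h"
    unfolding m by (rule vpaste_assoc_unit[where V = "f\<^sub>*" and W = "h\<^sub>* \<bullet> f\<^sub>*"]) simp_all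
  also have "\<dots> \<oslash> \<chi> h = hidc A f\<^sub>* \<oslash> (\<psi> h \<oslash> \<chi> h)"
    unfolding companion(15)[OF assms(1)]
    by (rule vpaste_assoc_unit[where V = "h\<^sub>* \<bullet> f\<^sub>*" and W = "h\<^sub>* \<bullet> f\<^sub>*", symmetric]) simp_all
  finally show "?j \<parallel> ?s = hidc A (h\<^sub>* \<bullet> f\<^sub>*)"
    by simp
qed

lemma splits_cmp_split:
  "\<lbrakk>f \<in> Hor A; h \<in> Hor A; hcod A f = hdom A h\<rbrakk> \<Longrightarrow> splits (h \<cdot> f)\<^sub>* h\<^sub>* f\<^sub>* (cmp_split A K h f)"
  by (simp add: splits_def cmp_split_join)

lemma joins_cmp_join:
  "\<lbrakk>f \<in> Hor A; h \<in> Hor A; hcod A f = hdom A h\<rbrakk> \<Longrightarrow> joins h\<^sub>* f\<^sub>* (h \<cdot> f)\<^sub>* (cmp_join A K h f)"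
  by (simp add: joins_def cmp_split_join)

lemma inverse_cells_cmp_split:
  "\<lbrakk>f \<in> Hor A; h \<in> Hor A; hcod A f = hdom A h\<rbrakk>
    \<Longrightarrow> inverse_cells (cmp_split A K h f) (cmp_join A K h f) (h \<cdot> f)\<^sub>* (h\<^sub>* \<bullet> f\<^sub>*)"
  by (simp add: inverse_cells_def cmp_split_join)

lemma cmp_split_hid [simp]:
  assumes [simp]: "f \<in> Hor A"
  shows "hdom A f = X \<Longrightarrow> cmp_split A K f (hid A X) = hidc A f\<^sub>*"
    "hcod A f = X \<Longrightarrow> cmp_split A K (hid A X) f = hidc A f\<^sub>*"
    "hdom A f = X \<Longrightarrow> cmp_join A K f (hid A X) = hidc A f\<^sub>*"
    "hcod A f = X \<Longrightarrow> cmp_join A K (hid A X) f = hidc A f\<^sub>*"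
  unfolding cmp_split_def cmp_join_def by (auto)

text \<open>
  Precomposed with \<open>\<psi> (l \<cdot> (h \<cdot> f))\<close> both sides become the staircase of \<open>\<psi> f\<close>, \<open>\<psi> h\<close> and \<open>\<psi> l\<close>.
\<close>

lemma cmp_split_coherence:
  assumes [simp]: "f \<in> Hor A" "h \<in> Hor A" "l \<in> Hor A" "hcod A f = hdom A h" "hcod A h = hdom A l"
  shows "cmp_split A K l (h \<cdot> f) \<parallel> cmp_split A K h f \<oslash> hidc A l\<^sub>* =
    cmp_split A K (l \<cdot> h) f \<parallel> (hidc A f\<^sub>* \<oslash> cmp_split A K l h \<parallel> assoc A l\<^sub>* h\<^sub>* f\<^sub>*)"
proof (rule psi_eqI[of "l \<cdot> (h \<cdot> f)"])
  note [simp] = splitsD[OF splits_cmp_split]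
  have [simp]: "l \<cdot> h \<cdot> f = l \<cdot> (h \<cdot> f)" by (simp add: hcomp_assoc)
  have "\<psi> (l \<cdot> (h \<cdot> f)) \<parallel> (cmp_split A K l (h \<cdot> f) \<parallel> cmp_split A K h f \<oslash> hidc A l\<^sub>*) =
      \<psi> (h \<cdot> f) \<oslash> (vidc A (h \<cdot> f) \<parallel> \<psi> l) \<parallel> cmp_split A K h f \<oslash> hidc A l\<^sub>*"
    by (subst hpaste_eq_assoc[OF cmp_split_join(3)]) simp_all
  also have "\<dots> = (\<psi> (h \<cdot> f) \<parallel> cmp_split A K h f) \<oslash> (vidc A (h \<cdot> f) \<parallel> \<psi> l)"
    by (subst interchange[symmetric]) (simp_all add: hpaste_assoc)
  also have "\<dots> = \<psi> f \<oslash> (vidc A f \<parallel> \<psi> h) \<oslash> (vidc A (h \<cdot> f) \<parallel> \<psi> l)"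
    by (simp add: cmp_split_join(3))
  finally have L: "\<psi> (l \<cdot> (h \<cdot> f)) \<parallel> (cmp_split A K l (h \<cdot> f) \<parallel> cmp_split A K h f \<oslash> hidc A l\<^sub>*) =
    \<psi> f \<oslash> (vidc A f \<parallel> \<psi> h) \<oslash> (vidc A (h \<cdot> f) \<parallel> \<psi> l)" .
  have v: "vidc A f \<parallel> (\<psi> h \<oslash> (vidc A h \<parallel> \<psi> l)) = (vidc A f \<parallel> \<psi> h) \<oslash> (vidc A (h \<cdot> f) \<parallel> \<psi> l)"
    using interchange[of "vidc A f" "\<psi> h" "vidc A f" "vidc A h \<parallel> \<psi> l"]
    by (simp flip: hpaste_assoc)
  have "\<psi> (l \<cdot> (h \<cdot> f)) \<parallel> (cmp_split A K (l \<cdot> h) f \<parallel> (hidc A f\<^sub>* \<oslash> cmp_split A K l h \<parallel> assoc A l\<^sub>* h\<^sub>* f\<^sub>*)) =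
      \<psi> (l \<cdot> h \<cdot> f) \<parallel> cmp_split A K (l \<cdot> h) f \<parallel> hidc A f\<^sub>* \<oslash> cmp_split A K l h \<parallel> assoc A l\<^sub>* h\<^sub>* f\<^sub>*"
    by (simp add: hpaste_assoc)
  also have "\<dots> = \<psi> f \<oslash> (vidc A f \<parallel> \<psi> (l \<cdot> h)) \<parallel> hidc A f\<^sub>* \<oslash> cmp_split A K l h \<parallel> assoc A l\<^sub>* h\<^sub>* f\<^sub>*"
    by (subst cmp_split_join(3)) simp_all
  also have "\<psi> f \<oslash> (vidc A f \<parallel> \<psi> (l \<cdot> h)) \<parallel> hidc A f\<^sub>* \<oslash> cmp_split A K l h =
      \<psi> f \<oslash> (vidc A f \<parallel> (\<psi> (l \<cdot> h) \<parallel> cmp_split A K l h))"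
    by (subst interchange[symmetric]) (simp_all add: hpaste_assoc)
  also have "\<dots> = \<psi> f \<oslash> ((vidc A f \<parallel> \<psi> h) \<oslash> (vidc A (h \<cdot> f) \<parallel> \<psi> l))"
    by (simp add: cmp_split_join(3) v)
  also have "\<dots> \<parallel> assoc A l\<^sub>* h\<^sub>* f\<^sub>* = \<psi> f \<oslash> (vidc A f \<parallel> \<psi> h) \<oslash> (vidc A (h \<cdot> f) \<parallel> \<psi> l)"
    using assoc_natural[of "\<psi> f" "vidc A f \<parallel> \<psi> h" "vidc A (h \<cdot> f) \<parallel> \<psi> l"] by simp
  finally show "\<psi> (l \<cdot> (h \<cdot> f)) \<parallel> (cmp_split A K l (h \<cdot> f) \<parallel> cmp_split A K h f \<oslash> hidc A l\<^sub>*) =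
      \<psi> (l \<cdot> (h \<cdot> f)) \<parallel> (cmp_split A K (l \<cdot> h) f \<parallel> (hidc A f\<^sub>* \<oslash> cmp_split A K l h \<parallel> assoc A l\<^sub>* h\<^sub>* f\<^sub>*))"
    unfolding L by simp
  show "\<guillemotleft>cmp_split A K l (h \<cdot> f) \<parallel> cmp_split A K h f \<oslash> hidc A l\<^sub>* : (l \<cdot> (h \<cdot> f))\<^sub>* \<Rightarrow> l\<^sub>* \<bullet> (h\<^sub>* \<bullet> f\<^sub>*)\<guillemotright>"
    "\<guillemotleft>cmp_split A K (l \<cdot> h) f \<parallel> (hidc A f\<^sub>* \<oslash> cmp_split A K l h \<parallel> assoc A l\<^sub>* h\<^sub>* f\<^sub>*) : (l \<cdot> (h \<cdot> f))\<^sub>* \<Rightarrow> l\<^sub>* \<bullet> (h\<^sub>* \<bullet> f\<^sub>*)\<guillemotright>"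
    unfolding is_globular_def by simp_all
qed simp

lemma cmp_join_coherence:
  assumes [simp]: "g \<in> Hor A" "k \<in> Hor A" "m \<in> Hor A" "hcod A g = hdom A k" "hcod A k = hdom A m"
  shows "cmp_join A K k g \<oslash> hidc A m\<^sub>* \<parallel> cmp_join A K m (k \<cdot> g) =
    assoc_inv m\<^sub>* k\<^sub>* g\<^sub>* \<parallel> (hidc A g\<^sub>* \<oslash> cmp_join A K m k \<parallel> cmp_join A K (m \<cdot> k) g)"
proof -
  have i: "inverse_cells (cmp_split A K m (k \<cdot> g)) (cmp_join A K m (k \<cdot> g)) (m \<cdot> (k \<cdot> g))\<^sub>* (m\<^sub>* \<bullet> (k \<cdot> g)\<^sub>*)"
    "inverse_cells (cmp_split A K k g \<oslash> hidc A m\<^sub>*) (cmp_join A K k g \<oslash> hidc A m\<^sub>*) (m\<^sub>* \<bullet> (k \<cdot> g)\<^sub>*) (m\<^sub>* \<bullet> (k\<^sub>* \<bullet> g\<^sub>*))"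
    "inverse_cells (cmp_split A K (m \<cdot> k) g) (cmp_join A K (m \<cdot> k) g) (m \<cdot> (k \<cdot> g))\<^sub>* ((m \<cdot> k)\<^sub>* \<bullet> g\<^sub>*)"
    "inverse_cells (hidc A g\<^sub>* \<oslash> cmp_split A K m k) (hidc A g\<^sub>* \<oslash> cmp_join A K m k) ((m \<cdot> k)\<^sub>* \<bullet> g\<^sub>*) (m\<^sub>* \<bullet> k\<^sub>* \<bullet> g\<^sub>*)"
    "inverse_cells (assoc A m\<^sub>* k\<^sub>* g\<^sub>*) (assoc_inv m\<^sub>* k\<^sub>* g\<^sub>*) (m\<^sub>* \<bullet> k\<^sub>* \<bullet> g\<^sub>*) (m\<^sub>* \<bullet> (k\<^sub>* \<bullet> g\<^sub>*))"
    using inverse_cells_cmp_split[of g "m \<cdot> k"]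
    by (simp_all add: inverse_cells_cmp_split inverse_cells_whisker inverse_cells_assoc hcomp_assoc)
  have e: "cmp_split A K m (k \<cdot> g) \<parallel> cmp_split A K k g \<oslash> hidc A m\<^sub>* =
      cmp_split A K (m \<cdot> k) g \<parallel> hidc A g\<^sub>* \<oslash> cmp_split A K m k \<parallel> assoc A m\<^sub>* k\<^sub>* g\<^sub>*"
    using i[THEN inverse_cellsD(1)] i[THEN inverse_cellsD(2)] i[THEN inverse_cellsD(3)]
    by (simp add: cmp_split_coherence hpaste_assoc)
  show ?thesis
    using pentagon_rotations(3)[OF i e] by simp
qed

section \<open>The double category of retrocells\<close>

abbreviation B where "B \<equiv> ret A K"

abbreviation L where "L \<equiv> ret_companions A K"

lemma ret_simps [simp]:
  "Obj B = Obj A" "Hor B = Hor A" "Ver B = Ver A" "Cell B = retrocells A K"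
  "hdom B = hdom A" "hcod B = hcod A" "hid B = hid A" "hcomp B = hcomp A"
  "vdom B = vdom A" "vcod B = vcod A" "vid B = vid A" "vcomp B = vcomp A"
  "ctop B = rtop" "cbot B = rbot" "cleft B = rleft" "cright B = rright"
  "hpaste B = ret_hpaste A K" "vpaste B = ret_vpaste A K"
  "hidc B v = Retrocell (hid A (vdom A v)) v v (hid A (vcod A v)) (hidc A v)"
  "vidc B f = Retrocell f (vid A (hdom A f)) (vid A (hcod A f)) f (hidc A f\<^sub>*)"
  "assoc B x w v = Retrocell (hid A (vdom A v)) (x \<bullet> w \<bullet> v) (x \<bullet> (w \<bullet> v)) (hid A (vcod A x)) (assoc_inv x w v)"
  "cmp L = cmp K"
  "psi L f = Retrocell (hid A (hdom A f)) (vid A (hdom A f)) f\<^sub>* f (hidc A f\<^sub>*)"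
  "chi L f = Retrocell f f\<^sub>* (vid A (hcod A f)) (hid A (hcod A f)) (hidc A f\<^sub>*)"
  by (simp_all add: ret_def ret_companions_def)

lemma retrocell_iff:
  "Retrocell f v w g \<alpha> \<in> retrocells A K \<longleftrightarrow>
     f \<in> Hor A \<and> g \<in> Hor A \<and> v \<in> Ver A \<and> w \<in> Ver A \<and>
     hdom A f = vdom A v \<and> hcod A f = vdom A w \<and> hdom A g = vcod A v \<and> hcod A g = vcod A w \<and>
     \<guillemotleft>\<alpha> : w \<bullet> f\<^sub>* \<Rightarrow> g\<^sub>* \<bullet> v\<guillemotright>"
  by (auto simp: retrocells_def)

lemma retrocellD:
  assumes "Retrocell f v w g \<alpha> \<in> retrocells A K"
  shows "f \<in> Hor A" "g \<in> Hor A" "v \<in> Ver A" "w \<in> Ver A"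
    "hdom A f = vdom A v" "hcod A f = vdom A w" "hdom A g = vcod A v" "hcod A g = vcod A w"
    "quintet w f\<^sub>* g\<^sub>* v \<alpha>" "\<guillemotleft>\<alpha> : w \<bullet> f\<^sub>* \<Rightarrow> g\<^sub>* \<bullet> v\<guillemotright>"
    "\<alpha> \<in> Cell A" "cleft A \<alpha> = w \<bullet> f\<^sub>*" "cright A \<alpha> = g\<^sub>* \<bullet> v"
    "ctop A \<alpha> = hid A (vdom A v)" "cbot A \<alpha> = hid A (vcod A w)"
proof -
  note a = assms[unfolded retrocell_iff]
  then show "f \<in> Hor A" "g \<in> Hor A" "v \<in> Ver A" "w \<in> Ver A"
    "hdom A f = vdom A v" "hcod A f = vdom A w" "hdom A g = vcod A v" "hcod A g = vcod A w"
    "\<guillemotleft>\<alpha> : w \<bullet> f\<^sub>* \<Rightarrow> g\<^sub>* \<bullet> v\<guillemotright>" by blast+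
  with a show "quintet w f\<^sub>* g\<^sub>* v \<alpha>" by (simp add: quintet_def)
  from quintetD(9-13)[OF this] a
  show "\<alpha> \<in> Cell A" "cleft A \<alpha> = w \<bullet> f\<^sub>*" "cright A \<alpha> = g\<^sub>* \<bullet> v"
    "ctop A \<alpha> = hid A (vdom A v)" "cbot A \<alpha> = hid A (vcod A w)" by simp_all
qed

lemma ret_hpaste_eq:
  assumes a: "Retrocell f v w g \<alpha> \<in> retrocells A K" and b: "Retrocell h w x k \<beta> \<in> retrocells A K"
  defines "\<delta> \<equiv> quintet_hcomp x h\<^sub>* k\<^sub>* w f\<^sub>* g\<^sub>* v (k \<cdot> g)\<^sub>* (cmp_split A K h f) \<beta> \<alpha> (cmp_join A K k g)"
  shows "ret_hpaste A K (Retrocell f v w g \<alpha>) (Retrocell h w x k \<beta>) = Retrocell (h \<cdot> f) v x (k \<cdot> g) \<delta>"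
    and "Retrocell (h \<cdot> f) v x (k \<cdot> g) \<delta> \<in> retrocells A K"
proof -
  note [simp] = retrocellD(1-8,11-15)[OF a] retrocellD(1-8,11-15)[OF b]
  have s: "splits (h \<cdot> f)\<^sub>* h\<^sub>* f\<^sub>* (cmp_split A K h f)" and j: "joins k\<^sub>* g\<^sub>* (k \<cdot> g)\<^sub>* (cmp_join A K k g)"
    by (simp_all add: splits_cmp_split joins_cmp_join)
  note [simp] = splitsD(7-11)[OF s] joinsD(7-11)[OF j]
  show "ret_hpaste A K (Retrocell f v w g \<alpha>) (Retrocell h w x k \<beta>) = Retrocell (h \<cdot> f) v x (k \<cdot> g) \<delta>"
    unfolding \<delta>_def quintet_hcomp_def prolong_join(1)[OF j retrocellD(3)[OF a], simplified]
    by (simp add: prolong_def hpaste_assoc)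
  have "quintet x (h \<cdot> f)\<^sub>* (k \<cdot> g)\<^sub>* v \<delta>"
    unfolding \<delta>_def by (rule quintet_hcomp[OF retrocellD(9)[OF a] retrocellD(9)[OF b] s j])
  from quintetD(14)[OF this] show "Retrocell (h \<cdot> f) v x (k \<cdot> g) \<delta> \<in> retrocells A K"
    by (simp add: retrocell_iff)
qed

lemma ret_vpaste_eq:
  assumes a: "Retrocell f v w g \<alpha> \<in> retrocells A K" and b: "Retrocell g v' w' h \<alpha>' \<in> retrocells A K"
  defines "\<delta> \<equiv> quintet_vcomp w' w f\<^sub>* g\<^sub>* v h\<^sub>* v' \<alpha> \<alpha>'"
  shows "ret_vpaste A K (Retrocell f v w g \<alpha>) (Retrocell g v' w' h \<alpha>') = Retrocell f (v' \<bullet> v) (w' \<bullet> w) h \<delta>"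
    and "Retrocell f (v' \<bullet> v) (w' \<bullet> w) h \<delta> \<in> retrocells A K"
proof -
  have [simp]: "vcod A v = vdom A v'" "vcod A w = vdom A w'"
    using retrocellD(7,8)[OF a] retrocellD(5,6)[OF b] by simp_all
  note [simp] = retrocellD(1-8,11-15)[OF a] retrocellD(1-4,7,8,11-15)[OF b]
  show "ret_vpaste A K (Retrocell f v w g \<alpha>) (Retrocell g v' w' h \<alpha>') = Retrocell f (v' \<bullet> v) (w' \<bullet> w) h \<delta>"
    unfolding \<delta>_def quintet_vcomp_def by (simp add: prolong_def hpaste_assoc)
  have "quintet (w' \<bullet> w) f\<^sub>* h\<^sub>* (v' \<bullet> v) \<delta>"
    unfolding \<delta>_def by (rule quintet_vcomp[OF retrocellD(9)[OF a] retrocellD(9)[OF b]])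
  from quintetD(14)[OF this] show "Retrocell f (v' \<bullet> v) (w' \<bullet> w) h \<delta> \<in> retrocells A K"
    by (simp add: retrocell_iff)
qed

text \<open>The globular retrocell \<open>b \<Rightarrow> a\<close> whose underlying globular cell is \<open>\<sigma> : a \<Rightarrow> b\<close>.\<close>

definition retro where
  "retro \<sigma> = Retrocell (hid A (vdom A (cleft A \<sigma>))) (cright A \<sigma>) (cleft A \<sigma>) (hid A (vcod A (cleft A \<sigma>))) \<sigma>"

lemma retro_eq:
  assumes "\<guillemotleft>\<sigma> : b \<Rightarrow> a\<guillemotright>"
  shows "retro \<sigma> = Retrocell (hid A (vdom A b)) a b (hid A (vcod A b)) \<sigma>"
    and "Retrocell (hid A (vdom A b)) a b (hid A (vcod A b)) \<sigma> \<in> retrocells A K"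
    and "retro \<sigma> \<in> retrocells A K"
  using globularD[OF assms] assms by (simp_all add: retro_def retrocell_iff)

lemma globular_ret_iff:
  "is_globular B r a b \<longleftrightarrow> (\<exists>\<sigma>. r = retro \<sigma> \<and> \<guillemotleft>\<sigma> : b \<Rightarrow> a\<guillemotright>)"
proof
  assume "is_globular B r a b"
  then obtain \<sigma> where r: "r = Retrocell (hid A (vdom A a)) a b (hid A (vcod A a)) \<sigma>" "r \<in> retrocells A K"
    by (cases r) (auto simp: is_globular_def)
  note m = r(2)[unfolded r(1)]
  have [simp]: "a \<in> Ver A" "b \<in> Ver A" using retrocellD[OF m] by simp_all
  have d: "vdom A b = vdom A a" "vcod A b = vcod A a" using retrocellD(6,8)[OF m] by simp_all
  have g: "\<guillemotleft>\<sigma> : b \<Rightarrow> a\<guillemotright>"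
    using retrocellD(10)[OF m] by (simp add: d)
  with retro_eq(1)[OF g] r(1) show "\<exists>\<sigma>. r = retro \<sigma> \<and> \<guillemotleft>\<sigma> : b \<Rightarrow> a\<guillemotright>"
    by (intro exI[of _ \<sigma>]) (simp add: d)
next
  assume "\<exists>\<sigma>. r = retro \<sigma> \<and> \<guillemotleft>\<sigma> : b \<Rightarrow> a\<guillemotright>"
  then obtain \<sigma> where r: "r = retro \<sigma>" and g: "\<guillemotleft>\<sigma> : b \<Rightarrow> a\<guillemotright>" by blast
  show "is_globular B r a b"
    unfolding r retro_eq(1)[OF g] is_globular_def using retro_eq(2)[OF g] globularD(6,7)[OF g] by simp
qed

text \<open>
  Pasting a globular retrocell onto a retrocell is whiskering and composition of 2-cells: the
  comparison cells and associators involved have an identity among their arguments.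
\<close>

lemma ret_hpaste_retro:
  assumes a: "Retrocell f v w g \<alpha> \<in> retrocells A K"
  shows "\<guillemotleft>\<sigma> : w' \<Rightarrow> w\<guillemotright> \<Longrightarrow> ret_hpaste A K (Retrocell f v w g \<alpha>) (retro \<sigma>) =
      Retrocell f v w' g (hidc A f\<^sub>* \<oslash> \<sigma> \<parallel> \<alpha>)" (is "_ \<Longrightarrow> ?R")
    and "\<guillemotleft>\<sigma> : v \<Rightarrow> v'\<guillemotright> \<Longrightarrow> ret_hpaste A K (retro \<sigma>) (Retrocell f v w g \<alpha>) =
      Retrocell f v' w g (\<alpha> \<parallel> \<sigma> \<oslash> hidc A g\<^sub>*)" (is "_ \<Longrightarrow> ?L")
proof -
  note [simp] = retrocellD(1-8,11-15)[OF a]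
  show ?R if s: "\<guillemotleft>\<sigma> : w' \<Rightarrow> w\<guillemotright>"
  proof -
    have [simp]: "vdom A w' = vdom A w" "vcod A w' = vcod A w"
      using globularD(6,7)[OF s] by simp_all
    note [simp] = globularD(1-5,8,9)[OF s]
    have m: "Retrocell (hid A (vdom A w)) w w' (hid A (vcod A w)) \<sigma> \<in> retrocells A K"
      using retro_eq(2)[OF s] by simp
    show ?R
      unfolding retro_eq(1)[OF s] using ret_hpaste_eq(1)[OF a m]
      by (simp add: quintet_hcomp_def prolong_def prolong_join_def)
  qed
  show ?L if s: "\<guillemotleft>\<sigma> : v \<Rightarrow> v'\<guillemotright>"
  proof -
    note [simp] = globularD[OF s]
    show ?L
      unfolding retro_eq(1)[OF s] using ret_hpaste_eq(1)[OF retro_eq(2)[OF s] a]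
      by (simp add: quintet_hcomp_def prolong_def prolong_join_def)
  qed
qed

lemma retro_hpaste:
  assumes "\<guillemotleft>\<sigma> : b \<Rightarrow> a\<guillemotright>" "\<guillemotleft>\<tau> : c \<Rightarrow> b\<guillemotright>"
  shows "ret_hpaste A K (retro \<sigma>) (retro \<tau>) = retro (\<tau> \<parallel> \<sigma>)"
proof -
  note [simp] = globularD(1-5,8,9)[OF assms(1)] globularD[OF assms(2)]
  have [simp]: "vdom A a = vdom A c" "vcod A a = vcod A c"
    using globularD(6,7)[OF assms(1)] by simp_all
  show ?thesis
    unfolding retro_eq(1)[OF assms(1)] ret_hpaste_retro(1)[OF retro_eq(2)[OF assms(1)] assms(2)]
      retro_eq(1)[OF globular_hpaste[OF assms(2,1)]] by simp
qed

text \<open>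
  Both \<open>retro_hpaste\<close> and this lemma say that \<open>retro\<close> identifies the globular part of the
  double category of retrocells with the opposite of the globular part of the original one; only
  the direction of 2-cells is reversed, not the order of vertical composition.
\<close>

lemma retro_vpaste:
  assumes s: "\<guillemotleft>\<sigma> : b \<Rightarrow> a\<guillemotright>" and t: "\<guillemotleft>\<tau> : d \<Rightarrow> c\<guillemotright>" and c: "vcod A b = vdom A d"
  shows "ret_vpaste A K (retro \<sigma>) (retro \<tau>) = retro (\<sigma> \<oslash> \<tau>)"
proof -
  note [simp] = globularD[OF s] globularD[OF t] c
  have m: "Retrocell (hid A (vcod A b)) c d (hid A (vcod A d)) \<tau> \<in> retrocells A K"
    using retro_eq(2)[OF t] by simp
  have "\<sigma> \<oslash> hidc A d \<parallel> hidc A a \<oslash> \<tau> = \<sigma> \<oslash> \<tau>"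
    using interchange[of \<sigma> "hidc A a" "hidc A d" \<tau>] by simp
  then show ?thesis
    using ret_vpaste_eq(1)[OF retro_eq(2)[OF s] m]
    unfolding retro_eq(1)[OF s] retro_eq(1)[OF t] retro_eq(1)[OF globular_vpaste[OF s t c]]
    by (simp add: quintet_vcomp_def prolong_def)
qed

lemma retro_hidc: "v \<in> Ver A \<Longrightarrow> hidc B v = retro (hidc A v)"
  by (simp add: retro_def)

lemma retro_assoc:
  assumes "v \<in> Ver A" "w \<in> Ver A" "x \<in> Ver A" "vcod A v = vdom A w" "vcod A w = vdom A x"
  shows "assoc B x w v = retro (assoc_inv x w v)"
  using assms by (simp add: retro_def)

lemma retro_inverse:
  assumes "inverse_cells \<sigma> \<sigma>' b a"
  shows "is_hinverse B (retro \<sigma>) (retro \<sigma>')"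
proof -
  note [simp] = inverse_cellsD(1-10)[OF assms]
  from assms have g: "\<guillemotleft>\<sigma> : b \<Rightarrow> a\<guillemotright>" "\<guillemotleft>\<sigma>' : a \<Rightarrow> b\<guillemotright>" by (simp_all add: inverse_cells_def)
  note [simp] = globularD(6,7)[OF g(1)]
  show ?thesis
    unfolding is_hinverse_def
    using retro_hpaste[OF g(1) g(2)] retro_hpaste[OF g(2) g(1)] retro_eq(1,3)[OF g(1)] retro_eq(1,3)[OF g(2)]
    by (simp add: retro_def)
qed

lemma retrocellE:
  assumes "a \<in> Cell B"
  obtains f v w g \<alpha> where "a = Retrocell f v w g \<alpha>" "Retrocell f v w g \<alpha> \<in> retrocells A K"
  using assms by (cases a) auto

lemma hcomposableE:
  assumes "a \<in> Cell B" "b \<in> Cell B" "cright B a = cleft B b"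
  obtains f v w g \<alpha> h x k \<beta> where "a = Retrocell f v w g \<alpha>" "b = Retrocell h w x k \<beta>"
    "Retrocell f v w g \<alpha> \<in> retrocells A K" "Retrocell h w x k \<beta> \<in> retrocells A K"
  using assms by (cases a; cases b) auto

lemma vcomposableE:
  assumes "a \<in> Cell B" "b \<in> Cell B" "cbot B a = ctop B b"
  obtains f v w g \<alpha> v' w' h \<beta> where "a = Retrocell f v w g \<alpha>" "b = Retrocell g v' w' h \<beta>"
    "Retrocell f v w g \<alpha> \<in> retrocells A K" "Retrocell g v' w' h \<beta> \<in> retrocells A K"
  using assms by (cases a; cases b) auto

lemma ret_boundary:
  assumes "a \<in> Cell B"
  shows "ctop B a \<in> Hor B" "cbot B a \<in> Hor B" "cleft B a \<in> Ver B" "cright B a \<in> Ver B"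
    "hdom B (ctop B a) = vdom B (cleft B a)" "hcod B (ctop B a) = vdom B (cright B a)"
    "hdom B (cbot B a) = vcod B (cleft B a)" "hcod B (cbot B a) = vcod B (cright B a)"
proof -
  obtain f v w g \<alpha> where e: "a = Retrocell f v w g \<alpha>" and m: "Retrocell f v w g \<alpha> \<in> retrocells A K"
    using assms by (rule retrocellE)
  show "ctop B a \<in> Hor B" "cbot B a \<in> Hor B" "cleft B a \<in> Ver B" "cright B a \<in> Ver B"
    "hdom B (ctop B a) = vdom B (cleft B a)" "hcod B (ctop B a) = vdom B (cright B a)"
    "hdom B (cbot B a) = vcod B (cleft B a)" "hcod B (cbot B a) = vcod B (cright B a)"
    unfolding e by (simp_all add: retrocellD(1-8)[OF m])
qed

lemma ret_hidc_globular: "v \<in> Ver B \<Longrightarrow> is_globular B (hidc B v) v v"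
  using globular_ret_iff[of "hidc B v" v v] retro_hidc[of v] by force

lemma ret_hpaste_boundary:
  assumes "a \<in> Cell B" "b \<in> Cell B" "cright B a = cleft B b"
  shows "a \<parallel>\<^bsub>B\<^esub> b \<in> Cell B" "ctop B (a \<parallel>\<^bsub>B\<^esub> b) = ctop B b \<cdot>\<^bsub>B\<^esub> ctop B a"
    "cbot B (a \<parallel>\<^bsub>B\<^esub> b) = cbot B b \<cdot>\<^bsub>B\<^esub> cbot B a"
    "cleft B (a \<parallel>\<^bsub>B\<^esub> b) = cleft B a" "cright B (a \<parallel>\<^bsub>B\<^esub> b) = cright B b"
proof -
  obtain f v w g \<alpha> h x k \<beta> where e: "a = Retrocell f v w g \<alpha>" "b = Retrocell h w x k \<beta>"
    and m: "Retrocell f v w g \<alpha> \<in> retrocells A K" "Retrocell h w x k \<beta> \<in> retrocells A K"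
    using assms by (rule hcomposableE)
  show "a \<parallel>\<^bsub>B\<^esub> b \<in> Cell B" "ctop B (a \<parallel>\<^bsub>B\<^esub> b) = ctop B b \<cdot>\<^bsub>B\<^esub> ctop B a"
    "cbot B (a \<parallel>\<^bsub>B\<^esub> b) = cbot B b \<cdot>\<^bsub>B\<^esub> cbot B a"
    "cleft B (a \<parallel>\<^bsub>B\<^esub> b) = cleft B a" "cright B (a \<parallel>\<^bsub>B\<^esub> b) = cright B b"
    using ret_hpaste_eq(2)[OF m] unfolding e by (simp_all add: ret_hpaste_eq(1)[OF m] del: ret_hpaste.simps)
qed

lemma ret_vpaste_boundary:
  assumes "a \<in> Cell B" "b \<in> Cell B" "cbot B a = ctop B b"
  shows "a \<oslash>\<^bsub>B\<^esub> b \<in> Cell B" "ctop B (a \<oslash>\<^bsub>B\<^esub> b) = ctop B a" "cbot B (a \<oslash>\<^bsub>B\<^esub> b) = cbot B b"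
    "cleft B (a \<oslash>\<^bsub>B\<^esub> b) = cleft B b \<bullet>\<^bsub>B\<^esub> cleft B a" "cright B (a \<oslash>\<^bsub>B\<^esub> b) = cright B b \<bullet>\<^bsub>B\<^esub> cright B a"
proof -
  obtain f v w g \<alpha> v' w' h \<beta> where e: "a = Retrocell f v w g \<alpha>" "b = Retrocell g v' w' h \<beta>"
    and m: "Retrocell f v w g \<alpha> \<in> retrocells A K" "Retrocell g v' w' h \<beta> \<in> retrocells A K"
    using assms by (rule vcomposableE)
  show "a \<oslash>\<^bsub>B\<^esub> b \<in> Cell B" "ctop B (a \<oslash>\<^bsub>B\<^esub> b) = ctop B a" "cbot B (a \<oslash>\<^bsub>B\<^esub> b) = cbot B b"
    "cleft B (a \<oslash>\<^bsub>B\<^esub> b) = cleft B b \<bullet>\<^bsub>B\<^esub> cleft B a" "cright B (a \<oslash>\<^bsub>B\<^esub> b) = cright B b \<bullet>\<^bsub>B\<^esub> cright B a"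
    using ret_vpaste_eq(2)[OF m] unfolding e by (simp_all add: ret_vpaste_eq(1)[OF m] del: ret_vpaste.simps)
qed

lemma ret_hpaste_hidc:
  assumes "a \<in> Cell B"
  shows "hidc B (cleft B a) \<parallel>\<^bsub>B\<^esub> a = a" "a \<parallel>\<^bsub>B\<^esub> hidc B (cright B a) = a"
proof -
  obtain f v w g \<alpha> where e: "a = Retrocell f v w g \<alpha>" and m: "Retrocell f v w g \<alpha> \<in> retrocells A K"
    using assms by (rule retrocellE)
  note [simp] = retrocellD(1-8,11-15)[OF m]
  show "hidc B (cleft B a) \<parallel>\<^bsub>B\<^esub> a = a"
    using ret_hpaste_retro(2)[OF m, of "hidc A v" v] retro_hidc[of v] unfolding e by simp
  show "a \<parallel>\<^bsub>B\<^esub> hidc B (cright B a) = a"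
    using ret_hpaste_retro(1)[OF m, of "hidc A w" w] retro_hidc[of w] unfolding e by simp
qed

lemma ret_hpaste_assoc:
  assumes "a \<in> Cell B" "b \<in> Cell B" "c \<in> Cell B" "cright B a = cleft B b" "cright B b = cleft B c"
  shows "a \<parallel>\<^bsub>B\<^esub> b \<parallel>\<^bsub>B\<^esub> c = a \<parallel>\<^bsub>B\<^esub> (b \<parallel>\<^bsub>B\<^esub> c)"
proof -
  obtain f v w g \<alpha> h x k \<beta> where e: "a = Retrocell f v w g \<alpha>" "b = Retrocell h w x k \<beta>"
    and m: "Retrocell f v w g \<alpha> \<in> retrocells A K" "Retrocell h w x k \<beta> \<in> retrocells A K"
    using assms(1,2,4) by (rule hcomposableE)
  obtain l y n \<gamma> where e3: "c = Retrocell l x y n \<gamma>" and m3: "Retrocell l x y n \<gamma> \<in> retrocells A K"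
    using assms(3,5) unfolding e by (cases c) auto
  note [simp] = retrocellD(1-8)[OF m(1)] retrocellD(1-8)[OF m(2)] retrocellD(1-8)[OF m3]
  note r1 = ret_hpaste_eq[OF m] and r2 = ret_hpaste_eq[OF m(2) m3]
  have eqs: "l \<cdot> h \<cdot> f = l \<cdot> (h \<cdot> f)" "n \<cdot> k \<cdot> g = n \<cdot> (k \<cdot> g)" by (simp_all add: hcomp_assoc)
  have s: "splits (h \<cdot> f)\<^sub>* h\<^sub>* f\<^sub>* (cmp_split A K h f)" "splits (l \<cdot> h)\<^sub>* l\<^sub>* h\<^sub>* (cmp_split A K l h)"
    "splits (l \<cdot> (h \<cdot> f))\<^sub>* l\<^sub>* (h \<cdot> f)\<^sub>* (cmp_split A K l (h \<cdot> f))"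
    "splits (l \<cdot> (h \<cdot> f))\<^sub>* (l \<cdot> h)\<^sub>* f\<^sub>* (cmp_split A K (l \<cdot> h) f)"
    using splits_cmp_split[of f "l \<cdot> h"] by (simp_all add: splits_cmp_split eqs)
  have j: "joins k\<^sub>* g\<^sub>* (k \<cdot> g)\<^sub>* (cmp_join A K k g)" "joins n\<^sub>* k\<^sub>* (n \<cdot> k)\<^sub>* (cmp_join A K n k)"
    "joins n\<^sub>* (k \<cdot> g)\<^sub>* (n \<cdot> (k \<cdot> g))\<^sub>* (cmp_join A K n (k \<cdot> g))"
    "joins (n \<cdot> k)\<^sub>* g\<^sub>* (n \<cdot> (k \<cdot> g))\<^sub>* (cmp_join A K (n \<cdot> k) g)"
    using joins_cmp_join[of g "n \<cdot> k"] by (simp_all add: joins_cmp_join eqs)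
  show ?thesis
    unfolding e e3 ret_simps r1(1) r2(1) ret_hpaste_eq(1)[OF r1(2) m3] ret_hpaste_eq(1)[OF m(1) r2(2)] eqs
    using quintet_hcomp_assoc[OF retrocellD(9)[OF m(1)] retrocellD(9)[OF m(2)] retrocellD(9)[OF m3] s j]
    by (simp add: cmp_split_coherence cmp_join_coherence)
qed

lemma ret_vidc:
  assumes "f \<in> Hor B"
  shows "vidc B f \<in> Cell B" "ctop B (vidc B f) = f" "cbot B (vidc B f) = f"
    "cleft B (vidc B f) = vid B (hdom B f)" "cright B (vidc B f) = vid B (hcod B f)"
  using assms by (simp_all add: retrocell_iff)

lemma ret_interchange:
  assumes "a \<in> Cell B" "b \<in> Cell B" "c \<in> Cell B" "d \<in> Cell B"
    "cright B a = cleft B b" "cright B c = cleft B d" "cbot B a = ctop B c" "cbot B b = ctop B d"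
  shows "(a \<parallel>\<^bsub>B\<^esub> b) \<oslash>\<^bsub>B\<^esub> (c \<parallel>\<^bsub>B\<^esub> d) = (a \<oslash>\<^bsub>B\<^esub> c) \<parallel>\<^bsub>B\<^esub> (b \<oslash>\<^bsub>B\<^esub> d)"
proof -
  obtain f v w g \<alpha> h x k \<beta> where e: "a = Retrocell f v w g \<alpha>" "b = Retrocell h w x k \<beta>"
    and m: "Retrocell f v w g \<alpha> \<in> retrocells A K" "Retrocell h w x k \<beta> \<in> retrocells A K"
    using assms(1,2,5) by (rule hcomposableE)
  obtain v' w' l \<alpha>' x' n \<beta>' where e': "c = Retrocell g v' w' l \<alpha>'" "d = Retrocell k w' x' n \<beta>'"
    and m': "Retrocell g v' w' l \<alpha>' \<in> retrocells A K" "Retrocell k w' x' n \<beta>' \<in> retrocells A K"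
    using assms(3,4,6,7,8) unfolding e by (cases c; cases d) auto
  note [simp] = retrocellD(1-6)[OF m(1)] retrocellD(1-6)[OF m(2)]
    retrocellD(1-8)[OF m'(1)] retrocellD(1-8)[OF m'(2)]
  note r = ret_hpaste_eq[OF m] ret_hpaste_eq[OF m'] ret_vpaste_eq[OF m(1) m'(1)] ret_vpaste_eq[OF m(2) m'(2)]
  have s: "splits (h \<cdot> f)\<^sub>* h\<^sub>* f\<^sub>* (cmp_split A K h f)" "splits (k \<cdot> g)\<^sub>* k\<^sub>* g\<^sub>* (cmp_split A K k g)"
    by (simp_all add: splits_cmp_split)
  have j: "joins k\<^sub>* g\<^sub>* (k \<cdot> g)\<^sub>* (cmp_join A K k g)" "joins n\<^sub>* l\<^sub>* (n \<cdot> l)\<^sub>* (cmp_join A K n l)"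
    by (simp_all add: joins_cmp_join)
  have i: "cmp_join A K k g \<parallel> cmp_split A K k g = hidc A (k\<^sub>* \<bullet> g\<^sub>*)"
    by (simp add: cmp_split_join)
  show ?thesis
    unfolding e e' ret_simps r(1,3,5,7) ret_vpaste_eq(1)[OF r(2,4)] ret_hpaste_eq(1)[OF r(6,8)]
    using quintet_interchange[OF retrocellD(9)[OF m(1)] retrocellD(9)[OF m(2)]
        retrocellD(9)[OF m'(1)] retrocellD(9)[OF m'(2)] s j i] by simp
qed

lemma ret_vpaste_hidc:
  assumes "v \<in> Ver B" "w \<in> Ver B" "vcod B v = vdom B w"
  shows "hidc B v \<oslash>\<^bsub>B\<^esub> hidc B w = hidc B (w \<bullet>\<^bsub>B\<^esub> v)"
  using assms retro_vpaste[of "hidc A v" v v "hidc A w" w w]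
    retro_hidc[of v] retro_hidc[of w] retro_hidc[of "w \<bullet> v"] by simp

lemma ret_hpaste_vidc:
  assumes "f \<in> Hor B" "h \<in> Hor B" "hcod B f = hdom B h"
  shows "vidc B f \<parallel>\<^bsub>B\<^esub> vidc B h = vidc B (h \<cdot>\<^bsub>B\<^esub> f)"
proof -
  note a [simp] = assms[unfolded ret_simps]
  have m: "Retrocell f (vid A (hdom A f)) (vid A (hcod A f)) f (hidc A f\<^sub>*) \<in> retrocells A K"
    "Retrocell h (vid A (hcod A f)) (vid A (hcod A h)) h (hidc A h\<^sub>*) \<in> retrocells A K"
    by (simp_all add: retrocell_iff)
  note s = splitsD(7-11)[OF splits_cmp_split[OF a]] and j = joinsD(7-11)[OF joins_cmp_join[OF a]]
  have "cmp_split A K h f \<parallel> cmp_join A K h f = hidc A (h \<cdot> f)\<^sub>*"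
    by (simp add: cmp_split_join)
  then show ?thesis
    using ret_hpaste_eq(1)[OF m] prolong_join(1)[OF joins_cmp_join[OF a], of "vid A (hdom A f)"]
    by (simp add: quintet_hcomp_def prolong_def s j)
qed

lemma ret_vpaste_vidc:
  assumes "a \<in> Cell B"
  shows "vidc B (ctop B a) \<oslash>\<^bsub>B\<^esub> a = a" "a \<oslash>\<^bsub>B\<^esub> vidc B (cbot B a) = a"
proof -
  obtain f v w g \<alpha> where e: "a = Retrocell f v w g \<alpha>" and m: "Retrocell f v w g \<alpha> \<in> retrocells A K"
    using assms by (rule retrocellE)
  note [simp] = retrocellD(1-8,11-15)[OF m]
  have m': "Retrocell f (vid A (hdom A f)) (vid A (hcod A f)) f (hidc A f\<^sub>*) \<in> retrocells A K"
    "Retrocell g (vid A (hdom A g)) (vid A (hcod A g)) g (hidc A g\<^sub>*) \<in> retrocells A K"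
    by (simp_all add: retrocell_iff)
  show "vidc B (ctop B a) \<oslash>\<^bsub>B\<^esub> a = a"
    using ret_vpaste_eq(1)[OF m'(1) m] unfolding e by (simp add: quintet_vcomp_def prolong_def)
  show "a \<oslash>\<^bsub>B\<^esub> vidc B (cbot B a) = a"
    using ret_vpaste_eq(1)[OF m m'(2)] unfolding e by (simp add: quintet_vcomp_def prolong_def)
qed

lemma ret_assoc_globular:
  assumes "v \<in> Ver B" "w \<in> Ver B" "x \<in> Ver B" "vcod B v = vdom B w" "vcod B w = vdom B x"
  shows "is_globular B (assoc B x w v) (x \<bullet>\<^bsub>B\<^esub> w \<bullet>\<^bsub>B\<^esub> v) (x \<bullet>\<^bsub>B\<^esub> (w \<bullet>\<^bsub>B\<^esub> v))"
  using assoc_inv_boundary(1)[OF assms[unfolded ret_simps]] retro_assoc[OF assms[unfolded ret_simps]]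
  unfolding globular_ret_iff by auto

lemma ret_assoc_inverse:
  assumes "v \<in> Ver B" "w \<in> Ver B" "x \<in> Ver B" "vcod B v = vdom B w" "vcod B w = vdom B x"
  shows "is_hinverse B (assoc B x w v) (retro (assoc A x w v))"
proof -
  have "inverse_cells (assoc_inv x w v) (assoc A x w v) (x \<bullet> (w \<bullet> v)) (x \<bullet> w \<bullet> v)"
    using inverse_cells_assoc[OF assms[unfolded ret_simps]] by (auto simp: inverse_cells_def)
  from retro_inverse[OF this] show ?thesis
    using retro_assoc[OF assms[unfolded ret_simps]] by simp
qed

lemma ret_assoc_iso:
  assumes "v \<in> Ver B" "w \<in> Ver B" "x \<in> Ver B" "vcod B v = vdom B w" "vcod B w = vdom B x"
  shows "\<exists>\<beta>. is_hinverse B (assoc B x w v) \<beta>"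
  using ret_assoc_inverse[OF assms] by blast

text \<open>
  \<open>quintet_vcomp_assoc\<close> with both associators moved to the other side, since the
  associators of retrocells are the inverse ones.
\<close>

lemma ret_assoc_natural:
  assumes "a \<in> Cell B" "b \<in> Cell B" "c \<in> Cell B" "cbot B a = ctop B b" "cbot B b = ctop B c"
  shows "a \<oslash>\<^bsub>B\<^esub> (b \<oslash>\<^bsub>B\<^esub> c) \<parallel>\<^bsub>B\<^esub> assoc B (cright B c) (cright B b) (cright B a) =
    assoc B (cleft B c) (cleft B b) (cleft B a) \<parallel>\<^bsub>B\<^esub> a \<oslash>\<^bsub>B\<^esub> b \<oslash>\<^bsub>B\<^esub> c"
proof -
  obtain f v1 w1 g \<alpha> v2 w2 h \<beta> where e: "a = Retrocell f v1 w1 g \<alpha>" "b = Retrocell g v2 w2 h \<beta>"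
    and m: "Retrocell f v1 w1 g \<alpha> \<in> retrocells A K" "Retrocell g v2 w2 h \<beta> \<in> retrocells A K"
    using assms(1,2,4) by (rule vcomposableE)
  obtain v3 w3 k \<gamma> where e3: "c = Retrocell h v3 w3 k \<gamma>" and m3: "Retrocell h v3 w3 k \<gamma> \<in> retrocells A K"
    using assms(3,5) unfolding e by (cases c) auto
  have [simp]: "vcod A v1 = vdom A v2" "vcod A w1 = vdom A w2" "vcod A v2 = vdom A v3" "vcod A w2 = vdom A w3"
    using retrocellD(5-8)[OF m(1)] retrocellD(5-8)[OF m(2)] retrocellD(5-8)[OF m3] by simp_all
  note [simp] = retrocellD(1-6)[OF m(1)] retrocellD(1-6)[OF m(2)] retrocellD(1-8)[OF m3]
  note r = ret_vpaste_eq[OF m] ret_vpaste_eq[OF m(2) m3]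
  note r' = ret_vpaste_eq[OF m(1) r(4)] ret_vpaste_eq[OF r(2) m3]
  let ?l = "quintet_vcomp (w3 \<bullet> w2) w1 f\<^sub>* g\<^sub>* v1 k\<^sub>* (v3 \<bullet> v2) \<alpha> (quintet_vcomp w3 w2 g\<^sub>* h\<^sub>* v2 k\<^sub>* v3 \<beta> \<gamma>)"
  let ?r = "quintet_vcomp w3 (w2 \<bullet> w1) f\<^sub>* h\<^sub>* (v2 \<bullet> v1) k\<^sub>* v3 (quintet_vcomp w2 w1 f\<^sub>* g\<^sub>* v1 h\<^sub>* v2 \<alpha> \<beta>) \<gamma>"
  let ?aw = "assoc A w3 w2 w1" and ?av = "assoc A v3 v2 v1"
  let ?aw' = "assoc_inv w3 w2 w1" and ?av' = "assoc_inv v3 v2 v1"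
  note [simp] = retrocellD(11-15)[OF r'(2)] retrocellD(11-15)[OF r'(4)]
  have q: "hidc A f\<^sub>* \<oslash> ?aw \<parallel> ?r = ?l \<parallel> ?av \<oslash> hidc A k\<^sub>*"
    by (rule quintet_vcomp_assoc[OF retrocellD(9)[OF m(1)] retrocellD(9)[OF m(2)] retrocellD(9)[OF m3]])
  have iw: "inverse_cells (hidc A f\<^sub>* \<oslash> ?aw) (hidc A f\<^sub>* \<oslash> ?aw') (w3 \<bullet> w2 \<bullet> w1 \<bullet> f\<^sub>*) (w3 \<bullet> (w2 \<bullet> w1) \<bullet> f\<^sub>*)"
    and iv: "inverse_cells (?av \<oslash> hidc A k\<^sub>*) (?av' \<oslash> hidc A k\<^sub>*) (k\<^sub>* \<bullet> (v3 \<bullet> v2 \<bullet> v1)) (k\<^sub>* \<bullet> (v3 \<bullet> (v2 \<bullet> v1)))"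
    by (simp_all add: inverse_cells_whisker inverse_cells_assoc)
  note [simp] = inverse_cellsD[OF iw] inverse_cellsD[OF iv]
  have "hidc A f\<^sub>* \<oslash> ?aw' \<parallel> ?l = hidc A f\<^sub>* \<oslash> ?aw' \<parallel> (?l \<parallel> ?av \<oslash> hidc A k\<^sub>* \<parallel> ?av' \<oslash> hidc A k\<^sub>*)"
    by (simp add: hpaste_assoc)
  also have "\<dots> = ?r \<parallel> ?av' \<oslash> hidc A k\<^sub>*"
    unfolding q[symmetric] by (simp add: hpaste_assoc)
  finally have q': "hidc A f\<^sub>* \<oslash> ?aw' \<parallel> ?l = ?r \<parallel> ?av' \<oslash> hidc A k\<^sub>*" .
  have ra: "assoc B w3 w2 w1 = retro ?aw'" "assoc B v3 v2 v1 = retro ?av'"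
    by (rule retro_assoc; simp)+
  show ?thesis
    unfolding e e3
    using ret_hpaste_retro(1)[OF r'(2) assoc_inv_boundary(1)[of w1 w2 w3]]
      ret_hpaste_retro(2)[OF r'(4) assoc_inv_boundary(1)[of v1 v2 v3]]
    by (simp add: ra r(1,3) r'(1,3) q' del: ret_simps(21) ret_vpaste.simps ret_hpaste.simps)
qed

lemma ret_pentagon:
  assumes "v \<in> Ver B" "w \<in> Ver B" "x \<in> Ver B" "y \<in> Ver B"
    "vcod B v = vdom B w" "vcod B w = vdom B x" "vcod B x = vdom B y"
  shows "assoc B (y \<bullet>\<^bsub>B\<^esub> x) w v \<parallel>\<^bsub>B\<^esub> assoc B y x (w \<bullet>\<^bsub>B\<^esub> v) =
    hidc B v \<oslash>\<^bsub>B\<^esub> assoc B y x w \<parallel>\<^bsub>B\<^esub> assoc B y (x \<bullet>\<^bsub>B\<^esub> w) v \<parallel>\<^bsub>B\<^esub> assoc B x w v \<oslash>\<^bsub>B\<^esub> hidc B y"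
proof -
  note [simp] = assms[unfolded ret_simps]
  have r: "assoc B (y \<bullet> x) w v = retro (assoc_inv (y \<bullet> x) w v)"
    "assoc B y x (w \<bullet> v) = retro (assoc_inv y x (w \<bullet> v))" "assoc B y x w = retro (assoc_inv y x w)"
    "assoc B y (x \<bullet> w) v = retro (assoc_inv y (x \<bullet> w) v)" "assoc B x w v = retro (assoc_inv x w v)"
    "hidc B v = retro (hidc A v)" "hidc B y = retro (hidc A y)"
    by (rule retro_assoc retro_hidc; simp)+
  have g: "\<guillemotleft>assoc_inv (y \<bullet> x) w v : y \<bullet> x \<bullet> (w \<bullet> v) \<Rightarrow> y \<bullet> x \<bullet> w \<bullet> v\<guillemotright>"
    "\<guillemotleft>assoc_inv y x (w \<bullet> v) : y \<bullet> (x \<bullet> (w \<bullet> v)) \<Rightarrow> y \<bullet> x \<bullet> (w \<bullet> v)\<guillemotright>"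
    "\<guillemotleft>hidc A v \<oslash> assoc_inv y x w : y \<bullet> (x \<bullet> w) \<bullet> v \<Rightarrow> y \<bullet> x \<bullet> w \<bullet> v\<guillemotright>"
    "\<guillemotleft>assoc_inv y (x \<bullet> w) v : y \<bullet> (x \<bullet> w \<bullet> v) \<Rightarrow> y \<bullet> (x \<bullet> w) \<bullet> v\<guillemotright>"
    "\<guillemotleft>assoc_inv x w v \<oslash> hidc A y : y \<bullet> (x \<bullet> (w \<bullet> v)) \<Rightarrow> y \<bullet> (x \<bullet> w \<bullet> v)\<guillemotright>"
    by (simp_all add: globular_vpaste)
  have w: "ret_vpaste A K (retro (hidc A v)) (retro (assoc_inv y x w)) = retro (hidc A v \<oslash> assoc_inv y x w)"
    "ret_vpaste A K (retro (assoc_inv x w v)) (retro (hidc A y)) = retro (assoc_inv x w v \<oslash> hidc A y)"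
    using retro_vpaste[of "hidc A v" v v "assoc_inv y x w" "y \<bullet> (x \<bullet> w)" "y \<bullet> x \<bullet> w"]
      retro_vpaste[of "assoc_inv x w v" "x \<bullet> (w \<bullet> v)" "x \<bullet> w \<bullet> v" "hidc A y" y y] by simp_all
  have "ret_hpaste A K (retro (assoc_inv (y \<bullet> x) w v)) (retro (assoc_inv y x (w \<bullet> v))) =
    ret_hpaste A K (ret_hpaste A K (retro (hidc A v \<oslash> assoc_inv y x w)) (retro (assoc_inv y (x \<bullet> w) v)))
      (retro (assoc_inv x w v \<oslash> hidc A y))"
    unfolding retro_hpaste[OF g(1,2)] retro_hpaste[OF g(3,4)]
      retro_hpaste[OF globular_hpaste[OF g(4,3)] g(5)]
    using pentagon_inv(3)[OF assms[unfolded ret_simps]] by simp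
  then show ?thesis
    unfolding ret_simps(1-18) r w .
qed

lemma ret_triangle:
  assumes "v \<in> Ver B" "w \<in> Ver B" "vcod B v = vdom B w"
  shows "assoc B w (vid B (vcod B v)) v = hidc B (w \<bullet>\<^bsub>B\<^esub> v)"
  using assms by simp

theorem double_category_ret: "double_category B"
  by unfold_locales (fact ret_boundary ret_hidc_globular ret_hpaste_boundary ret_hpaste_hidc ret_hpaste_assoc ret_vidc
    ret_vpaste_boundary ret_interchange ret_vpaste_hidc ret_hpaste_vidc ret_vpaste_vidc
    ret_assoc_globular ret_assoc_iso ret_assoc_natural ret_pentagon ret_triangle
  | (simp add: hcomp_assoc; fail))+

theorem companion_choice_ret: "companion_choice B L"
proof -
  have "is_companion B f f\<^sub>* (psi L f) (chi L f)" if f[simp]: "f \<in> Hor A" for f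
  proof -
    have m: "Retrocell (hid A (hdom A f)) (vid A (hdom A f)) f\<^sub>* f (hidc A f\<^sub>*) \<in> retrocells A K"
      "Retrocell f f\<^sub>* (vid A (hcod A f)) (hid A (hcod A f)) (hidc A f\<^sub>*) \<in> retrocells A K"
      by (simp_all add: retrocell_iff)
    show ?thesis
      unfolding is_companion_def using m ret_hpaste_eq(1)[OF m] ret_vpaste_eq(1)[OF m]
      by (simp add: quintet_hcomp_def quintet_vcomp_def prolong_def prolong_join_def)
  qed
  then show ?thesis
    unfolding companion_choice_def by simp
qed

section \<open>The isomorphism with retrocells of retrocells\<close>

abbreviation T where "T \<equiv> companion_transpose A K"

text \<open>
  The right-hand side is the horizontal pasting of \<open>T \<beta>\<close> and \<open>T \<alpha>\<close> as retrocells of retrocells. Folding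
  it lets \<open>\<psi> (k \<cdot> g)\<close> travel inwards from the left and \<open>\<chi> (h \<cdot> f)\<close> from the right. They
  meet as \<open>\<psi> f\<close> above \<open>\<alpha>\<close> above \<open>\<psi> k\<close>, and \<open>\<chi> f\<close> above \<open>\<beta>\<close> above \<open>\<chi> k\<close>, whose
  pasting is \<open>\<alpha> \<parallel> \<beta>\<close> by the companion identities.
\<close>

lemma transpose_hpaste:
  assumes [simp]: "\<alpha> \<in> Cell A" "\<beta> \<in> Cell A" and m: "cright A \<alpha> = cleft A \<beta>"
  shows "T (\<alpha> \<parallel> \<beta>) =
    hidc A (cleft A \<alpha>) \<oslash> cmp_split A K (cbot A \<beta>) (cbot A \<alpha>) \<parallel>
    (assoc A (cbot A \<beta>)\<^sub>* (cbot A \<alpha>)\<^sub>* (cleft A \<alpha>) \<parallel> (T \<alpha> \<oslash> hidc A (cbot A \<beta>)\<^sub>* \<parallel>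
    (assoc_inv (cbot A \<beta>)\<^sub>* (cright A \<alpha>) (ctop A \<alpha>)\<^sub>* \<parallel> (hidc A (ctop A \<alpha>)\<^sub>* \<oslash> T \<beta> \<parallel>
    (assoc A (cright A \<beta>) (ctop A \<beta>)\<^sub>* (ctop A \<alpha>)\<^sub>* \<parallel>
      cmp_join A K (ctop A \<beta>) (ctop A \<alpha>) \<oslash> hidc A (cright A \<beta>))))))" (is "_ = ?S")
proof -
  define f v w g where d: "f = ctop A \<alpha>" "v = cleft A \<alpha>" "w = cright A \<alpha>" "g = cbot A \<alpha>"
  define h x k where d': "h = ctop A \<beta>" "x = cright A \<beta>" "k = cbot A \<beta>"
  note cor = corner_tl corner_tr corner_bl corner_br
  have [simp]: "f \<in> Hor A" "g \<in> Hor A" "h \<in> Hor A" "k \<in> Hor A" "v \<in> Ver A" "w \<in> Ver A" "x \<in> Ver A"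
    "hdom A f = vdom A v" "hcod A f = vdom A w" "hdom A g = vcod A v" "hcod A g = vcod A w"
    "hdom A h = vdom A w" "hcod A h = vdom A x" "hdom A k = vcod A w" "hcod A k = vcod A x"
    unfolding d d' by (simp_all add: cor) (simp_all add: m cor)
  have T: "\<guillemotleft>T \<alpha> : g\<^sub>* \<bullet> v \<Rightarrow> w \<bullet> f\<^sub>*\<guillemotright>" "\<guillemotleft>T \<beta> : k\<^sub>* \<bullet> w \<Rightarrow> x \<bullet> h\<^sub>*\<guillemotright>"
    using transpose_boundary[of \<alpha>] transpose_boundary[of \<beta>] unfolding d d' by (simp_all add: m)
  have p: "hidc A v \<oslash> \<psi> g \<parallel> T \<alpha> = \<psi> f \<oslash> \<alpha>" and c: "T \<beta> \<parallel> \<chi> h \<oslash> hidc A x = \<beta> \<oslash> \<chi> k"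
    using psi_transpose(1)[of \<alpha>] psi_transpose(2)[of \<beta>] unfolding d d' by simp_all
  have b: "cleft A \<alpha> = v" "cright A \<alpha> = w" "ctop A \<alpha> = f" "cbot A \<alpha> = g"
    "cleft A \<beta> = w" "cright A \<beta> = x" "ctop A \<beta> = h" "cbot A \<beta> = k"
    by (simp_all add: d d' m)
  note [simp] = b globularD(1-3)[OF T(1)] globularD(1-3)[OF T(2)]
  have [simp]: "ctop A (T \<alpha>) = hid A (vdom A v)" "cbot A (T \<alpha>) = hid A (vcod A w)"
    "ctop A (T \<beta>) = hid A (vdom A w)" "cbot A (T \<beta>) = hid A (vcod A x)"
    using globularD(8,9)[OF T(1)] globularD(8,9)[OF T(2)] by simp_all
  have s: "splits (k \<cdot> g)\<^sub>* k\<^sub>* g\<^sub>* (cmp_split A K k g)" and j: "joins h\<^sub>* f\<^sub>* (h \<cdot> f)\<^sub>* (cmp_join A K h f)"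
    by (simp_all add: splits_cmp_split joins_cmp_join)
  have [simp]: "cmp_split A K k g \<in> Cell A" "cleft A (cmp_split A K k g) = (k \<cdot> g)\<^sub>*"
    "cright A (cmp_split A K k g) = k\<^sub>* \<bullet> g\<^sub>*" "ctop A (cmp_split A K k g) = hid A (vcod A v)"
    "cbot A (cmp_split A K k g) = hid A (vcod A x)"
    "cmp_join A K h f \<in> Cell A" "cright A (cmp_join A K h f) = (h \<cdot> f)\<^sub>*"
    "cleft A (cmp_join A K h f) = h\<^sub>* \<bullet> f\<^sub>*" "ctop A (cmp_join A K h f) = hid A (vdom A v)"
    "cbot A (cmp_join A K h f) = hid A (vdom A x)"
    using splitsD[OF s] joinsD[OF j] by simp_all
  \<comment> \<open>Steps 1 to 4 move \<open>\<psi> (k \<cdot> g)\<close> inwards from the left, steps 5 to 7 move \<open>\<chi> (h \<cdot> f)\<close> from the right.\<close>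
  let ?\<tau> = "vidc A g \<parallel> \<psi> k" and ?\<kappa> = "\<chi> f \<parallel> vidc A h"
  have 1: "hidc A v \<oslash> \<psi> (k \<cdot> g) \<parallel> hidc A v \<oslash> cmp_split A K k g = hidc A v \<oslash> (\<psi> g \<oslash> ?\<tau>)"
    using interchange[of "hidc A v" "hidc A v" "\<psi> (k \<cdot> g)" "cmp_split A K k g"] by (simp add: cmp_split_join(3))
  have 2: "hidc A v \<oslash> (\<psi> g \<oslash> ?\<tau>) \<parallel> assoc A k\<^sub>* g\<^sub>* v = hidc A v \<oslash> \<psi> g \<oslash> ?\<tau>"
    using assoc_natural[of "hidc A v" "\<psi> g" ?\<tau>] by simp
  have 3: "hidc A v \<oslash> \<psi> g \<oslash> ?\<tau> \<parallel> T \<alpha> \<oslash> hidc A k\<^sub>* = \<psi> f \<oslash> \<alpha> \<oslash> ?\<tau>"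
    using interchange[of "hidc A v \<oslash> \<psi> g" "T \<alpha>" ?\<tau> "hidc A k\<^sub>*"] by (simp add: p)
  have 4: "\<psi> f \<oslash> \<alpha> \<oslash> ?\<tau> \<parallel> assoc_inv k\<^sub>* w f\<^sub>* = \<psi> f \<oslash> (\<alpha> \<oslash> ?\<tau>)"
    using assoc_inv_natural[of "\<psi> f" \<alpha> ?\<tau>] by simp
  have 5: "cmp_join A K h f \<oslash> hidc A x \<parallel> \<chi> (h \<cdot> f) \<oslash> hidc A x = ?\<kappa> \<oslash> \<chi> h \<oslash> hidc A x"
    using interchange[of "cmp_join A K h f" "\<chi> (h \<cdot> f)" "hidc A x" "hidc A x"] by (simp add: cmp_split_join(4))
  have 6: "assoc A x h\<^sub>* f\<^sub>* \<parallel> ?\<kappa> \<oslash> \<chi> h \<oslash> hidc A x = ?\<kappa> \<oslash> (\<chi> h \<oslash> hidc A x)"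
    using assoc_natural[of ?\<kappa> "\<chi> h" "hidc A x"] by simp
  have 7: "hidc A f\<^sub>* \<oslash> T \<beta> \<parallel> ?\<kappa> \<oslash> (\<chi> h \<oslash> hidc A x) = ?\<kappa> \<oslash> (\<beta> \<oslash> \<chi> k)"
    using interchange[of "hidc A f\<^sub>*" ?\<kappa> "T \<beta>" "\<chi> h \<oslash> hidc A x"] by (simp add: c)
  have 8: "\<psi> f \<oslash> (\<alpha> \<oslash> ?\<tau>) \<parallel> ?\<kappa> \<oslash> (\<beta> \<oslash> \<chi> k) = \<alpha> \<parallel> \<beta>"
  proof -
    have "\<psi> f \<parallel> ?\<kappa> = vidc A (h \<cdot> f)"
      by (simp add: hpaste_eq_assoc[OF companion(14)])
    moreover have "?\<tau> \<parallel> \<chi> k = vidc A (k \<cdot> g)"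
      by (simp add: hpaste_assoc)
    ultimately show ?thesis
      using interchange[of "\<psi> f" ?\<kappa> "\<alpha> \<oslash> ?\<tau>" "\<beta> \<oslash> \<chi> k"] interchange[of \<alpha> \<beta> ?\<tau> "\<chi> k"] by simp
  qed
  let ?S' = "hidc A v \<oslash> cmp_split A K k g \<parallel> (assoc A k\<^sub>* g\<^sub>* v \<parallel> (T \<alpha> \<oslash> hidc A k\<^sub>* \<parallel>
    (assoc_inv k\<^sub>* w f\<^sub>* \<parallel> (hidc A f\<^sub>* \<oslash> T \<beta> \<parallel> (assoc A x h\<^sub>* f\<^sub>* \<parallel> cmp_join A K h f \<oslash> hidc A x)))))"
  have "fold_companions (k \<cdot> g) v ?S' x (h \<cdot> f) = \<alpha> \<parallel> \<beta>"
    unfolding fold_companions_def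
    by (simp add: hpaste_assoc hpaste_eq_assoc[OF 1] hpaste_eq_assoc[OF 2] hpaste_eq_assoc[OF 3]
        hpaste_eq_assoc[OF 4] 5 6 7 8)
  moreover have "\<guillemotleft>?S' : (k \<cdot> g)\<^sub>* \<bullet> v \<Rightarrow> x \<bullet> (h \<cdot> f)\<^sub>*\<guillemotright>"
    unfolding is_globular_def by simp
  ultimately show ?thesis
    using fold_boundary(6)[of "h \<cdot> f" "k \<cdot> g" v x ?S'] by simp
qed

lemma transpose_vpaste:
  assumes [simp]: "\<alpha> \<in> Cell A" "\<beta> \<in> Cell A" and m: "cbot A \<alpha> = ctop A \<beta>"
  shows "T (\<alpha> \<oslash> \<beta>) =
    assoc_inv (cbot A \<beta>)\<^sub>* (cleft A \<beta>) (cleft A \<alpha>) \<parallel> (hidc A (cleft A \<alpha>) \<oslash> T \<beta> \<parallel>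
    (assoc A (cright A \<beta>) (cbot A \<alpha>)\<^sub>* (cleft A \<alpha>) \<parallel> (T \<alpha> \<oslash> hidc A (cright A \<beta>) \<parallel>
      assoc_inv (cright A \<beta>) (cright A \<alpha>) (ctop A \<alpha>)\<^sub>*)))"
proof -
  define f v w g where d: "f = ctop A \<alpha>" "v = cleft A \<alpha>" "w = cright A \<alpha>" "g = cbot A \<alpha>"
  define h v' w' where d': "h = cbot A \<beta>" "v' = cleft A \<beta>" "w' = cright A \<beta>"
  note cor = corner_tl corner_tr corner_bl corner_br
  have t: "ctop A \<beta> = g" unfolding d m ..
  have [simp]: "f \<in> Hor A" "g \<in> Hor A" "h \<in> Hor A" "v \<in> Ver A" "w \<in> Ver A" "v' \<in> Ver A" "w' \<in> Ver A"
    "hdom A f = vdom A v" "hcod A f = vdom A w" "hdom A g = vcod A v" "hcod A g = vcod A w"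
    "hdom A h = vcod A v'" "hcod A h = vcod A w'" "vdom A v' = vcod A v" "vdom A w' = vcod A w"
    unfolding d d' using cor[of \<alpha>] cor[of \<beta>] m by simp_all
  have T: "\<guillemotleft>T \<alpha> : g\<^sub>* \<bullet> v \<Rightarrow> w \<bullet> f\<^sub>*\<guillemotright>" "\<guillemotleft>T \<beta> : h\<^sub>* \<bullet> v' \<Rightarrow> w' \<bullet> g\<^sub>*\<guillemotright>"
    using transpose_boundary[of \<alpha>] transpose_boundary[of \<beta>] unfolding d d' by (simp_all add: m)
  have p: "hidc A v' \<oslash> \<psi> h \<parallel> T \<beta> = \<psi> g \<oslash> \<beta>" and c: "T \<alpha> \<parallel> \<chi> f \<oslash> hidc A w = \<alpha> \<oslash> \<chi> g"
    using psi_transpose(1)[of \<beta>] psi_transpose(2)[of \<alpha>] unfolding d d' by (simp_all add: m)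
  have b: "cleft A \<alpha> = v" "cright A \<alpha> = w" "ctop A \<alpha> = f" "cbot A \<alpha> = g"
    "cleft A \<beta> = v'" "cright A \<beta> = w'" "ctop A \<beta> = g" "cbot A \<beta> = h"
    by (simp_all add: d d' m)
  note [simp] = b globularD(1-3)[OF T(1)] globularD(1-3)[OF T(2)]
  have [simp]: "ctop A (T \<alpha>) = hid A (vdom A v)" "cbot A (T \<alpha>) = hid A (vcod A w)"
    "ctop A (T \<beta>) = hid A (vcod A v)" "cbot A (T \<beta>) = hid A (vcod A w')"
    using globularD(8,9)[OF T(1)] globularD(8,9)[OF T(2)] by simp_all
  have 1: "hidc A (v' \<bullet> v) \<oslash> \<psi> h \<parallel> assoc_inv h\<^sub>* v' v = hidc A v \<oslash> (hidc A v' \<oslash> \<psi> h)"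
    using assoc_inv_natural[of "hidc A v" "hidc A v'" "\<psi> h"] by simp
  have 2: "hidc A v \<oslash> (hidc A v' \<oslash> \<psi> h) \<parallel> hidc A v \<oslash> T \<beta> = hidc A v \<oslash> (\<psi> g \<oslash> \<beta>)"
    using interchange[of "hidc A v" "hidc A v" "hidc A v' \<oslash> \<psi> h" "T \<beta>"] by (simp add: p)
  have 3: "hidc A v \<oslash> (\<psi> g \<oslash> \<beta>) \<parallel> assoc A w' g\<^sub>* v = hidc A v \<oslash> \<psi> g \<oslash> \<beta>"
    using assoc_natural[of "hidc A v" "\<psi> g" \<beta>] by simp
  have 4: "assoc_inv w' w f\<^sub>* \<parallel> \<chi> f \<oslash> hidc A (w' \<bullet> w) = \<chi> f \<oslash> hidc A w \<oslash> hidc A w'"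
    using assoc_inv_natural[of "\<chi> f" "hidc A w" "hidc A w'"] by simp
  have 5: "T \<alpha> \<oslash> hidc A w' \<parallel> \<chi> f \<oslash> hidc A w \<oslash> hidc A w' = \<alpha> \<oslash> \<chi> g \<oslash> hidc A w'"
    using interchange[of "T \<alpha>" "\<chi> f \<oslash> hidc A w" "hidc A w'" "hidc A w'"] by (simp add: c)
  have 6: "hidc A v \<oslash> \<psi> g \<oslash> \<beta> \<parallel> \<alpha> \<oslash> \<chi> g \<oslash> hidc A w' = \<alpha> \<oslash> \<beta>"
    using interchange[of "hidc A v \<oslash> \<psi> g" "\<alpha> \<oslash> \<chi> g" \<beta> "hidc A w'"]
      interchange[of "hidc A v" \<alpha> "\<psi> g" "\<chi> g"] by simp
  let ?S' = "assoc_inv h\<^sub>* v' v \<parallel> (hidc A v \<oslash> T \<beta> \<parallel> (assoc A w' g\<^sub>* v \<parallel> (T \<alpha> \<oslash> hidc A w' \<parallel> assoc_inv w' w f\<^sub>*)))"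
  have "fold_companions h (v' \<bullet> v) ?S' (w' \<bullet> w) f = \<alpha> \<oslash> \<beta>"
    unfolding fold_companions_def
    by (simp add: hpaste_assoc hpaste_eq_assoc[OF 1] hpaste_eq_assoc[OF 2] hpaste_eq_assoc[OF 3] 4 5 6)
  moreover have "\<guillemotleft>?S' : h\<^sub>* \<bullet> (v' \<bullet> v) \<Rightarrow> w' \<bullet> w \<bullet> f\<^sub>*\<guillemotright>"
    unfolding is_globular_def by simp
  ultimately show ?thesis
    using fold_boundary(6)[of f h "v' \<bullet> v" "w' \<bullet> w" ?S'] by simp
qed

text \<open>
  The direction of 2-cells is reversed for retrocells, so splitting and joining change roles.
\<close>

lemma ret_split_join:
  assumes a [simp]: "f \<in> Hor A" "h \<in> Hor A" "hcod A f = hdom A h"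
  shows "cmp_split B L h f = retro (cmp_join A K h f)" "cmp_join B L h f = retro (cmp_split A K h f)"
proof -
  have g: "\<guillemotleft>cmp_join A K h f : h\<^sub>* \<bullet> f\<^sub>* \<Rightarrow> (h \<cdot> f)\<^sub>*\<guillemotright>" "\<guillemotleft>cmp_split A K h f : (h \<cdot> f)\<^sub>* \<Rightarrow> h\<^sub>* \<bullet> f\<^sub>*\<guillemotright>"
    by (simp_all add: cmp_split_join)
  note [simp] = splitsD(7-11)[OF splits_cmp_split[OF a]] joinsD(7-11)[OF joins_cmp_join[OF a]]
  have m: "Retrocell e (vid A (hdom A e)) (vid A (hcod A e)) e (hidc A e\<^sub>*) \<in> retrocells A K"
    "Retrocell (hid A (hdom A e)) (vid A (hdom A e)) e\<^sub>* e (hidc A e\<^sub>*) \<in> retrocells A K"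
    "Retrocell e e\<^sub>* (vid A (hcod A e)) (hid A (hcod A e)) (hidc A e\<^sub>*) \<in> retrocells A K"
    if "e \<in> Hor A" for e
    using that by (simp_all add: retrocell_iff)
  note mf = m[OF a(1)] and mh = m[OF a(2), folded a(3)]
  have mhf: "Retrocell (hid A (hdom A f)) (vid A (hdom A f)) (h \<cdot> f)\<^sub>* (h \<cdot> f) (hidc A (h \<cdot> f)\<^sub>*) \<in> retrocells A K"
    "Retrocell (h \<cdot> f) (h \<cdot> f)\<^sub>* (vid A (hcod A h)) (hid A (hcod A h)) (hidc A (h \<cdot> f)\<^sub>*) \<in> retrocells A K"
    using m(2,3)[of "h \<cdot> f"] by simp_all
  have 1: "vidc B f \<parallel>\<^bsub>B\<^esub> psi L h = Retrocell f (vid A (hdom A f)) h\<^sub>* (h \<cdot> f) (cmp_join A K h f)"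
    and m1: "Retrocell f (vid A (hdom A f)) h\<^sub>* (h \<cdot> f) (cmp_join A K h f) \<in> retrocells A K"
    using ret_hpaste_eq[OF mf(1) mh(2)]
    by (simp_all add: quintet_hcomp_def prolong_def prolong_join(1)[OF joins_cmp_join])
  have 2: "chi L f \<parallel>\<^bsub>B\<^esub> vidc B h = Retrocell (h \<cdot> f) f\<^sub>* (vid A (hcod A h)) h (cmp_split A K h f)"
    and m2: "Retrocell (h \<cdot> f) f\<^sub>* (vid A (hcod A h)) h (cmp_split A K h f) \<in> retrocells A K"
    using ret_hpaste_eq[OF mf(3) mh(1)]
    by (simp_all add: quintet_hcomp_def prolong_def prolong_join_def)
  have 3: "psi L f \<oslash>\<^bsub>B\<^esub> (vidc B f \<parallel>\<^bsub>B\<^esub> psi L h) =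
      Retrocell (hid A (hdom A f)) (vid A (hdom A f)) (h\<^sub>* \<bullet> f\<^sub>*) (h \<cdot> f) (cmp_join A K h f)"
    and m3: "Retrocell (hid A (hdom A f)) (vid A (hdom A f)) (h\<^sub>* \<bullet> f\<^sub>*) (h \<cdot> f) (cmp_join A K h f) \<in> retrocells A K"
    unfolding 1 using ret_vpaste_eq[OF mf(2) m1] by (simp_all add: quintet_vcomp_def prolong_def)
  show "cmp_split B L h f = retro (cmp_join A K h f)"
    unfolding cmp_split_def[of B] 3 retro_eq(1)[OF g(1)] using ret_vpaste_eq(1)[OF m3 mhf(2)]
    by (simp add: quintet_vcomp_def prolong_def)
  have 4: "(chi L f \<parallel>\<^bsub>B\<^esub> vidc B h) \<oslash>\<^bsub>B\<^esub> chi L h =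
      Retrocell (h \<cdot> f) (h\<^sub>* \<bullet> f\<^sub>*) (vid A (hcod A h)) (hid A (hcod A h)) (cmp_split A K h f)"
    and m4: "Retrocell (h \<cdot> f) (h\<^sub>* \<bullet> f\<^sub>*) (vid A (hcod A h)) (hid A (hcod A h)) (cmp_split A K h f) \<in> retrocells A K"
    unfolding 2 using ret_vpaste_eq[OF m2, of "h\<^sub>*" "vid A (hcod A h)" "hid A (hcod A h)" "hidc A h\<^sub>*"] mh(3)
    by (simp_all add: quintet_vcomp_def prolong_def)
  show "cmp_join B L h f = retro (cmp_split A K h f)"
    unfolding cmp_join_def[of B] ret_simps(8) 4 retro_eq(1)[OF g(2)] using ret_vpaste_eq(1)[OF mhf(1) m4]
    by (simp add: quintet_vcomp_def prolong_def)
qed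

lemma ret_companions: "double_category_with_companions B L"
  by (simp add: double_category_with_companions_def double_category_with_companions_axioms_def
      double_category_ret companion_choice_ret)

abbreviation F where "F \<equiv> to_ret_ret A K"

lemma retretcell_iff:
  "Retrocell f v w g r \<in> retrocells B L \<longleftrightarrow>
     f \<in> Hor A \<and> g \<in> Hor A \<and> v \<in> Ver A \<and> w \<in> Ver A \<and>
     hdom A f = vdom A v \<and> hcod A f = vdom A w \<and> hdom A g = vcod A v \<and> hcod A g = vcod A w \<and>
     (\<exists>\<sigma>. r = retro \<sigma> \<and> \<guillemotleft>\<sigma> : g\<^sub>* \<bullet> v \<Rightarrow> w \<bullet> f\<^sub>*\<guillemotright>)"
  using double_category_with_companions.retrocell_iff[OF ret_companions, of f v w g r]
  by (simp add: globular_ret_iff)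

lemma on_cell_eq:
  assumes "\<alpha> \<in> Cell A"
  shows "on_cell F \<alpha> = Retrocell (ctop A \<alpha>) (cleft A \<alpha>) (cright A \<alpha>) (cbot A \<alpha>) (retro (T \<alpha>))"
    and "on_cell F \<alpha> \<in> retrocells B L"
proof -
  show 1: "on_cell F \<alpha> = Retrocell (ctop A \<alpha>) (cleft A \<alpha>) (cright A \<alpha>) (cbot A \<alpha>) (retro (T \<alpha>))"
    using assms retro_eq(1)[OF transpose_boundary[OF assms]]
    by (simp add: to_ret_ret_def Let_def corner_tl corner_tr corner_bl corner_br)
  show "on_cell F \<alpha> \<in> retrocells B L"
    unfolding 1 retretcell_iff using assms transpose_boundary[OF assms]
    by (auto simp: corner_tl corner_tr corner_bl corner_br)
qed

lemma retro_hinv: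
  assumes "inverse_cells \<sigma> \<sigma>' b a"
  shows "hinv B (retro \<sigma>) = retro \<sigma>'"
proof (rule double_category.hinv_eq[OF double_category_ret _ retro_inverse[OF assms]])
  show "retro \<sigma> \<in> Cell B"
    using assms retro_eq(3)[of \<sigma> b a] by (simp add: inverse_cells_def)
qed

lemma ret_hinv_assoc:
  assumes "v \<in> Ver A" "w \<in> Ver A" "x \<in> Ver A" "vcod A v = vdom A w" "vcod A w = vdom A x"
  shows "hinv B (assoc B x w v) = retro (assoc A x w v)"
  unfolding retro_assoc[OF assms]
proof (rule retro_hinv)
  show "inverse_cells (assoc_inv x w v) (assoc A x w v) (x \<bullet> (w \<bullet> v)) (x \<bullet> w \<bullet> v)"
    using inverse_cells_assoc[OF assms] unfolding inverse_cells_def by blast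
qed

lemma on_cell_hpaste:
  assumes [simp]: "\<alpha> \<in> Cell A" "\<beta> \<in> Cell A" and m: "cright A \<alpha> = cleft A \<beta>"
  shows "on_cell F (\<alpha> \<parallel> \<beta>) = ret_hpaste B L (on_cell F \<alpha>) (on_cell F \<beta>)"
proof -
  define f v w g where d: "f = ctop A \<alpha>" "v = cleft A \<alpha>" "w = cright A \<alpha>" "g = cbot A \<alpha>"
  define h x k where d': "h = ctop A \<beta>" "x = cright A \<beta>" "k = cbot A \<beta>"
  note cor = corner_tl corner_tr corner_bl corner_br
  have [simp]: "f \<in> Hor A" "g \<in> Hor A" "h \<in> Hor A" "k \<in> Hor A" "v \<in> Ver A" "w \<in> Ver A" "x \<in> Ver A"
    "hdom A f = vdom A v" "hcod A f = vdom A w" "hdom A g = vcod A v" "hcod A g = vcod A w"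
    "hdom A h = vdom A w" "hcod A h = vdom A x" "hdom A k = vcod A w" "hcod A k = vcod A x"
    unfolding d d' by (simp_all add: cor) (simp_all add: m cor)
  have b: "cleft A \<alpha> = v" "cright A \<alpha> = w" "ctop A \<alpha> = f" "cbot A \<alpha> = g"
    "cleft A \<beta> = w" "cright A \<beta> = x" "ctop A \<beta> = h" "cbot A \<beta> = k"
    by (simp_all add: d d' m)
  note [simp] = b
  have T: "\<guillemotleft>T \<alpha> : g\<^sub>* \<bullet> v \<Rightarrow> w \<bullet> f\<^sub>*\<guillemotright>" "\<guillemotleft>T \<beta> : k\<^sub>* \<bullet> w \<Rightarrow> x \<bullet> h\<^sub>*\<guillemotright>"
    using transpose_boundary[of \<alpha>] transpose_boundary[of \<beta>] by simp_all
  have g: "\<guillemotleft>cmp_join A K h f \<oslash> hidc A x : x \<bullet> (h\<^sub>* \<bullet> f\<^sub>*) \<Rightarrow> x \<bullet> (h \<cdot> f)\<^sub>*\<guillemotright>"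
    "\<guillemotleft>assoc A x h\<^sub>* f\<^sub>* : x \<bullet> h\<^sub>* \<bullet> f\<^sub>* \<Rightarrow> x \<bullet> (h\<^sub>* \<bullet> f\<^sub>*)\<guillemotright>"
    "\<guillemotleft>hidc A f\<^sub>* \<oslash> T \<beta> : k\<^sub>* \<bullet> w \<bullet> f\<^sub>* \<Rightarrow> x \<bullet> h\<^sub>* \<bullet> f\<^sub>*\<guillemotright>"
    "\<guillemotleft>assoc_inv k\<^sub>* w f\<^sub>* : k\<^sub>* \<bullet> (w \<bullet> f\<^sub>*) \<Rightarrow> k\<^sub>* \<bullet> w \<bullet> f\<^sub>*\<guillemotright>"
    "\<guillemotleft>T \<alpha> \<oslash> hidc A k\<^sub>* : k\<^sub>* \<bullet> (g\<^sub>* \<bullet> v) \<Rightarrow> k\<^sub>* \<bullet> (w \<bullet> f\<^sub>*)\<guillemotright>"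
    "\<guillemotleft>assoc A k\<^sub>* g\<^sub>* v : k\<^sub>* \<bullet> g\<^sub>* \<bullet> v \<Rightarrow> k\<^sub>* \<bullet> (g\<^sub>* \<bullet> v)\<guillemotright>"
    "\<guillemotleft>hidc A v \<oslash> cmp_split A K k g : (k \<cdot> g)\<^sub>* \<bullet> v \<Rightarrow> k\<^sub>* \<bullet> g\<^sub>* \<bullet> v\<guillemotright>"
    by (simp_all add: globular_vpaste T cmp_split_join)
  note c1 = g(1) and c2 = globular_hpaste[OF g(2,1)]
  note c3 = globular_hpaste[OF g(3) c2] note c4 = globular_hpaste[OF g(4) c3]
  note c5 = globular_hpaste[OF g(5) c4] note c6 = globular_hpaste[OF g(6) c5]
  have w: "ret_vpaste A K (retro (cmp_join A K h f)) (hidc B x) = retro (cmp_join A K h f \<oslash> hidc A x)"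
    "ret_vpaste A K (hidc B f\<^sub>*) (retro (T \<beta>)) = retro (hidc A f\<^sub>* \<oslash> T \<beta>)"
    "ret_vpaste A K (retro (T \<alpha>)) (hidc B k\<^sub>*) = retro (T \<alpha> \<oslash> hidc A k\<^sub>*)"
    "ret_vpaste A K (hidc B v) (retro (cmp_split A K k g)) = retro (hidc A v \<oslash> cmp_split A K k g)"
    using retro_vpaste[OF cmp_split_join(2)[of f h] hidc_boundary(6)[of x]]
      retro_vpaste[OF hidc_boundary(6)[of "f\<^sub>*"] T(2)] retro_vpaste[OF T(1) hidc_boundary(6)[of "k\<^sub>*"]]
      retro_vpaste[OF hidc_boundary(6)[of v] cmp_split_join(1)[of g k]]
    by (simp_all add: retro_hidc del: ret_simps(19) ret_vpaste.simps)
  have i: "hinv B (assoc B x h\<^sub>* f\<^sub>*) = retro (assoc A x h\<^sub>* f\<^sub>*)" "hinv B (assoc B k\<^sub>* g\<^sub>* v) = retro (assoc A k\<^sub>* g\<^sub>* v)"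
    "assoc B k\<^sub>* w f\<^sub>* = retro (assoc_inv k\<^sub>* w f\<^sub>*)"
    by (rule ret_hinv_assoc retro_assoc; simp)+
  have s: "cmp_split B L h f = retro (cmp_join A K h f)" "cmp_join B L k g = retro (cmp_split A K k g)"
    by (rule ret_split_join; simp)+
  have "ret_hpaste B L (on_cell F \<alpha>) (on_cell F \<beta>) = Retrocell (h \<cdot> f) v x (k \<cdot> g) (retro (T (\<alpha> \<parallel> \<beta>)))"
    unfolding on_cell_eq(1)[OF assms(1)] on_cell_eq(1)[OF assms(2)] b ret_hpaste.simps
      transpose_hpaste[OF assms] s ret_simps(8,17,18,22) w i
    unfolding retro_hpaste[OF c1 g(2)] retro_hpaste[OF c2 g(3)] retro_hpaste[OF c3 g(4)]
      retro_hpaste[OF c4 g(5)] retro_hpaste[OF c5 g(6)] retro_hpaste[OF c6 g(7)] ..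
  then show ?thesis
    by (simp add: on_cell_eq(1) m)
qed

lemma on_cell_vpaste:
  assumes [simp]: "\<alpha> \<in> Cell A" "\<beta> \<in> Cell A" and m: "cbot A \<alpha> = ctop A \<beta>"
  shows "on_cell F (\<alpha> \<oslash> \<beta>) = ret_vpaste B L (on_cell F \<alpha>) (on_cell F \<beta>)"
proof -
  define f v w g where d: "f = ctop A \<alpha>" "v = cleft A \<alpha>" "w = cright A \<alpha>" "g = cbot A \<alpha>"
  define h v' w' where d': "h = cbot A \<beta>" "v' = cleft A \<beta>" "w' = cright A \<beta>"
  note cor = corner_tl corner_tr corner_bl corner_br
  have [simp]: "f \<in> Hor A" "g \<in> Hor A" "h \<in> Hor A" "v \<in> Ver A" "w \<in> Ver A" "v' \<in> Ver A" "w' \<in> Ver A"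
    "hdom A f = vdom A v" "hcod A f = vdom A w" "hdom A g = vcod A v" "hcod A g = vcod A w"
    "hdom A h = vcod A v'" "hcod A h = vcod A w'" "vdom A v' = vcod A v" "vdom A w' = vcod A w"
    unfolding d d' using cor[of \<alpha>] cor[of \<beta>] m by simp_all
  have b: "cleft A \<alpha> = v" "cright A \<alpha> = w" "ctop A \<alpha> = f" "cbot A \<alpha> = g"
    "cleft A \<beta> = v'" "cright A \<beta> = w'" "ctop A \<beta> = g" "cbot A \<beta> = h"
    by (simp_all add: d d' m)
  note [simp] = b
  have T: "\<guillemotleft>T \<alpha> : g\<^sub>* \<bullet> v \<Rightarrow> w \<bullet> f\<^sub>*\<guillemotright>" "\<guillemotleft>T \<beta> : h\<^sub>* \<bullet> v' \<Rightarrow> w' \<bullet> g\<^sub>*\<guillemotright>"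
    using transpose_boundary[of \<alpha>] transpose_boundary[of \<beta>] by simp_all
  have g: "\<guillemotleft>assoc_inv w' w f\<^sub>* : w' \<bullet> (w \<bullet> f\<^sub>*) \<Rightarrow> w' \<bullet> w \<bullet> f\<^sub>*\<guillemotright>"
    "\<guillemotleft>T \<alpha> \<oslash> hidc A w' : w' \<bullet> (g\<^sub>* \<bullet> v) \<Rightarrow> w' \<bullet> (w \<bullet> f\<^sub>*)\<guillemotright>"
    "\<guillemotleft>assoc A w' g\<^sub>* v : w' \<bullet> g\<^sub>* \<bullet> v \<Rightarrow> w' \<bullet> (g\<^sub>* \<bullet> v)\<guillemotright>"
    "\<guillemotleft>hidc A v \<oslash> T \<beta> : h\<^sub>* \<bullet> v' \<bullet> v \<Rightarrow> w' \<bullet> g\<^sub>* \<bullet> v\<guillemotright>"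
    "\<guillemotleft>assoc_inv h\<^sub>* v' v : h\<^sub>* \<bullet> (v' \<bullet> v) \<Rightarrow> h\<^sub>* \<bullet> v' \<bullet> v\<guillemotright>"
    by (simp_all add: globular_vpaste T)
  note c1 = g(1) and c2 = globular_hpaste[OF g(2,1)]
  note c3 = globular_hpaste[OF g(3) c2] note c4 = globular_hpaste[OF g(4) c3]
  have w: "ret_vpaste A K (retro (T \<alpha>)) (hidc B w') = retro (T \<alpha> \<oslash> hidc A w')"
    "ret_vpaste A K (hidc B v) (retro (T \<beta>)) = retro (hidc A v \<oslash> T \<beta>)"
    using retro_vpaste[OF T(1) hidc_boundary(6)[of w']] retro_vpaste[OF hidc_boundary(6)[of v] T(2)]
    by (simp_all add: retro_hidc del: ret_simps(19) ret_vpaste.simps)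
  have i: "hinv B (assoc B w' g\<^sub>* v) = retro (assoc A w' g\<^sub>* v)"
    "assoc B w' w f\<^sub>* = retro (assoc_inv w' w f\<^sub>*)" "assoc B h\<^sub>* v' v = retro (assoc_inv h\<^sub>* v' v)"
    by (rule ret_hinv_assoc retro_assoc; simp)+
  have "ret_vpaste B L (on_cell F \<alpha>) (on_cell F \<beta>) = Retrocell f (v' \<bullet> v) (w' \<bullet> w) h (retro (T (\<alpha> \<oslash> \<beta>)))"
    unfolding on_cell_eq(1)[OF assms(1)] on_cell_eq(1)[OF assms(2)] b ret_vpaste.simps
      transpose_vpaste[OF assms] ret_simps(12,17,18,22) w i
    unfolding retro_hpaste[OF c1 g(2)] retro_hpaste[OF c2 g(3)] retro_hpaste[OF c3 g(4)]
      retro_hpaste[OF c4 g(5)] ..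
  then show ?thesis
    by (simp add: on_cell_eq(1) m)
qed

abbreviation BB where "BB \<equiv> ret B L"

abbreviation LL where "LL \<equiv> ret_companions B L"

lemma ret_ret_simps:
  "Obj BB = Obj A" "Hor BB = Hor A" "Ver BB = Ver A" "Cell BB = retrocells B L"
  "hdom BB = hdom A" "hcod BB = hcod A" "hid BB = hid A" "hcomp BB = hcomp A"
  "vdom BB = vdom A" "vcod BB = vcod A" "vid BB = vid A" "vcomp BB = vcomp A"
  "ctop BB = rtop" "cbot BB = rbot" "cleft BB = rleft" "cright BB = rright"
  "hpaste BB = ret_hpaste B L" "vpaste BB = ret_vpaste B L"
  "hidc BB v = Retrocell (hid A (vdom A v)) v v (hid A (vcod A v)) (hidc B v)"
  "vidc BB f = Retrocell f (vid A (hdom A f)) (vid A (hcod A f)) f (hidc B f\<^sub>*)"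
  "assoc BB x w v = Retrocell (hid A (vdom A v)) (x \<bullet> w \<bullet> v) (x \<bullet> (w \<bullet> v)) (hid A (vcod A x)) (hinv B (assoc B x w v))"
  "cmp LL = cmp K"
  "psi LL f = Retrocell (hid A (hdom A f)) (vid A (hdom A f)) f\<^sub>* f (hidc B f\<^sub>*)"
  "chi LL f = Retrocell f f\<^sub>* (vid A (hcod A f)) (hid A (hcod A f)) (hidc B f\<^sub>*)"
  by (simp_all only: double_category_with_companions.ret_simps[OF ret_companions] ret_simps(1-18,22))

lemma on_arrows: "on_obj F X = X" "on_hor F f = f" "on_ver F v = v"
  by (simp_all add: to_ret_ret_def)

lemma double_category_ret_ret: "double_category BB" "companion_choice BB LL"
  by (rule double_category_with_companions.double_category_ret[OF ret_companions]
      double_category_with_companions.companion_choice_ret[OF ret_companions])+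

lemma double_functor_to_ret_ret: "double_functor A BB F"
proof -
  interpret BB: double_category BB by (rule double_category_ret_ret)
  show ?thesis
  proof unfold_locales
    show "on_cell F (hidc A v) = hidc BB (on_ver F v)" if "v \<in> Ver A" for v
    proof -
      have "T (hidc A v) = hidc A v" using that by (simp add: companion_transpose_def)
      then show ?thesis
        using that by (simp add: on_cell_eq(1) on_arrows ret_ret_simps retro_hidc del: ret_simps)
    qed
    show "on_cell F (vidc A f) = vidc BB (on_hor F f)" if "f \<in> Hor A" for f
    proof -
      have "T (vidc A f) = hidc A f\<^sub>*" using that by (simp add: companion_transpose_def)
      then show ?thesis
        using that by (simp add: on_cell_eq(1) on_arrows ret_ret_simps retro_hidc del: ret_simps)
    qed
    show "on_cell F (assoc A x w v) = assoc BB (on_ver F x) (on_ver F w) (on_ver F v)"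
      if "v \<in> Ver A" "w \<in> Ver A" "x \<in> Ver A" "vcod A v = vdom A w" "vcod A w = vdom A x" for v w x
    proof -
      have "T (assoc A x w v) = assoc A x w v" using that by (simp add: companion_transpose_def)
      then show ?thesis
        using that by (simp add: on_cell_eq(1) on_arrows ret_ret_simps ret_hinv_assoc del: ret_simps)
    qed
    show "on_cell F (\<alpha> \<parallel> \<beta>) = on_cell F \<alpha> \<parallel>\<^bsub>BB\<^esub> on_cell F \<beta>"
      if "\<alpha> \<in> Cell A" "\<beta> \<in> Cell A" "cright A \<alpha> = cleft A \<beta>" for \<alpha> \<beta>
      using on_cell_hpaste[OF that] by (simp add: ret_ret_simps)
    show "on_cell F (\<alpha> \<oslash> \<beta>) = on_cell F \<alpha> \<oslash>\<^bsub>BB\<^esub> on_cell F \<beta>"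
      if "\<alpha> \<in> Cell A" "\<beta> \<in> Cell A" "cbot A \<alpha> = ctop A \<beta>" for \<alpha> \<beta>
      using on_cell_vpaste[OF that] by (simp add: ret_ret_simps)
  qed (simp_all only: ret_ret_simps on_arrows on_cell_eq(2), simp_all add: on_cell_eq(1))
qed

text \<open>
  The two applications of \<open>rcell\<close> strip the two layers of retrocells, down to a globular cell of
  the original double category.
\<close>

definition from_ret_ret where
  "from_ret_ret = \<lparr>on_obj = (\<lambda>X. X), on_hor = (\<lambda>f. f), on_ver = (\<lambda>v. v),
     on_cell = (\<lambda>r. fold_companions (rbot r) (rleft r) (rcell (rcell r)) (rright r) (rtop r))\<rparr>"

lemma iso_to_ret_ret: "iso_with_companions A K BB LL F"
proof -
  let ?G = "from_ret_ret"
  have G: "on_obj ?G X = X" "on_hor ?G f = f" "on_ver ?G v = v"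
    "on_cell ?G (Retrocell f v w g (retro \<sigma>)) = fold_companions g v \<sigma> w f" for X f v w g \<sigma>
    by (simp_all add: from_ret_ret_def retro_def)
  have GF: "inverse_on A F ?G"
    unfolding inverse_on_def by (simp add: on_arrows G on_cell_eq(1) fold_transpose)
  have cell: "on_cell ?G r \<in> Cell A \<and> on_cell F (on_cell ?G r) = r" if r: "r \<in> Cell BB" for r
  proof -
    obtain f v w g s where e: "r = Retrocell f v w g s" by (cases r)
    with r obtain \<sigma> where s: "s = retro \<sigma>" and c: "f \<in> Hor A" "g \<in> Hor A" "v \<in> Ver A" "w \<in> Ver A"
      "hdom A f = vdom A v" "hcod A f = vdom A w" "hdom A g = vcod A v" "hcod A g = vcod A w"
      "\<guillemotleft>\<sigma> : g\<^sub>* \<bullet> v \<Rightarrow> w \<bullet> f\<^sub>*\<guillemotright>"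
      unfolding ret_ret_simps(4) by (auto simp: retretcell_iff)
    show ?thesis
      unfolding e s G by (simp add: on_cell_eq(1) fold_boundary[OF c])
  qed
  have FG: "inverse_on BB ?G F"
    unfolding inverse_on_def using cell by (auto simp: on_arrows G(1-3))
  have pF: "preserves_companions A K LL F"
    unfolding preserves_companions_def
  proof (intro ballI conjI)
    fix f assume f [simp]: "f \<in> Hor A"
    have t: "T (\<psi> f) = hidc A f\<^sub>*" "T (\<chi> f) = hidc A f\<^sub>*"
      by (simp_all add: companion_transpose_def)
    show "on_ver F f\<^sub>* = cmp LL (on_hor F f)"
      by (simp add: on_arrows ret_ret_simps)
    show "on_cell F (\<psi> f) = psi LL (on_hor F f)" "on_cell F (\<chi> f) = chi LL (on_hor F f)"
      by (simp_all add: on_arrows on_cell_eq(1) t ret_ret_simps(23,24) retro_hidc del: ret_simps)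
  qed
  have pG: "preserves_companions BB LL K ?G"
    using pF GF unfolding preserves_companions_def inverse_on_def
    by (simp add: on_arrows G ret_ret_simps(2,22)) (metis companion(4,9))
  have dG: "double_functor BB A ?G"
    by (rule double_functor_inverse[OF double_functor_to_ret_ret GF FG])
      (use cell in \<open>auto simp: G(1-3) ret_ret_simps(1-3)\<close>)
  show ?thesis
    unfolding iso_with_companions_def
    using companions double_category_ret_ret double_functor_to_ret_ret pF dG pG GF FG by blast
qed

end

theorem theorem2p2:
  fixes A :: "('o, 'h, 'v, 'c) dblcat" and K :: "('h, 'v, 'c) companions"
  assumes "double_category A" and "companion_choice A K"
  shows "double_category (ret A K) \<and>
         companion_choice (ret A K) (ret_companions A K) \<and>
         iso_with_companions A K
           (ret (ret A K) (ret_companions A K))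
           (ret_companions (ret A K) (ret_companions A K))
           (to_ret_ret A K) \<and>
         (\<forall>X \<in> Obj A. on_obj (to_ret_ret A K) X = X) \<and>
         (\<forall>f \<in> Hor A. on_hor (to_ret_ret A K) f = f) \<and>
         (\<forall>v \<in> Ver A. on_ver (to_ret_ret A K) v = v)"
proof -
  interpret double_category_with_companions A K
    using assms by (simp add: double_category_with_companions_def double_category_with_companions_axioms_def)
  show ?thesis
    using double_category_ret companion_choice_ret iso_to_ret_ret on_arrows by blast
qed

end
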